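(* Let $F^{n}=(M^{n},L)$ be a Finsler space, let $b_i(x,y)$ be an $h$-vector in $F^n$, and let ${}^{*}F^{n}=(M^{n},{}^{*}L)$ be the Finsler space obtained by the Kropina change with $h$-vector ${}^{*}L(x,y)=L^2(x,y)/(b_i(x,y)y^i)$. Let $F^{n-1}$ and ${}^{*}F^{n-1}$ be the Finslerian hypersurfaces of $F^n$ and ${}^{*}F^n$, respectively, with the same underlying hypersurface $M^{n-1}$ of $M^n$. Suppose that the $h$-vector $b_i$ is a gradient, is tangential to the hypersurface $F^{n-1}$, and satisfies $$b_{r|0}\,C^{r}_{ij}=0,\qquad\text{where } b_{r|0}=b_{r|k}\,y^k.$$ Then: 1. ${}^{*}F^{n-1}$ is a hyperplane of the second kind if $F^{n-1}$ is a hyperplane of the second kind and $M_{\alpha\beta}=0$, where $M_{\alpha\beta}$ is the second fundamental $v$-tensor of $F^{n-1}$. 2. ${}^{*}F^{n-1}$ is a hyperplane of the third kind if $F^{n-1}$ is a hyperplane of the third kind.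
   Context: Notation: $\partial_i=\partial/\partial x^i$, $\dot\partial_i=\partial/\partial y^i$; the summation convention is used. Latin indices run over $1,\dots,n$, Greek indices over $1,\dots,n-1$. Finsler space: $F^n=(M^n,L)$ is an $n$-dimensional smooth manifold with Finsler metric function $L(x,y)$. Set $l_i=\dot\partial_iL$, $g_{ij}=\tfrac12\dot\partial_i\dot\partial_jL^2$, $h_{ij}=L\,\dot\partial_i\dot\partial_jL$, $C_{ijk}=\tfrac12\dot\partial_kg_{ij}$, $C^{h}_{ij}=g^{hk}C_{ijk}$. Cartan connection $C\Gamma=(F^i_{jk},G^i_j,C^i_{jk})$ of $F^n$: $G^i=\tfrac14g^{ir}(y^j\dot\partial_r\partial_jL^2-\partial_rL^2)$, $G^i_j=\dot\partial_jG^i$, and with $\delta_k=\partial_k-G^h_k\dot\partial_h$, $F^i_{jk}=\tfrac12g^{ir}(\delta_kg_{rj}+\delta_jg_{rk}-\delta_rg_{jk})$. For a covariant vector field $X_i(x,y)$ the $h$- and $v$-covariant derivatives are $X_{i|j}=\partial_jX_i-(\dot\partial_hX_i)G^h_j-F^r_{ij}X_r$ and $X_i|_j=\dot\partial_jX_i-C^r_{ij}X_r$. $h$-vector: $b_i(x,y)$ is an $h$-vector in $F^n$ if (i) $b_i|_k=0$ and (ii) $L\,C^h_{ij}b_h=\rho\,h_{ij}$ for a scalar function $\rho\neq0$. (By a known result of Izumi, $\rho$ is independent of $y$.) It is a gradient if $b_{i|j}=b_{j|i}$. Kropina change: put $\beta=b_iy^i$ (nonzero where ${}^{*}L$ is considered).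 ${}^{*}F^n=(M^n,{}^{*}L)$ is assumed to be a Finsler space; quantities marked with an asterisk are those formed from ${}^{*}L$ in the same way. Hypersurface: $M^{n-1}$ is given by $x^i=x^i(u^\alpha)$, with $B^i_\alpha=\partial x^i/\partial u^\alpha$ of rank $n-1$; the supporting element is tangent to $M^{n-1}$: $y^i=B^i_\alpha(u)v^\alpha$. $F^{n-1}=(M^{n-1},\underline L)$ with $\underline L(u,v)=L(x(u),y(u,v))$, and ${}^{*}F^{n-1}=(M^{n-1},{}^{*}\underline L)$ with ${}^{*}\underline L(u,v)={}^{*}L(x(u),y(u,v))$. Ambient quantities are evaluated at $(x(u),y(u,v))$. The unit normal $N^i(u,v)$ of $F^{n-1}$ is defined by $g_{ij}B^i_\alpha N^j=0$, $g_{ij}N^iN^j=1$, and $N_i=g_{ij}N^j$; similarly ${}^{*}N^i$ for ${}^{*}F^{n-1}$ using ${}^{*}g_{ij}$, and ${}^{*}N_i={}^{*}g_{ij}{}^{*}N^j$. The vector $b_i$ is tangential to $F^{n-1}$ if $b_iN^i=0$ along $F^{n-1}$. Fundamental tensors of $F^{n-1}$: with $B^i_{\alpha\beta}=\partial^2x^i/\partial u^\alpha\partial u^\beta$ and $B^i_{0\alpha}=B^i_{\beta\alpha}v^\beta$, put $M_\alpha=C_{ijk}B^i_\alpha N^jN^k$, $H_\alpha=N_i(B^i_{0\alpha}+G^i_jB^j_\alpha)$ (normal curvature vector), $H_{\alpha\beta}=N_i(B^i_{\alpha\beta}+F^i_{jk}B^j_\alpha B^k_\beta)+M_\alpha H_\beta$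 (second fundamental $h$-tensor), $M_{\alpha\beta}=C_{ijk}B^i_\alpha B^j_\beta N^k$ (second fundamental $v$-tensor). For ${}^{*}F^{n-1}$ the tensors ${}^{*}M_\alpha,{}^{*}H_\alpha,{}^{*}H_{\alpha\beta},{}^{*}M_{\alpha\beta}$ are given by the same formulas with ${}^{*}N,{}^{*}G,{}^{*}F,{}^{*}C$ and the same $B^i_\alpha$. Hyperplanes (Matsumoto's characterizations, to be taken as definitions): $F^{n-1}$ is a hyperplane of the second kind if and only if $H_{\alpha\beta}=0$, and a hyperplane of the third kind if and only if $H_{\alpha\beta}=0=M_{\alpha\beta}$; likewise for ${}^{*}F^{n-1}$ with the starred tensors. *)

theory Defs
  imports "HOL-Analysis.Analysis"
begin

section \<open>Partial derivatives and smoothness\<close>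

definition partial_deriv :: "'k::finite \<Rightarrow> (real^'k \<Rightarrow> real) \<Rightarrow> real^'k \<Rightarrow> real" where
  "partial_deriv i f x = deriv (\<lambda>t. f (x + t *\<^sub>R axis i 1)) 0"

text \<open>Both notions below are meant for open \<open>S\<close>.\<close>

primrec Ck_on :: "nat \<Rightarrow> 'a::euclidean_space set \<Rightarrow> ('a \<Rightarrow> 'b::real_normed_vector) \<Rightarrow> bool" where
  "Ck_on 0 S f \<longleftrightarrow> continuous_on S f"
| "Ck_on (Suc k) S f \<longleftrightarrow>
     f differentiable_on S \<and> (\<forall>e\<in>Basis. Ck_on k S (\<lambda>x. frechet_derivative f (at x) e))"

definition smooth_on :: "'a::euclidean_space set \<Rightarrow> ('a \<Rightarrow> 'b::real_normed_vector) \<Rightarrow> bool" where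
  "smooth_on S f \<longleftrightarrow> (\<forall>k. Ck_on k S f)"

text \<open>\<open>(x, y) \<mapsto> (f x, tangent_lift f x y)\<close> is the tangent map of \<open>f\<close>.\<close>

definition tangent_lift :: "(real^'k::finite \<Rightarrow> real^'n::finite) \<Rightarrow> real^'k \<Rightarrow> real^'k \<Rightarrow> real^'n" where
  "tangent_lift f x y = (\<chi> i. \<Sum>j\<in>UNIV. partial_deriv j (\<lambda>z. f z $ i) x * y $ j)"


section \<open>Smooth manifolds\<close>

text \<open>A chart is a domain together with its coordinate map; only the values of the map on the
  domain matter.\<close>

type_synonym ('p, 'n) chart = "'p set \<times> ('p \<Rightarrow> real^'n)"

definition is_chart :: "'p topology \<Rightarrow> ('p, 'n::finite) chart \<Rightarrow> bool" where
  "is_chart M c \<longleftrightarrow> openin M (fst c) \<and> open (snd c ` fst c) \<and>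
     homeomorphic_map (subtopology M (fst c)) (top_of_set (snd c ` fst c)) (snd c)"

text \<open>Coordinate expression of a map \<open>f\<close> with respect to charts \<open>c\<close> (source) and \<open>d\<close> (target).\<close>

definition rep_dom :: "('q \<Rightarrow> 'p) \<Rightarrow> ('q, 'k::finite) chart \<Rightarrow> ('p, 'n::finite) chart \<Rightarrow> (real^'k) set" where
  "rep_dom f c d = snd c ` (fst c \<inter> f -` fst d)"

definition rep :: "('q \<Rightarrow> 'p) \<Rightarrow> ('q, 'k::finite) chart \<Rightarrow> ('p, 'n::finite) chart \<Rightarrow> real^'k \<Rightarrow> real^'n" where
  "rep f c d = snd d \<circ> f \<circ> inv_into (fst c) (snd c)"

definition smooth_manifold :: "'p topology \<Rightarrow> ('p, 'n::finite) chart set \<Rightarrow> bool" where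
  "smooth_manifold M A \<longleftrightarrow> Hausdorff_space M \<and> second_countable M \<and>
     (\<forall>c\<in>A. is_chart M c) \<and> (\<Union>c\<in>A. fst c) = topspace M \<and>
     (\<forall>c\<in>A. \<forall>d\<in>A. smooth_on (rep_dom id c d) (rep id c d))"


section \<open>Objects on the tangent bundle, given by their components in each chart\<close>

text \<open>A function \<open>f(x, y)\<close> of position and supporting element, in the coordinates of one chart.\<close>

type_synonym 'n tmfun = "real^'n \<Rightarrow> real^'n \<Rightarrow> real"

text \<open>The domain of the supporting elements: an open conic subset of the tangent bundle without
  the zero section. It cannot be taken to be the whole slit tangent bundle: \<open>L\<^sup>2 / \<beta>\<close> is undefined
  where \<open>\<beta> = 0\<close>, and an \<open>h\<close>-vector with \<open>\<rho> \<noteq> 0\<close> does not exist over a full punctured tangent space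
  (\<open>det g\<close> would have a critical point on each indicatrix, forcing \<open>\<rho> = 0\<close> there).\<close>

definition conic_domain ::
  "('p, 'n::finite) chart set \<Rightarrow> (('p, 'n) chart \<Rightarrow> ((real^'n) \<times> (real^'n)) set) \<Rightarrow> bool" where
  "conic_domain A D \<longleftrightarrow>
     (\<forall>c\<in>A. open (D c) \<and> D c \<subseteq> (snd c ` fst c) \<times> (- {0}) \<and>
        (\<forall>(x, y)\<in>D c. \<forall>t>0. (x, t *\<^sub>R y) \<in> D c)) \<and>
     (\<forall>c\<in>A. \<forall>d\<in>A. \<forall>(x, y)\<in>D c. x \<in> rep_dom id c d \<longrightarrow>
        (rep id c d x, tangent_lift (rep id c d) x y) \<in> D d)"

definition scalar_field ::
  "('p, 'n::finite) chart set \<Rightarrow> (('p, 'n) chart \<Rightarrow> ((real^'n) \<times> (real^'n)) set) \<Rightarrow>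
   (('p, 'n) chart \<Rightarrow> 'n tmfun) \<Rightarrow> bool" where
  "scalar_field A D f \<longleftrightarrow>
     (\<forall>c\<in>A. \<forall>d\<in>A. \<forall>(x, y)\<in>D c. x \<in> rep_dom id c d \<longrightarrow>
        f d (rep id c d x) (tangent_lift (rep id c d) x y) = f c x y)"

definition covector_field ::
  "('p, 'n::finite) chart set \<Rightarrow> (('p, 'n) chart \<Rightarrow> ((real^'n) \<times> (real^'n)) set) \<Rightarrow>
   (('p, 'n) chart \<Rightarrow> 'n \<Rightarrow> 'n tmfun) \<Rightarrow> bool" where
  "covector_field A D b \<longleftrightarrow>
     (\<forall>c\<in>A. \<forall>d\<in>A. \<forall>(x, y)\<in>D c. x \<in> rep_dom id c d \<longrightarrow>
        (\<forall>i. b c i x y =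
           (\<Sum>j\<in>UNIV. b d j (rep id c d x) (tangent_lift (rep id c d) x y) *
              partial_deriv i (\<lambda>z. rep id c d z $ j) x)))"


section \<open>Finsler tensors and the Cartan connection in local coordinates\<close>

definition dx :: "'n::finite \<Rightarrow> 'n tmfun \<Rightarrow> 'n tmfun" where
  "dx i f x y = partial_deriv i (\<lambda>z. f z y) x"

definition dy :: "'n::finite \<Rightarrow> 'n tmfun \<Rightarrow> 'n tmfun" where
  "dy i f x y = partial_deriv i (f x) y"

definition sq :: "'n::finite tmfun \<Rightarrow> 'n tmfun" where
  "sq L x y = (L x y)\<^sup>2"

definition g_low :: "'n::finite tmfun \<Rightarrow> 'n \<Rightarrow> 'n \<Rightarrow> 'n tmfun" where
  "g_low L i j x y = 1/2 * dy i (dy j (sq L)) x y"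

definition g_mat :: "'n::finite tmfun \<Rightarrow> real^'n \<Rightarrow> real^'n \<Rightarrow> real^'n^'n" where
  "g_mat L x y = (\<chi> i j. g_low L i j x y)"

definition g_up :: "'n::finite tmfun \<Rightarrow> 'n \<Rightarrow> 'n \<Rightarrow> 'n tmfun" where
  "g_up L i j x y = matrix_inv (g_mat L x y) $ i $ j"

definition h_low :: "'n::finite tmfun \<Rightarrow> 'n \<Rightarrow> 'n \<Rightarrow> 'n tmfun" where
  "h_low L i j x y = L x y * dy i (dy j L) x y"

definition C_low :: "'n::finite tmfun \<Rightarrow> 'n \<Rightarrow> 'n \<Rightarrow> 'n \<Rightarrow> 'n tmfun" where
  "C_low L i j k x y = 1/2 * dy k (g_low L i j) x y"

definition C_up :: "'n::finite tmfun \<Rightarrow> 'n \<Rightarrow> 'n \<Rightarrow> 'n \<Rightarrow> 'n tmfun" where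
  "C_up L h i j x y = (\<Sum>k\<in>UNIV. g_up L h k x y * C_low L i j k x y)"

definition spray :: "'n::finite tmfun \<Rightarrow> 'n \<Rightarrow> 'n tmfun" where
  "spray L i x y = 1/4 * (\<Sum>r\<in>UNIV. g_up L i r x y *
     ((\<Sum>j\<in>UNIV. y $ j * dy r (dx j (sq L)) x y) - dx r (sq L) x y))"

definition nonlin_conn :: "'n::finite tmfun \<Rightarrow> 'n \<Rightarrow> 'n \<Rightarrow> 'n tmfun" where
  "nonlin_conn L i j x y = dy j (spray L i) x y"

definition delta :: "'n::finite tmfun \<Rightarrow> 'n \<Rightarrow> 'n tmfun \<Rightarrow> 'n tmfun" where
  "delta L k f x y = dx k f x y - (\<Sum>h\<in>UNIV. nonlin_conn L h k x y * dy h f x y)"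

definition F_conn :: "'n::finite tmfun \<Rightarrow> 'n \<Rightarrow> 'n \<Rightarrow> 'n \<Rightarrow> 'n tmfun" where
  "F_conn L i j k x y = 1/2 * (\<Sum>r\<in>UNIV. g_up L i r x y *
     (delta L k (g_low L r j) x y + delta L j (g_low L r k) x y - delta L r (g_low L j k) x y))"

text \<open>\<open>h_cov L X i j\<close> is $X_{i|j}$ and \<open>v_cov L X i j\<close> is $X_i|_j$.\<close>

definition h_cov :: "'n::finite tmfun \<Rightarrow> ('n \<Rightarrow> 'n tmfun) \<Rightarrow> 'n \<Rightarrow> 'n \<Rightarrow> 'n tmfun" where
  "h_cov L X i j x y = dx j (X i) x y - (\<Sum>h\<in>UNIV. dy h (X i) x y * nonlin_conn L h j x y)
     - (\<Sum>r\<in>UNIV. F_conn L r i j x y * X r x y)"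

definition v_cov :: "'n::finite tmfun \<Rightarrow> ('n \<Rightarrow> 'n tmfun) \<Rightarrow> 'n \<Rightarrow> 'n \<Rightarrow> 'n tmfun" where
  "v_cov L X i j x y = dy j (X i) x y - (\<Sum>r\<in>UNIV. C_up L r i j x y * X r x y)"


section \<open>Finsler spaces, h-vectors and the Kropina change\<close>

text \<open>Regularity means that \<open>g_mat\<close> is nonsingular; positive definiteness is not required. No sign is
  imposed on the metric function, since \<open>L\<^sup>2 / \<beta>\<close> takes the sign of \<open>\<beta>\<close>. The positive, positive
  definite metrics are included.\<close>

definition finsler_space ::
  "'p topology \<Rightarrow> ('p, 'n::finite) chart set \<Rightarrow> (('p, 'n) chart \<Rightarrow> ((real^'n) \<times> (real^'n)) set) \<Rightarrow>
   (('p, 'n) chart \<Rightarrow> 'n tmfun) \<Rightarrow> bool" where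
  "finsler_space M A D L \<longleftrightarrow>
     smooth_manifold M A \<and> conic_domain A D \<and> scalar_field A D L \<and>
     (\<forall>c\<in>A. smooth_on (D c) (\<lambda>(x, y). L c x y)) \<and>
     (\<forall>c\<in>A. \<forall>(x, y)\<in>D c. L c x y \<noteq> 0 \<and> (\<forall>t>0. L c x (t *\<^sub>R y) = t * L c x y) \<and>
        invertible (g_mat (L c) x y))"

definition h_vector ::
  "('p, 'n::finite) chart set \<Rightarrow> (('p, 'n) chart \<Rightarrow> ((real^'n) \<times> (real^'n)) set) \<Rightarrow>
   (('p, 'n) chart \<Rightarrow> 'n tmfun) \<Rightarrow> (('p, 'n) chart \<Rightarrow> 'n \<Rightarrow> 'n tmfun) \<Rightarrow> bool" where
  "h_vector A D L b \<longleftrightarrow>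
     covector_field A D b \<and> (\<forall>c\<in>A. \<forall>i. smooth_on (D c) (\<lambda>(x, y). b c i x y)) \<and>
     (\<forall>c\<in>A. \<forall>(x, y)\<in>D c. \<forall>i k. v_cov (L c) (b c) i k x y = 0) \<and>
     (\<exists>\<rho>. scalar_field A D \<rho> \<and>
        (\<forall>c\<in>A. \<forall>(x, y)\<in>D c. \<rho> c x y \<noteq> 0 \<and>
           (\<forall>i j. L c x y * (\<Sum>h\<in>UNIV. C_up (L c) h i j x y * b c h x y) =
              \<rho> c x y * h_low (L c) i j x y)))"

definition gradient ::
  "('p, 'n::finite) chart set \<Rightarrow> (('p, 'n) chart \<Rightarrow> ((real^'n) \<times> (real^'n)) set) \<Rightarrow>
   (('p, 'n) chart \<Rightarrow> 'n tmfun) \<Rightarrow> (('p, 'n) chart \<Rightarrow> 'n \<Rightarrow> 'n tmfun) \<Rightarrow> bool" where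
  "gradient A D L b \<longleftrightarrow>
     (\<forall>c\<in>A. \<forall>(x, y)\<in>D c. \<forall>i j. h_cov (L c) (b c) i j x y = h_cov (L c) (b c) j i x y)"

definition beta :: "('n::finite \<Rightarrow> 'n tmfun) \<Rightarrow> 'n tmfun" where
  "beta b x y = (\<Sum>i\<in>UNIV. b i x y * y $ i)"

definition kropina ::
  "(('p, 'n::finite) chart \<Rightarrow> 'n tmfun) \<Rightarrow> (('p, 'n) chart \<Rightarrow> 'n \<Rightarrow> 'n tmfun) \<Rightarrow>
   ('p, 'n) chart \<Rightarrow> 'n tmfun" where
  "kropina L b c x y = (L c x y)\<^sup>2 / beta (b c) x y"


section \<open>Hypersurfaces\<close>

text \<open>In this part \<open>X\<close> is the coordinate expression \<open>x\<^sup>i = x\<^sup>i(u)\<close> of the hypersurface, \<open>N\<close> the normal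
  as a function of \<open>(u, v)\<close>, and ambient quantities are evaluated at \<open>(X u, tangent_lift X u v)\<close>.\<close>

definition B1 :: "(real^'m::finite \<Rightarrow> real^'n::finite) \<Rightarrow> 'n \<Rightarrow> 'm \<Rightarrow> real^'m \<Rightarrow> real" where
  "B1 X i \<alpha> u = partial_deriv \<alpha> (\<lambda>w. X w $ i) u"

definition B2 :: "(real^'m::finite \<Rightarrow> real^'n::finite) \<Rightarrow> 'n \<Rightarrow> 'm \<Rightarrow> 'm \<Rightarrow> real^'m \<Rightarrow> real" where
  "B2 X i \<alpha> \<beta> u = partial_deriv \<alpha> (partial_deriv \<beta> (\<lambda>w. X w $ i)) u"

definition B0 :: "(real^'m::finite \<Rightarrow> real^'n::finite) \<Rightarrow> 'n \<Rightarrow> 'm \<Rightarrow> real^'m \<Rightarrow> real^'m \<Rightarrow> real" where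
  "B0 X i \<alpha> u v = (\<Sum>\<beta>\<in>UNIV. B2 X i \<beta> \<alpha> u * v $ \<beta>)"

definition along ::
  "(real^'m::finite \<Rightarrow> real^'n::finite) \<Rightarrow> 'n tmfun \<Rightarrow> real^'m \<Rightarrow> real^'m \<Rightarrow> real" where
  "along X f u v = f (X u) (tangent_lift X u v)"

definition N_low ::
  "'n::finite tmfun \<Rightarrow> (real^'m::finite \<Rightarrow> real^'n) \<Rightarrow> (real^'m \<Rightarrow> real^'m \<Rightarrow> real^'n) \<Rightarrow>
   'n \<Rightarrow> real^'m \<Rightarrow> real^'m \<Rightarrow> real" where
  "N_low L X N i u v = (\<Sum>j\<in>UNIV. along X (g_low L i j) u v * N u v $ j)"

definition is_unit_normal ::
  "'n::finite tmfun \<Rightarrow> (real^'m::finite \<Rightarrow> real^'n) \<Rightarrow> (real^'m \<Rightarrow> real^'m \<Rightarrow> real^'n) \<Rightarrow>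
   real^'m \<Rightarrow> real^'m \<Rightarrow> bool" where
  "is_unit_normal L X N u v \<longleftrightarrow>
     (\<forall>\<alpha>. (\<Sum>i\<in>UNIV. \<Sum>j\<in>UNIV. along X (g_low L i j) u v * B1 X i \<alpha> u * N u v $ j) = 0) \<and>
     (\<Sum>i\<in>UNIV. \<Sum>j\<in>UNIV. along X (g_low L i j) u v * N u v $ i * N u v $ j) = 1"

definition M_vec ::
  "'n::finite tmfun \<Rightarrow> (real^'m::finite \<Rightarrow> real^'n) \<Rightarrow> (real^'m \<Rightarrow> real^'m \<Rightarrow> real^'n) \<Rightarrow>
   'm \<Rightarrow> real^'m \<Rightarrow> real^'m \<Rightarrow> real" where
  "M_vec L X N \<alpha> u v = (\<Sum>i\<in>UNIV. \<Sum>j\<in>UNIV. \<Sum>k\<in>UNIV.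
     along X (C_low L i j k) u v * B1 X i \<alpha> u * N u v $ j * N u v $ k)"

definition H_vec ::
  "'n::finite tmfun \<Rightarrow> (real^'m::finite \<Rightarrow> real^'n) \<Rightarrow> (real^'m \<Rightarrow> real^'m \<Rightarrow> real^'n) \<Rightarrow>
   'm \<Rightarrow> real^'m \<Rightarrow> real^'m \<Rightarrow> real" where
  "H_vec L X N \<alpha> u v = (\<Sum>i\<in>UNIV. N_low L X N i u v *
     (B0 X i \<alpha> u v + (\<Sum>j\<in>UNIV. along X (nonlin_conn L i j) u v * B1 X j \<alpha> u)))"

definition H_tensor ::
  "'n::finite tmfun \<Rightarrow> (real^'m::finite \<Rightarrow> real^'n) \<Rightarrow> (real^'m \<Rightarrow> real^'m \<Rightarrow> real^'n) \<Rightarrow>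
   'm \<Rightarrow> 'm \<Rightarrow> real^'m \<Rightarrow> real^'m \<Rightarrow> real" where
  "H_tensor L X N \<alpha> \<beta> u v =
     (\<Sum>i\<in>UNIV. N_low L X N i u v *
        (B2 X i \<alpha> \<beta> u +
         (\<Sum>j\<in>UNIV. \<Sum>k\<in>UNIV. along X (F_conn L i j k) u v * B1 X j \<alpha> u * B1 X k \<beta> u)))
     + M_vec L X N \<alpha> u v * H_vec L X N \<beta> u v"

definition M_tensor ::
  "'n::finite tmfun \<Rightarrow> (real^'m::finite \<Rightarrow> real^'n) \<Rightarrow> (real^'m \<Rightarrow> real^'m \<Rightarrow> real^'n) \<Rightarrow>
   'm \<Rightarrow> 'm \<Rightarrow> real^'m \<Rightarrow> real^'m \<Rightarrow> real" where
  "M_tensor L X N \<alpha> \<beta> u v = (\<Sum>i\<in>UNIV. \<Sum>j\<in>UNIV. \<Sum>k\<in>UNIV.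
     along X (C_low L i j k) u v * B1 X i \<alpha> u * B1 X j \<beta> u * N u v $ k)"

text \<open>A hypersurface is an immersed manifold \<open>S\<close> (atlas \<open>A'\<close>) of dimension \<open>CARD('n) - 1\<close>.\<close>

definition hypersurface ::
  "'p topology \<Rightarrow> ('p, 'n::finite) chart set \<Rightarrow> 'q topology \<Rightarrow> ('q, 'm::finite) chart set \<Rightarrow>
   ('q \<Rightarrow> 'p) \<Rightarrow> bool" where
  "hypersurface M A S A' f \<longleftrightarrow>
     CARD('n) = CARD('m) + 1 \<and> smooth_manifold S A' \<and> continuous_map S M f \<and>
     (\<forall>c\<in>A'. \<forall>d\<in>A. smooth_on (rep_dom f c d) (rep f c d) \<and>
        (\<forall>u\<in>rep_dom f c d. rank (\<chi> i \<alpha>. B1 (rep f c d) i \<alpha> u) = CARD('m)))"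

text \<open>The supporting elements \<open>(u, v)\<close> of the Finslerian hypersurface in a pair of charts.\<close>

definition supp_elems ::
  "(('p, 'n::finite) chart \<Rightarrow> ((real^'n) \<times> (real^'n)) set) \<Rightarrow> ('q \<Rightarrow> 'p) \<Rightarrow>
   ('q, 'm::finite) chart \<Rightarrow> ('p, 'n) chart \<Rightarrow> ((real^'m) \<times> (real^'m)) set" where
  "supp_elems D f c d =
     {(u, v). u \<in> rep_dom f c d \<and> (rep f c d u, tangent_lift (rep f c d) u v) \<in> D d}"

text \<open>The unit normal is determined up to sign; the sign may be chosen independently at each
  supporting element and in each pair of charts. It affects none of the conditions below.\<close>

type_synonym ('q, 'm, 'p, 'n) normal =
  "('q, 'm) chart \<Rightarrow> ('p, 'n) chart \<Rightarrow> real^'m \<Rightarrow> real^'m \<Rightarrow> real^'n"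

definition unit_normal_field ::
  "('p, 'n::finite) chart set \<Rightarrow> (('p, 'n) chart \<Rightarrow> ((real^'n) \<times> (real^'n)) set) \<Rightarrow>
   (('p, 'n) chart \<Rightarrow> 'n tmfun) \<Rightarrow> ('q, 'm::finite) chart set \<Rightarrow> ('q \<Rightarrow> 'p) \<Rightarrow>
   ('q, 'm, 'p, 'n) normal \<Rightarrow> bool" where
  "unit_normal_field A D L A' f N \<longleftrightarrow>
     (\<forall>c\<in>A'. \<forall>d\<in>A. \<forall>(u, v)\<in>supp_elems D f c d. is_unit_normal (L d) (rep f c d) (N c d) u v)"

definition tangential ::
  "('p, 'n::finite) chart set \<Rightarrow> (('p, 'n) chart \<Rightarrow> ((real^'n) \<times> (real^'n)) set) \<Rightarrow>
   (('p, 'n) chart \<Rightarrow> 'n \<Rightarrow> 'n tmfun) \<Rightarrow> ('q, 'm::finite) chart set \<Rightarrow> ('q \<Rightarrow> 'p) \<Rightarrow>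
   ('q, 'm, 'p, 'n) normal \<Rightarrow> bool" where
  "tangential A D b A' f N \<longleftrightarrow>
     (\<forall>c\<in>A'. \<forall>d\<in>A. \<forall>(u, v)\<in>supp_elems D f c d.
        (\<Sum>i\<in>UNIV. along (rep f c d) (b d i) u v * N c d u v $ i) = 0)"

definition H_tensor_vanishes ::
  "('p, 'n::finite) chart set \<Rightarrow> (('p, 'n) chart \<Rightarrow> ((real^'n) \<times> (real^'n)) set) \<Rightarrow>
   (('p, 'n) chart \<Rightarrow> 'n tmfun) \<Rightarrow> ('q, 'm::finite) chart set \<Rightarrow> ('q \<Rightarrow> 'p) \<Rightarrow>
   ('q, 'm, 'p, 'n) normal \<Rightarrow> bool" where
  "H_tensor_vanishes A D L A' f N \<longleftrightarrow>
     (\<forall>c\<in>A'. \<forall>d\<in>A. \<forall>(u, v)\<in>supp_elems D f c d.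
        \<forall>\<alpha> \<beta>. H_tensor (L d) (rep f c d) (N c d) \<alpha> \<beta> u v = 0)"

definition M_tensor_vanishes ::
  "('p, 'n::finite) chart set \<Rightarrow> (('p, 'n) chart \<Rightarrow> ((real^'n) \<times> (real^'n)) set) \<Rightarrow>
   (('p, 'n) chart \<Rightarrow> 'n tmfun) \<Rightarrow> ('q, 'm::finite) chart set \<Rightarrow> ('q \<Rightarrow> 'p) \<Rightarrow>
   ('q, 'm, 'p, 'n) normal \<Rightarrow> bool" where
  "M_tensor_vanishes A D L A' f N \<longleftrightarrow>
     (\<forall>c\<in>A'. \<forall>d\<in>A. \<forall>(u, v)\<in>supp_elems D f c d.
        \<forall>\<alpha> \<beta>. M_tensor (L d) (rep f c d) (N c d) \<alpha> \<beta> u v = 0)"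

definition hyperplane_2nd ::
  "('p, 'n::finite) chart set \<Rightarrow> (('p, 'n) chart \<Rightarrow> ((real^'n) \<times> (real^'n)) set) \<Rightarrow>
   (('p, 'n) chart \<Rightarrow> 'n tmfun) \<Rightarrow> ('q, 'm::finite) chart set \<Rightarrow> ('q \<Rightarrow> 'p) \<Rightarrow>
   ('q, 'm, 'p, 'n) normal \<Rightarrow> bool" where
  "hyperplane_2nd A D L A' f N \<longleftrightarrow> H_tensor_vanishes A D L A' f N"

definition hyperplane_3rd ::
  "('p, 'n::finite) chart set \<Rightarrow> (('p, 'n) chart \<Rightarrow> ((real^'n) \<times> (real^'n)) set) \<Rightarrow>
   (('p, 'n) chart \<Rightarrow> 'n tmfun) \<Rightarrow> ('q, 'm::finite) chart set \<Rightarrow> ('q \<Rightarrow> 'p) \<Rightarrow>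
   ('q, 'm, 'p, 'n) normal \<Rightarrow> bool" where
  "hyperplane_3rd A D L A' f N \<longleftrightarrow>
     H_tensor_vanishes A D L A' f N \<and> M_tensor_vanishes A D L A' f N"

end

theory Submission
  imports Defs
begin

text \<open>Write \<open>E = L\<^sup>2/2\<close>, let subscripts denote derivatives in \<open>y\<close>, and let \<open>G\<close> be the spray of \<open>L\<close>.
  Contracting \<open>b\<^bsub>r|0\<^esub> C\<^sup>r\<^sub>i\<^sub>j = 0\<close> with \<open>b\<^sup>j\<close> gives \<open>b\<^bsub>r|0\<^esub> = \<tau> E\<^sub>r\<close>, and the gradient condition makes
  \<open>\<tau>\<close> independent of \<open>y\<close>. Hence the horizontal derivative of the starred energy is \<open>\<eta> E\<^sub>k\<close>
  with \<open>\<eta> = - \<tau> L\<^sup>4/\<beta>\<^sup>3\<close>, and the difference \<open>D\<close> of the two sprays satisfies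
  \<open>*g\<^sub>r\<^sub>i D\<^sup>i = E \<eta>\<^sub>r\<close>.

  At a point of the hypersurface where \<open>M\<^sub>\<alpha>\<^sub>\<beta> = 0\<close>, the functions \<open>L\<close>, \<open>\<beta>\<close>, \<open>\<tau>\<close>, and so everything built
  algebraically from them, have vanishing \<open>y\<close>-derivatives in the directions \<open>N\<close>, \<open>(N, B)\<close> and
  \<open>(N, B, B')\<close> for tangent \<open>B, B'\<close>. Therefore \<open>*N\<close> is a multiple of \<open>N\<close>, \<open>D\<close> and its tangential
  derivatives are tangent, and \<open>*N\<^sub>i *F\<^sup>i\<^sub>j\<^sub>k\<close>, \<open>*N\<^sub>i *G\<^sup>i\<^sub>j\<close> restricted to tangent vectors are a common
  multiple of their unstarred versions. As \<open>H\<^sub>\<alpha>\<^sub>\<beta> = 0\<close> contracted with \<open>v\<^sup>\<alpha>\<close> forces \<open>H\<^sub>\<beta> = 0\<close>, the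
  starred tensors vanish as well.\<close>

section \<open>Directional derivatives and smooth functions\<close>

text \<open>The total derivative is evaluated in a direction, so linearity in the direction holds
  wherever the function is differentiable.\<close>

definition dir_deriv :: "'a::real_normed_vector \<Rightarrow> ('a \<Rightarrow> real) \<Rightarrow> 'a \<Rightarrow> real" where
  "dir_deriv e F p = frechet_derivative F (at p) e"

lemma dir_deriv_eq: "(F has_derivative F') (at p) \<Longrightarrow> dir_deriv e F p = F' e"
  by (metis dir_deriv_def frechet_derivative_at)

lemma has_derivative_dir_deriv:
  "F differentiable at p \<Longrightarrow> (F has_derivative (\<lambda>e. dir_deriv e F p)) (at p)"
  by (simp add: dir_deriv_def frechet_derivative_works[symmetric])

lemma dir_deriv_cong:
  assumes "open S" "p \<in> S" "\<And>q. q \<in> S \<Longrightarrow> F q = G q"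
  shows "dir_deriv e F p = dir_deriv e G p"
proof -
  have "(F has_derivative D) (at p) \<longleftrightarrow> (G has_derivative D) (at p)" for D
    using assms by (metis has_derivative_transform_within_open)
  thus ?thesis by (simp add: dir_deriv_def frechet_derivative_def)
qed

lemma dir_deriv_const [simp]: "dir_deriv e (\<lambda>p. c) = (\<lambda>p. 0)"
  by (rule ext) (simp add: dir_deriv_def)

lemma dir_deriv_mult:
  assumes "F differentiable at p" "G differentiable at p"
  shows "dir_deriv e (\<lambda>p. F p * G p) p = F p * dir_deriv e G p + dir_deriv e F p * G p"
  using dir_deriv_eq[OF has_derivative_mult[OF assms[THEN has_derivative_dir_deriv]]] .

lemma dir_deriv_sum:
  assumes "\<And>i. i \<in> I \<Longrightarrow> F i differentiable at p"
  shows "dir_deriv e (\<lambda>p. \<Sum>i\<in>I. F i p) p = (\<Sum>i\<in>I. dir_deriv e (F i) p)"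
proof -
  have "((\<lambda>p. \<Sum>i\<in>I. F i p) has_derivative (\<lambda>e. \<Sum>i\<in>I. dir_deriv e (F i) p)) (at p)"
    using assms by (intro has_derivative_sum has_derivative_dir_deriv)
  thus ?thesis by (rule dir_deriv_eq)
qed

lemma dir_deriv_add:
  assumes "F differentiable at p" "G differentiable at p"
  shows "dir_deriv e (\<lambda>p. F p + G p) p = dir_deriv e F p + dir_deriv e G p"
  using dir_deriv_eq[OF has_derivative_add[OF assms[THEN has_derivative_dir_deriv]]] .

lemma dir_deriv_diff:
  assumes "F differentiable at p" "G differentiable at p"
  shows "dir_deriv e (\<lambda>p. F p - G p) p = dir_deriv e F p - dir_deriv e G p"
  using dir_deriv_eq[OF has_derivative_diff[OF assms[THEN has_derivative_dir_deriv]]] .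

lemma dir_deriv_cmult:
  assumes "F differentiable at p"
  shows "dir_deriv e (\<lambda>p. c * F p) p = c * dir_deriv e F p"
  using dir_deriv_mult[OF differentiable_const assms] by simp

text \<open>The right-hand side consists of products only, so that the closure rules for products
  apply to it as it stands.\<close>

lemma dir_deriv_inverse:
  assumes "F differentiable at p" "F p \<noteq> 0"
  shows "dir_deriv e (\<lambda>p. inverse (F p)) p = - 1 * (dir_deriv e F p * (inverse (F p) * inverse (F p)))"
proof -
  have "((\<lambda>p. inverse (F p)) has_derivative
      (\<lambda>e. - (inverse (F p) * dir_deriv e F p * inverse (F p)))) (at p)"
    by (rule Deriv.has_derivative_inverse) (use assms has_derivative_dir_deriv in auto)
  from dir_deriv_eq[OF this] show ?thesis by simp
qed

lemma dir_deriv_lin: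
  assumes "F differentiable at p"
  shows "dir_deriv (e + e') F p = dir_deriv e F p + dir_deriv e' F p"
    and "dir_deriv (c *\<^sub>R e) F p = c * dir_deriv e F p"
    and "dir_deriv (\<Sum>i\<in>I. h i) F p = (\<Sum>i\<in>I. dir_deriv (h i) F p)"
proof -
  have "linear (\<lambda>e. dir_deriv e F p)"
    using has_derivative_dir_deriv[OF assms] has_derivative_linear by blast
  thus "dir_deriv (e + e') F p = dir_deriv e F p + dir_deriv e' F p"
    and "dir_deriv (c *\<^sub>R e) F p = c * dir_deriv e F p"
    and "dir_deriv (\<Sum>i\<in>I. h i) F p = (\<Sum>i\<in>I. dir_deriv (h i) F p)"
    using linear_add[of "\<lambda>e. dir_deriv e F p"] linear_scale[of "\<lambda>e. dir_deriv e F p"]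
      linear_sum[of "\<lambda>e. dir_deriv e F p"] by auto
qed

lemma has_real_derivative_line:
  assumes "F differentiable at (p + t *\<^sub>R e)"
  shows "((\<lambda>t. F (p + t *\<^sub>R e)) has_real_derivative dir_deriv e F (p + t *\<^sub>R e)) (at t)"
proof -
  have "((\<lambda>t. p + t *\<^sub>R e) has_derivative (\<lambda>s. s *\<^sub>R e)) (at t)"
    by (auto intro!: derivative_eq_intros)
  from diff_chain_at[OF this has_derivative_dir_deriv[OF assms]]
  show ?thesis
    by (simp add: o_def dir_deriv_lin[OF assms] has_field_derivative_def mult.commute[of _ "dir_deriv _ _ _"])
qed

section \<open>Symmetry of second derivatives\<close>

text \<open>Two applications of the mean value theorem, first along \<open>e\<close>, then along
  \<open>e'\<close>. The mixed difference is symmetric in the two directions, so it can be compared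
  with the derivatives taken in either order.\<close>

lemma second_difference:
  fixes F :: "'a::real_normed_vector \<Rightarrow> real"
  assumes "h > 0"
    and box: "\<And>s t. 0 \<le> s \<Longrightarrow> s \<le> h \<Longrightarrow> 0 \<le> t \<Longrightarrow> t \<le> h \<Longrightarrow> p + s *\<^sub>R e + t *\<^sub>R e' \<in> S"
    and F: "\<And>q. q \<in> S \<Longrightarrow> F differentiable at q"
    and F': "\<And>q. q \<in> S \<Longrightarrow> dir_deriv e F differentiable at q"
  obtains s t where "0 \<le> s" "s \<le> h" "0 \<le> t" "t \<le> h"
    "F (p + h *\<^sub>R e + h *\<^sub>R e') - F (p + h *\<^sub>R e) - F (p + h *\<^sub>R e') + F p =
       h * (h * dir_deriv e' (dir_deriv e F) (p + s *\<^sub>R e + t *\<^sub>R e'))"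
proof -
  define u where "u s = F (p + h *\<^sub>R e' + s *\<^sub>R e) - F (p + s *\<^sub>R e)" for s
  have "\<exists>z>0. z < h \<and> u h - u 0 = (h - 0) *
      (dir_deriv e F (p + h *\<^sub>R e' + z *\<^sub>R e) - dir_deriv e F (p + z *\<^sub>R e))"
    unfolding u_def
  proof (rule MVT2[OF \<open>h > 0\<close>], rule DERIV_diff)
    fix s assume s: "0 \<le> s" "s \<le> h"
    show "((\<lambda>s. F (p + h *\<^sub>R e' + s *\<^sub>R e)) has_real_derivative dir_deriv e F (p + h *\<^sub>R e' + s *\<^sub>R e)) (at s)"
      using s box[of s h] \<open>h > 0\<close> by (intro has_real_derivative_line F) (simp add: algebra_simps)
    show "((\<lambda>s. F (p + s *\<^sub>R e)) has_real_derivative dir_deriv e F (p + s *\<^sub>R e)) (at s)"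
      using s box[of s 0] \<open>h > 0\<close> by (intro has_real_derivative_line F) (simp add: algebra_simps)
  qed
  then obtain s where s: "s > 0" "s < h" "u h - u 0 = h *
      (dir_deriv e F (p + h *\<^sub>R e' + s *\<^sub>R e) - dir_deriv e F (p + s *\<^sub>R e))" by auto
  have "\<exists>z>0. z < h \<and> dir_deriv e F (p + s *\<^sub>R e + h *\<^sub>R e') - dir_deriv e F (p + s *\<^sub>R e + 0 *\<^sub>R e') =
      (h - 0) * dir_deriv e' (dir_deriv e F) (p + s *\<^sub>R e + z *\<^sub>R e')"
    by (rule MVT2[OF \<open>h > 0\<close>], rule has_real_derivative_line, rule F', rule box) (use s in auto)
  then obtain t where t: "t > 0" "t < h"
    "dir_deriv e F (p + s *\<^sub>R e + h *\<^sub>R e') - dir_deriv e F (p + s *\<^sub>R e) =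
      h * dir_deriv e' (dir_deriv e F) (p + s *\<^sub>R e + t *\<^sub>R e')" by auto
  show thesis
    by (rule that[of s t]) (use s t in \<open>auto simp: u_def algebra_simps\<close>)
qed

lemma dir_deriv_commute:
  fixes F :: "'a::real_normed_vector \<Rightarrow> real"
  assumes S: "open S" "p \<in> S"
    and F: "\<And>q. q \<in> S \<Longrightarrow> F differentiable at q"
    and F1: "\<And>q. q \<in> S \<Longrightarrow> dir_deriv e F differentiable at q"
    and F2: "\<And>q. q \<in> S \<Longrightarrow> dir_deriv e' F differentiable at q"
    and cont: "isCont (dir_deriv e' (dir_deriv e F)) p" "isCont (dir_deriv e (dir_deriv e' F)) p"
  shows "dir_deriv e' (dir_deriv e F) p = dir_deriv e (dir_deriv e' F) p"
proof (rule ccontr)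
  let ?A = "dir_deriv e' (dir_deriv e F)" and ?B = "dir_deriv e (dir_deriv e' F)"
  assume ne: "?A p \<noteq> ?B p"
  \<comment> \<open>Half the gap: near \<open>p\<close> each mixed derivative stays strictly within
    \<epsilon> of its value at \<open>p\<close>, so values of the two at nearby points cannot
    coincide.\<close>
  define \<epsilon> where "\<epsilon> = \<bar>?A p - ?B p\<bar> / 2"
  have \<epsilon>: "\<epsilon> > 0" using ne by (simp add: \<epsilon>_def)
  obtain d1 where d1: "d1 > 0" "\<And>q. dist q p < d1 \<Longrightarrow> \<bar>?A q - ?A p\<bar> < \<epsilon>"
    using cont(1) \<epsilon> unfolding continuous_at_eps_delta dist_real_def by metis
  obtain d2 where d2: "d2 > 0" "\<And>q. dist q p < d2 \<Longrightarrow> \<bar>?B q - ?B p\<bar> < \<epsilon>"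
    using cont(2) \<epsilon> unfolding continuous_at_eps_delta dist_real_def by metis
  obtain d3 where d3: "d3 > 0" "ball p d3 \<subseteq> S" using S openE by blast
  define d where "d = min d1 (min d2 d3)"
  have d: "d > 0" "d \<le> d1" "d \<le> d2" "d \<le> d3" using d1 d2 d3 by (auto simp: d_def)
  \<comment> \<open>The parallelogram spanned by \<open>h\<close> times the directions stays within
    distance \<open>d\<close> of \<open>p\<close>; the summand 1 keeps the denominator positive even
    if both directions are zero.\<close>
  define h where "h = d / (2 * (norm e + norm e' + 1))"
  have h: "h > 0" using d by (simp add: h_def add_nonneg_pos)
  have near: "dist (p + s *\<^sub>R e + t *\<^sub>R e') p < d" if "0 \<le> s" "s \<le> h" "0 \<le> t" "t \<le> h" for s t
  proof -
    have "dist (p + s *\<^sub>R e + t *\<^sub>R e') p \<le> norm (s *\<^sub>R e) + norm (t *\<^sub>R e')"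
      by (simp add: dist_norm add.assoc norm_triangle_ineq del: norm_scaleR)
    also have "\<dots> \<le> h * norm e + h * norm e'"
      using that by (auto intro!: add_mono mult_right_mono)
    also have "\<dots> < h * (2 * (norm e + norm e' + 1))"
      using h by (simp add: algebra_simps add_nonneg_pos)
    also have "\<dots> = d"
    proof -
      have "norm e + norm e' + 1 \<noteq> 0" using norm_ge_zero[of e] norm_ge_zero[of e'] by linarith
      thus ?thesis by (simp add: h_def)
    qed
    finally show ?thesis .
  qed
  have box: "p + s *\<^sub>R e + t *\<^sub>R e' \<in> S" "p + s *\<^sub>R e' + t *\<^sub>R e \<in> S"
    if "0 \<le> s" "s \<le> h" "0 \<le> t" "t \<le> h" for s t
    using near[of s t] near[of t s] that d d3 by (auto simp: dist_commute algebra_simps)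
  obtain s t where st: "0 \<le> s" "s \<le> h" "0 \<le> t" "t \<le> h"
    "F (p + h *\<^sub>R e + h *\<^sub>R e') - F (p + h *\<^sub>R e) - F (p + h *\<^sub>R e') + F p =
       h * (h * ?A (p + s *\<^sub>R e + t *\<^sub>R e'))"
    by (rule second_difference[OF h box(1) F F1])
  obtain s' t' where st': "0 \<le> s'" "s' \<le> h" "0 \<le> t'" "t' \<le> h"
    "F (p + h *\<^sub>R e' + h *\<^sub>R e) - F (p + h *\<^sub>R e') - F (p + h *\<^sub>R e) + F p =
       h * (h * ?B (p + s' *\<^sub>R e' + t' *\<^sub>R e))"
    by (rule second_difference[OF h box(2) F F2])
  \<comment> \<open>Both values are the same second difference divided twice by
    \<open>h\<close>.\<close>
  have "?A (p + s *\<^sub>R e + t *\<^sub>R e') = ?B (p + t' *\<^sub>R e + s' *\<^sub>R e')"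
    using st st' h by (simp add: algebra_simps)
  with d1(2)[of "p + s *\<^sub>R e + t *\<^sub>R e'"] d2(2)[of "p + t' *\<^sub>R e + s' *\<^sub>R e'"]
    near[OF st(1-4)] near[OF st'(3,4,1,2)] d
  show False by (auto simp: \<epsilon>_def abs_if split: if_splits)
qed

section \<open>Closure properties of smooth functions on open sets\<close>

lemma Ck_on_cong:
  assumes "open S" "\<And>p. p \<in> S \<Longrightarrow> F p = G p"
  shows "Ck_on k S F \<Longrightarrow> Ck_on k S G"
  using assms(2)
proof (induction k arbitrary: F G)
  case 0 thus ?case using continuous_on_cong by force
next
  case (Suc k)
  have "frechet_derivative F (at p) = frechet_derivative G (at p)" if "p \<in> S" for p
  proof -
    have "(F has_derivative D) (at p) \<longleftrightarrow> (G has_derivative D) (at p)" for D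
      using assms(1) that Suc.prems(2) by (metis has_derivative_transform_within_open)
    thus ?thesis by (simp add: frechet_derivative_def)
  qed
  moreover have "G differentiable_on S"
    using Suc.prems assms(1) unfolding Ck_on.simps differentiable_on_eq_differentiable_at[OF assms(1)]
    by (meson differentiable_transform_within assms(1) differentiable_def has_derivative_transform_within_open)
  moreover have "Ck_on k S (\<lambda>x. frechet_derivative G (at x) e)" if "e \<in> Basis" for e
    by (rule Suc.IH[of "\<lambda>x. frechet_derivative F (at x) e"]) (use calculation Suc.prems(1) that in auto)
  ultimately show ?case by simp
qed

lemma Ck_on_Suc_imp: "Ck_on (Suc k) S F \<Longrightarrow> Ck_on k S F"
  by (induction k arbitrary: F) (auto intro: differentiable_imp_continuous_on)

lemma Ck_on_Suc_iff:
  fixes F :: "'a::euclidean_space \<Rightarrow> real"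
  assumes "open S"
  shows "Ck_on (Suc k) S F \<longleftrightarrow>
    (\<forall>p\<in>S. F differentiable at p) \<and> (\<forall>e\<in>Basis. Ck_on k S (dir_deriv e F))"
  by (simp add: differentiable_on_eq_differentiable_at[OF assms] dir_deriv_def[abs_def])

lemma Ck_on_const: "Ck_on k S (\<lambda>p::'a::euclidean_space. c::real)"
  by (induction k arbitrary: c) auto

lemma Ck_on_add:
  fixes F G :: "'a::euclidean_space \<Rightarrow> real"
  assumes "open S"
  shows "Ck_on k S F \<Longrightarrow> Ck_on k S G \<Longrightarrow> Ck_on k S (\<lambda>p. F p + G p)"
proof (induction k arbitrary: F G)
  case 0 thus ?case by (auto intro: continuous_on_add)
next
  case (Suc k)
  have "Ck_on k S (dir_deriv e (\<lambda>p. F p + G p))" if "e \<in> Basis" for e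
    by (rule Ck_on_cong[OF assms _ Suc.IH[of "dir_deriv e F" "dir_deriv e G"]])
      (use Suc.prems that in \<open>auto simp: Ck_on_Suc_iff[OF assms] dir_deriv_add simp del: Ck_on.simps\<close>)
  thus ?case using Suc.prems by (auto simp: Ck_on_Suc_iff[OF assms] simp del: Ck_on.simps)
qed

lemma Ck_on_mult:
  fixes F G :: "'a::euclidean_space \<Rightarrow> real"
  assumes "open S"
  shows "Ck_on k S F \<Longrightarrow> Ck_on k S G \<Longrightarrow> Ck_on k S (\<lambda>p. F p * G p)"
proof (induction k arbitrary: F G)
  case 0 thus ?case by (auto intro: continuous_on_mult)
next
  case (Suc k)
  have "Ck_on k S (dir_deriv e (\<lambda>p. F p * G p))" if "e \<in> Basis" for e
  proof (rule Ck_on_cong[OF assms])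
    \<comment> \<open>The product rule also contains the undifferentiated factors, which are known
      to be of the lower class by \<open>Ck_on_Suc_imp\<close>.\<close>
    show "Ck_on k S (\<lambda>p. F p * dir_deriv e G p + dir_deriv e F p * G p)"
      using Suc.prems that Ck_on_Suc_imp[of k S F] Ck_on_Suc_imp[of k S G]
      by (intro Ck_on_add[OF assms] Suc.IH) (auto simp: Ck_on_Suc_iff[OF assms] simp del: Ck_on.simps)
  qed (use Suc.prems in \<open>auto simp: Ck_on_Suc_iff[OF assms] dir_deriv_mult simp del: Ck_on.simps\<close>)
  thus ?case using Suc.prems by (auto simp: Ck_on_Suc_iff[OF assms] simp del: Ck_on.simps)
qed

lemma Ck_on_inverse:
  fixes F :: "'a::euclidean_space \<Rightarrow> real"
  assumes "open S" and nz: "\<And>p. p \<in> S \<Longrightarrow> F p \<noteq> 0"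
  shows "Ck_on k S F \<Longrightarrow> Ck_on k S (\<lambda>p. inverse (F p))"
proof (induction k)
  case 0 thus ?case using nz by (auto intro: continuous_on_inverse)
next
  case (Suc k)
  have IH: "Ck_on k S (\<lambda>p. inverse (F p))" by (rule Suc.IH[OF Ck_on_Suc_imp[OF Suc.prems]])
  have "Ck_on k S (dir_deriv e (\<lambda>p. inverse (F p)))" if "e \<in> Basis" for e
  proof (rule Ck_on_cong[OF assms(1)])
    show "Ck_on k S (\<lambda>p. - 1 * (dir_deriv e F p * (inverse (F p) * inverse (F p))))"
      using Suc.prems that
      by (intro Ck_on_mult[OF assms(1)] Ck_on_const IH) (auto simp: Ck_on_Suc_iff[OF assms(1)] simp del: Ck_on.simps)
  qed (use Suc.prems nz in \<open>auto simp: Ck_on_Suc_iff[OF assms(1)] dir_deriv_inverse simp del: Ck_on.simps\<close>)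
  moreover have "\<forall>p\<in>S. (\<lambda>p. inverse (F p)) differentiable at p"
    using Suc.prems nz by (auto simp: Ck_on_Suc_iff[OF assms(1)] simp del: Ck_on.simps)
  ultimately show ?case by (simp add: Ck_on_Suc_iff[OF assms(1)] del: Ck_on.simps)
qed

lemma smooth_on_const: "smooth_on S (\<lambda>p::'a::euclidean_space. c::real)"
  by (simp add: smooth_on_def Ck_on_const)

lemma smooth_on_mult:
  fixes F G :: "'a::euclidean_space \<Rightarrow> real"
  shows "open S \<Longrightarrow> smooth_on S F \<Longrightarrow> smooth_on S G \<Longrightarrow> smooth_on S (\<lambda>p. F p * G p)"
  by (simp add: smooth_on_def Ck_on_mult)

lemma smooth_on_add:
  fixes F G :: "'a::euclidean_space \<Rightarrow> real"
  shows "open S \<Longrightarrow> smooth_on S F \<Longrightarrow> smooth_on S G \<Longrightarrow> smooth_on S (\<lambda>p. F p + G p)"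
  by (simp add: smooth_on_def Ck_on_add)

lemma smooth_on_diff:
  fixes F G :: "'a::euclidean_space \<Rightarrow> real"
  assumes "open S" "smooth_on S F" "smooth_on S G"
  shows "smooth_on S (\<lambda>p. F p - G p)"
  using smooth_on_add[OF assms(1,2) smooth_on_mult[OF assms(1) smooth_on_const[where c = "-1"] assms(3)]]
  by simp

lemma smooth_on_inverse:
  fixes F :: "'a::euclidean_space \<Rightarrow> real"
  shows "open S \<Longrightarrow> smooth_on S F \<Longrightarrow> (\<And>p. p \<in> S \<Longrightarrow> F p \<noteq> 0) \<Longrightarrow> smooth_on S (\<lambda>p. inverse (F p))"
  by (simp add: smooth_on_def Ck_on_inverse)

lemma smooth_on_divide:
  fixes F G :: "'a::euclidean_space \<Rightarrow> real"
  assumes "open S" "smooth_on S F" "smooth_on S G" "\<And>p. p \<in> S \<Longrightarrow> G p \<noteq> 0"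
  shows "smooth_on S (\<lambda>p. F p / G p)"
  using smooth_on_mult[OF assms(1,2) smooth_on_inverse[OF assms(1,3,4)]] by (simp add: divide_inverse)

lemma smooth_on_power:
  fixes F :: "'a::euclidean_space \<Rightarrow> real"
  assumes "open S" "smooth_on S F"
  shows "smooth_on S (\<lambda>p. F p ^ k)"
  by (induction k) (simp_all add: smooth_on_const smooth_on_mult assms)

lemma smooth_on_sum:
  fixes F :: "'b \<Rightarrow> 'a::euclidean_space \<Rightarrow> real"
  assumes "open S" "\<And>i. i \<in> I \<Longrightarrow> smooth_on S (F i)"
  shows "smooth_on S (\<lambda>p. \<Sum>i\<in>I. F i p)"
  using assms(2)
  by (induction I rule: infinite_finite_induct) (simp_all add: smooth_on_const smooth_on_add assms(1))

lemma smooth_on_prod: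
  fixes F :: "'b \<Rightarrow> 'a::euclidean_space \<Rightarrow> real"
  assumes "open S" "\<And>i. i \<in> I \<Longrightarrow> smooth_on S (F i)"
  shows "smooth_on S (\<lambda>p. \<Prod>i\<in>I. F i p)"
  using assms(2)
  by (induction I rule: infinite_finite_induct) (simp_all add: smooth_on_const smooth_on_mult assms(1))

text \<open>A bounded linear map is its own derivative at every point, so one differentiation leaves
  only constants.\<close>

lemma smooth_on_linear:
  fixes F :: "'a::euclidean_space \<Rightarrow> real"
  assumes "bounded_linear F"
  shows "smooth_on S F"
proof -
  have der: "frechet_derivative F (at p) = F" for p
    using frechet_derivative_at[OF bounded_linear_imp_has_derivative[OF assms]] by simp
  have "Ck_on k S F" for k
    using assms
    by (cases k) (auto simp: der Ck_on_const linear_continuous_on bounded_linear_imp_differentiable_on)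
  thus ?thesis by (simp add: smooth_on_def)
qed

lemma smooth_on_cong:
  "open S \<Longrightarrow> smooth_on S F \<Longrightarrow> (\<And>p. p \<in> S \<Longrightarrow> F p = G p) \<Longrightarrow> smooth_on S G"
  unfolding smooth_on_def using Ck_on_cong by blast

lemma smooth_on_differentiable:
  "open S \<Longrightarrow> smooth_on S F \<Longrightarrow> p \<in> S \<Longrightarrow> F differentiable at p"
  unfolding smooth_on_def by (metis Ck_on.simps(2) differentiable_on_eq_differentiable_at)

lemma smooth_on_isCont:
  "open S \<Longrightarrow> smooth_on S F \<Longrightarrow> p \<in> S \<Longrightarrow> isCont F p"
  by (simp add: differentiable_imp_continuous_within smooth_on_differentiable)

lemma smooth_on_subset_open:
  "open S \<Longrightarrow> open T \<Longrightarrow> T \<subseteq> S \<Longrightarrow> smooth_on S F \<Longrightarrow> smooth_on T F"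
proof -
  assume S: "T \<subseteq> S"
  have "Ck_on k S F \<Longrightarrow> Ck_on k T F" for k
    using S by (induction k arbitrary: F) (auto intro: continuous_on_subset differentiable_on_subset)
  thus "smooth_on S F \<Longrightarrow> smooth_on T F" by (simp add: smooth_on_def)
qed

text \<open>\<open>Ck_on\<close> speaks of basis directions only, so a general direction is expanded
  in the basis.\<close>

lemma smooth_on_dir_deriv:
  fixes F :: "'a::euclidean_space \<Rightarrow> real"
  assumes "open S" "smooth_on S F"
  shows "smooth_on S (dir_deriv e F)"
proof (rule smooth_on_cong[OF assms(1)])
  show "smooth_on S (\<lambda>p. \<Sum>i\<in>Basis. (e \<bullet> i) * dir_deriv i F p)"
  proof (intro smooth_on_sum smooth_on_mult smooth_on_const assms(1))
    fix i :: 'a assume "i \<in> Basis"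
    thus "smooth_on S (dir_deriv i F)"
      using assms unfolding smooth_on_def by (metis Ck_on_Suc_iff)
  qed
next
  fix p assume p: "p \<in> S"
  have "dir_deriv e F p = dir_deriv (\<Sum>i\<in>Basis. (e \<bullet> i) *\<^sub>R i) F p"
    by (simp add: euclidean_representation)
  also have "\<dots> = (\<Sum>i\<in>Basis. (e \<bullet> i) * dir_deriv i F p)"
    by (simp add: dir_deriv_lin smooth_on_differentiable[OF assms p])
  finally show "(\<Sum>i\<in>Basis. (e \<bullet> i) * dir_deriv i F p) = dir_deriv e F p" by simp
qed

lemma smooth_on_dir_deriv_commute:
  fixes F :: "'a::euclidean_space \<Rightarrow> real"
  assumes "open S" "smooth_on S F" "p \<in> S"
  shows "dir_deriv e (dir_deriv e' F) p = dir_deriv e' (dir_deriv e F) p"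
  using assms
  by (intro dir_deriv_commute[OF assms(1,3)] smooth_on_differentiable[OF assms(1)] smooth_on_isCont[OF assms(1)]
      smooth_on_dir_deriv) auto

section \<open>Finsler metrics in a chart\<close>

text \<open>Position and supporting element form one argument, and \<open>(0, u)\<close> moves only
  the latter. The direction is a constant vector: in \<open>vd (snd p) F p\<close> the supporting
  element is frozen at \<open>p\<close>.\<close>

abbreviation vd :: "real^'n \<Rightarrow> ((real^'n) \<times> (real^'n) \<Rightarrow> real) \<Rightarrow> (real^'n) \<times> (real^'n) \<Rightarrow> real" where
  "vd u \<equiv> dir_deriv (0, u)"

abbreviation xd :: "real^'n \<Rightarrow> ((real^'n) \<times> (real^'n) \<Rightarrow> real) \<Rightarrow> (real^'n) \<times> (real^'n) \<Rightarrow> real" where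
  "xd u \<equiv> dir_deriv (u, 0)"

abbreviation ax :: "'n::finite \<Rightarrow> real^'n" where
  "ax i \<equiv> axis i 1"

lemma axis_sum: "(\<Sum>i\<in>UNIV. u $ i *\<^sub>R ax i) = u"
  by (simp add: basis_expansion scalar_mult_eq_scaleR[symmetric])

lemma vd_expand:
  assumes "F differentiable at p"
  shows "vd u F p = (\<Sum>i\<in>UNIV. u $ i * vd (ax i) F p)"
proof -
  have "(0, u) = (\<Sum>i\<in>UNIV. u $ i *\<^sub>R (0, ax i))"
    by (simp add: sum_prod axis_sum)
  thus ?thesis by (metis (no_types, lifting) assms dir_deriv_lin(2) dir_deriv_lin(3) sum.cong)
qed

lemma xd_expand:
  assumes "F differentiable at p"
  shows "xd u F p = (\<Sum>i\<in>UNIV. u $ i * xd (ax i) F p)"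
proof -
  have "(u, 0) = (\<Sum>i\<in>UNIV. u $ i *\<^sub>R (ax i, 0))"
    by (simp add: sum_prod axis_sum)
  thus ?thesis by (metis (no_types, lifting) assms dir_deriv_lin(2) dir_deriv_lin(3) sum.cong)
qed

lemma smooth_on_snd_nth: "smooth_on S (\<lambda>p :: (real^'n) \<times> (real^'n). snd p $ i)"
  by (intro smooth_on_linear bounded_linear_compose[OF bounded_linear_vec_nth bounded_linear_snd])

lemma dir_deriv_snd_nth [simp]: "dir_deriv e (\<lambda>p. snd p $ i) = (\<lambda>p. snd e $ i)"
  by (intro ext dir_deriv_eq bounded_linear_imp_has_derivative
      bounded_linear_compose[OF bounded_linear_vec_nth bounded_linear_snd])

locale open_domain =
  fixes D :: "((real^'n::finite) \<times> (real^'n)) set"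
  assumes open_D: "open D"
begin

lemmas smooth_rules = smooth_on_const smooth_on_mult[OF open_D] smooth_on_add[OF open_D]
  smooth_on_diff[OF open_D] smooth_on_sum[OF open_D] smooth_on_dir_deriv[OF open_D] smooth_on_snd_nth
  smooth_on_power[OF open_D] smooth_on_divide[OF open_D] smooth_on_inverse[OF open_D]

lemma diff: "p \<in> D \<Longrightarrow> smooth_on D F \<Longrightarrow> F differentiable at p"
  using smooth_on_differentiable[OF open_D] by blast

lemmas deriv_rules = dir_deriv_sum dir_deriv_mult dir_deriv_add dir_deriv_diff diff smooth_rules

lemma dd_commute: "p \<in> D \<Longrightarrow> smooth_on D F \<Longrightarrow> dir_deriv e (dir_deriv e' F) p = dir_deriv e' (dir_deriv e F) p"
  using smooth_on_dir_deriv_commute[OF open_D] by blast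

lemma dd_commute3: "p \<in> D \<Longrightarrow> smooth_on D F \<Longrightarrow>
    dir_deriv e'' (dir_deriv e (dir_deriv e' F)) p = dir_deriv e'' (dir_deriv e' (dir_deriv e F)) p"
  by (rule dir_deriv_cong[OF open_D]) (auto intro: dd_commute)

lemma dd_cong: "p \<in> D \<Longrightarrow> (\<And>q. q \<in> D \<Longrightarrow> F q = G q) \<Longrightarrow> dir_deriv e F p = dir_deriv e G p"
  using dir_deriv_cong[OF open_D] by blast

lemma vd_exp: "p \<in> D \<Longrightarrow> smooth_on D F \<Longrightarrow> vd u F p = (\<Sum>i\<in>UNIV. u $ i * vd (ax i) F p)"
  by (intro vd_expand diff)

lemma xd_exp: "p \<in> D \<Longrightarrow> smooth_on D F \<Longrightarrow> xd u F p = (\<Sum>i\<in>UNIV. u $ i * xd (ax i) F p)"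
  by (intro xd_expand diff)

lemma vd_vd_exp:
  assumes "p \<in> D" "smooth_on D F"
  shows "vd u (vd v F) p = (\<Sum>i\<in>UNIV. v $ i * vd u (vd (ax i) F) p)"
  using vd_exp[OF assms(1) smooth_on_dir_deriv[OF open_D assms(2)], of v] assms
  by (simp add: dd_commute[where e = "(0, u)"])

text \<open>A bridge from the coordinate definitions, which nest one-variable derivatives, to
  directional derivatives. Agreement of \<open>f\<close> and \<open>F\<close> on the open set
  \<open>D\<close> is enough, so iterated partials are translated one at a time.\<close>

lemma dy_eq:
  assumes "(x, y) \<in> D" "smooth_on D F" "\<And>x y. (x, y) \<in> D \<Longrightarrow> f x y = F (x, y)"
  shows "dy i f x y = vd (ax i) F (x, y)"
proof -
  let ?F = "\<lambda>(x, y). f x y"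
  have "smooth_on D ?F" by (rule smooth_on_cong[OF open_D assms(2)]) (use assms(3) in auto)
  hence "((\<lambda>t. ?F ((x, y) + t *\<^sub>R (0, ax i))) has_real_derivative vd (ax i) ?F ((x, y) + 0 *\<^sub>R (0, ax i))) (at 0)"
    using assms(1) by (intro has_real_derivative_line diff) auto
  hence "dy i f x y = vd (ax i) ?F (x, y)"
    by (auto simp: dy_def partial_deriv_def intro: DERIV_imp_deriv)
  also have "\<dots> = vd (ax i) F (x, y)" by (rule dd_cong[OF assms(1)]) (use assms(3) in auto)
  finally show ?thesis .
qed

lemma dx_eq:
  assumes "(x, y) \<in> D" "smooth_on D F" "\<And>x y. (x, y) \<in> D \<Longrightarrow> f x y = F (x, y)"
  shows "dx i f x y = xd (ax i) F (x, y)"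
proof -
  let ?F = "\<lambda>(x, y). f x y"
  have "smooth_on D ?F" by (rule smooth_on_cong[OF open_D assms(2)]) (use assms(3) in auto)
  hence "((\<lambda>t. ?F ((x, y) + t *\<^sub>R (ax i, 0))) has_real_derivative xd (ax i) ?F ((x, y) + 0 *\<^sub>R (ax i, 0))) (at 0)"
    using assms(1) by (intro has_real_derivative_line diff) auto
  hence "dx i f x y = xd (ax i) ?F (x, y)"
    by (auto simp: dx_def partial_deriv_def intro: DERIV_imp_deriv)
  also have "\<dots> = xd (ax i) F (x, y)" by (rule dd_cong[OF assms(1)]) (use assms(3) in auto)
  finally show ?thesis .
qed

section \<open>Homogeneous functions and Euler's relation\<close>

text \<open>Euler's relation, the infinitesimal form of positive homogeneity of degree
  \<open>k\<close>. As a differential identity it passes to derivatives by the product rule.\<close>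

definition homog :: "real \<Rightarrow> ((real^'n) \<times> (real^'n) \<Rightarrow> real) \<Rightarrow> bool" where
  "homog k F \<longleftrightarrow> (\<forall>p\<in>D. vd (snd p) F p = k * F p)"

lemma homogD: "homog k F \<Longrightarrow> p \<in> D \<Longrightarrow> vd (snd p) F p = k * F p"
  by (simp add: homog_def)

text \<open>Differentiating Euler's relation also hits the coefficient \<open>snd p\<close>. Hence
  fibre derivatives lower the degree by one and position derivatives keep it.\<close>

lemma dir_deriv_euler:
  assumes "smooth_on D F" "homog k F" "p \<in> D"
  shows "vd (snd p) (dir_deriv e F) p = k * dir_deriv e F p - vd (snd e) F p"
proof -
  have "k * dir_deriv e F p = dir_deriv e (\<lambda>q. k * F q) p"
    using assms by (simp add: deriv_rules)
  also have "\<dots> = dir_deriv e (\<lambda>q. \<Sum>i\<in>UNIV. snd q $ i * vd (ax i) F q) p"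
    by (rule dd_cong[OF assms(3)]) (use assms vd_exp in \<open>auto simp: homog_def\<close>)
  also have "\<dots> = (\<Sum>i\<in>UNIV. snd p $ i * dir_deriv e (vd (ax i) F) p + snd e $ i * vd (ax i) F p)"
    using assms by (simp add: deriv_rules)
  also have "\<dots> = vd (snd p) (dir_deriv e F) p + vd (snd e) F p"
    using assms by (simp add: vd_exp[of p _ "snd p"] vd_exp[of p _ "snd e"] deriv_rules sum.distrib
        dd_commute[where e = e])
  finally show ?thesis by simp
qed

lemma homog_vd: "smooth_on D F \<Longrightarrow> homog k F \<Longrightarrow> homog (k - 1) (vd u F)"
  unfolding homog_def[of "k - 1"] by (simp add: dir_deriv_euler algebra_simps)

lemma vd_zero: "p \<in> D \<Longrightarrow> smooth_on D F \<Longrightarrow> vd 0 F p = 0"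
  using vd_exp[of p F 0] by simp

lemma homog_xd: "smooth_on D F \<Longrightarrow> homog k F \<Longrightarrow> homog k (xd u F)"
  unfolding homog_def[of k "xd u F"] by (simp add: dir_deriv_euler vd_zero)

lemma homog_mult:
  "smooth_on D F \<Longrightarrow> smooth_on D G \<Longrightarrow> homog k F \<Longrightarrow> homog l G \<Longrightarrow> homog (k + l) (\<lambda>p. F p * G p)"
  by (simp add: homog_def deriv_rules algebra_simps)

lemma homog_diff:
  "smooth_on D F \<Longrightarrow> smooth_on D G \<Longrightarrow> homog k F \<Longrightarrow> homog k G \<Longrightarrow> homog k (\<lambda>p. F p - G p)"
  by (simp add: homog_def deriv_rules algebra_simps)

lemma homog_sum:
  "(\<And>i. i \<in> I \<Longrightarrow> smooth_on D (F i)) \<Longrightarrow> (\<And>i. i \<in> I \<Longrightarrow> homog k (F i)) \<Longrightarrow> homog k (\<lambda>p. \<Sum>i\<in>I. F i p)"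
  by (simp add: homog_def deriv_rules sum_distrib_left)

lemma homog_snd_nth: "homog 1 (\<lambda>p. snd p $ i)"
  by (simp add: homog_def)

end

section \<open>Inverse matrices and determinants\<close>

lemma matrix_inv_inverse:
  fixes A :: "real^'n^'n"
  assumes "invertible A"
  shows "A ** matrix_inv A = mat 1" "matrix_inv A ** A = mat 1"
  using someI_ex[of "\<lambda>A'. A ** A' = mat 1 \<and> A' ** A = mat 1"] assms
  unfolding matrix_inv_def invertible_def by auto

text \<open>Cramer's rule. It presents the entries of the inverse metric as quotients of
  determinants, from which their smoothness follows.\<close>

lemma matrix_inv_nth:
  fixes A :: "real^'n^'n"
  assumes "invertible A"
  shows "matrix_inv A $ i $ j = det (\<chi> a b. if b = i then ax j $ a else A $ a $ b) / det A"
proof -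
  note matrix_inv_inverse(1)[OF assms]
  hence "A *v (matrix_inv A *v ax j) = ax j"
    by (simp add: matrix_vector_mul_assoc)
  moreover have "det A \<noteq> 0" using assms invertible_det_nz by blast
  ultimately have "matrix_inv A *v ax j = (\<chi> k. det (\<chi> a b. if b = k then ax j $ a else A $ a $ b) / det A)"
    using cramer by blast
  hence "(matrix_inv A *v ax j) $ i = det (\<chi> a b. if b = i then ax j $ a else A $ a $ b) / det A"
    by simp
  moreover have "(matrix_inv A *v ax j) $ i = matrix_inv A $ i $ j"
    by (simp add: matrix_vector_mult_basis column_def)
  ultimately show ?thesis by simp
qed

lemma smooth_on_det:
  assumes "open S" "\<And>i j. smooth_on S (\<lambda>p::'a::euclidean_space. A p $ i $ j)"
  shows "smooth_on S (\<lambda>p. det (A p :: real^'n^'n))"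
  unfolding det_def
  by (intro smooth_on_sum smooth_on_mult smooth_on_prod smooth_on_const assms)

section \<open>Energy, metric tensor and spray in a chart\<close>

locale finsler_chart = open_domain D for D :: "((real^'n::finite) \<times> (real^'n)) set" +
  fixes L :: "'n tmfun"
  assumes conic: "(x, y) \<in> D \<Longrightarrow> t > 0 \<Longrightarrow> (x, t *\<^sub>R y) \<in> D"
    and smooth_L: "smooth_on D (\<lambda>(x, y). L x y)"
    and L_nonzero: "(x, y) \<in> D \<Longrightarrow> L x y \<noteq> 0"
    and L_homog: "(x, y) \<in> D \<Longrightarrow> t > 0 \<Longrightarrow> L x (t *\<^sub>R y) = t * L x y"
    and invertible_g: "(x, y) \<in> D \<Longrightarrow> invertible (g_mat L x y)"
begin

definition Lf :: "(real^'n) \<times> (real^'n) \<Rightarrow> real" where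
  "Lf p = L (fst p) (snd p)"

text \<open>The energy; its fibre Hessian is the metric tensor.\<close>

definition En :: "(real^'n) \<times> (real^'n) \<Rightarrow> real" where
  "En p = 1/2 * (Lf p * Lf p)"

definition G :: "'n \<Rightarrow> (real^'n) \<times> (real^'n) \<Rightarrow> real" where
  "G i p = spray L i (fst p) (snd p)"

lemma smooth_Lf: "smooth_on D Lf"
  using smooth_L by (simp add: Lf_def[abs_def] case_prod_unfold)

lemma Lf_nonzero: "p \<in> D \<Longrightarrow> Lf p \<noteq> 0"
  using L_nonzero[of "fst p" "snd p"] by (simp add: Lf_def)

lemma smooth_En: "smooth_on D En"
  unfolding En_def[abs_def] by (intro smooth_rules smooth_Lf)

lemma En_nonzero: "p \<in> D \<Longrightarrow> En p \<noteq> 0"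
  by (simp add: En_def Lf_nonzero)

lemma homog_Lf: "homog 1 Lf"
  unfolding homog_def
proof
  fix p assume p: "p \<in> D"
  obtain x y where xy: "p = (x, y)" by (cases p)
  have "((\<lambda>t. Lf ((x, y) + t *\<^sub>R (0, y))) has_real_derivative vd y Lf ((x, y) + 0 *\<^sub>R (0, y))) (at 0)"
    using p xy by (intro has_real_derivative_line diff smooth_Lf) simp
  \<comment> \<open>Along the ray the function is affine in \<open>t\<close> near 0; the interval
    keeps \<open>1 + t\<close> positive, as \<open>L_homog\<close> requires.\<close>
  moreover have "((\<lambda>t. Lf ((x, y) + t *\<^sub>R (0, y))) has_real_derivative Lf p) (at 0)"
  proof (rule has_field_derivative_transform_within_open)
    show "((\<lambda>t. (1 + t) * Lf p) has_real_derivative Lf p) (at 0)"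
      by (auto intro!: derivative_eq_intros)
    show "open {-1<..<(1::real)}" "0 \<in> {-1<..<(1::real)}" by auto
    fix t :: real assume "t \<in> {-1<..<1}"
    moreover have "y + t *\<^sub>R y = (1 + t) *\<^sub>R y" by (simp add: algebra_simps)
    ultimately show "(1 + t) * Lf p = Lf ((x, y) + t *\<^sub>R (0, y))"
      using L_homog[of x y "1 + t"] p xy by (simp add: Lf_def)
  qed
  ultimately show "vd (snd p) Lf p = 1 * Lf p"
    using DERIV_unique xy by fastforce
qed

lemma homog_En: "homog 2 En"
proof -
  have "homog 0 (\<lambda>p. 1/2)" by (simp add: homog_def)
  hence "homog (0 + (1 + 1)) (\<lambda>p. 1/2 * (Lf p * Lf p))"
    by (intro homog_mult smooth_rules smooth_Lf homog_Lf)
  thus ?thesis by (simp add: En_def[abs_def])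
qed

lemmas smooths = smooth_rules smooth_Lf smooth_En

lemma homog_En1: "homog 1 (vd u En)"
  using homog_vd[OF smooth_En homog_En] by simp

lemma homog_En2: "homog 0 (vd u (vd v En))"
  using homog_vd[OF _ homog_En1] by (simp add: smooths)

lemma sq_eq: "sq L x y = 2 * En (x, y)"
  by (simp add: sq_def En_def Lf_def power2_eq_square)

lemma dy_sq: "(x, y) \<in> D \<Longrightarrow> dy i (sq L) x y = 2 * vd (ax i) En (x, y)"
  using dy_eq[of x y "\<lambda>p. 2 * En p" "sq L"] by (simp add: sq_eq smooths dir_deriv_cmult diff)

lemma dx_sq: "(x, y) \<in> D \<Longrightarrow> dx i (sq L) x y = 2 * xd (ax i) En (x, y)"
  using dx_eq[of x y "\<lambda>p. 2 * En p" "sq L"] by (simp add: sq_eq smooths dir_deriv_cmult diff)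

lemma dy_dx_sq: "(x, y) \<in> D \<Longrightarrow> dy r (dx j (sq L)) x y = 2 * vd (ax r) (xd (ax j) En) (x, y)"
  using dy_eq[of x y "\<lambda>p. 2 * xd (ax j) En p" "dx j (sq L)"]
  by (simp add: dx_sq smooths dir_deriv_cmult diff)

lemma g_low_eq: "(x, y) \<in> D \<Longrightarrow> g_low L i j x y = vd (ax i) (vd (ax j) En) (x, y)"
  using dy_eq[of x y "\<lambda>p. 2 * vd (ax j) En p" "dy j (sq L)"]
  by (simp add: dy_sq g_low_def smooths dir_deriv_cmult diff)

lemma C_low_eq: "(x, y) \<in> D \<Longrightarrow> C_low L i j k x y = 1/2 * vd (ax k) (vd (ax i) (vd (ax j) En)) (x, y)"
  using dy_eq[of x y "\<lambda>p. vd (ax i) (vd (ax j) En) p" "g_low L i j"]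
  by (simp add: C_low_def g_low_eq smooths)

lemma g_inverse:
  assumes "(x, y) \<in> D"
  shows "(\<Sum>i\<in>UNIV. g_low L k i x y * g_up L i r x y) = (if k = r then 1 else 0)"
    and "(\<Sum>i\<in>UNIV. g_up L k i x y * g_low L i r x y) = (if k = r then 1 else 0)"
proof -
  have "(g_mat L x y ** matrix_inv (g_mat L x y)) $ k $ r = mat 1 $ k $ r"
    "(matrix_inv (g_mat L x y) ** g_mat L x y) $ k $ r = mat 1 $ k $ r"
    using invertible_g[OF assms] by (simp_all add: matrix_inv_inverse)
  thus "(\<Sum>i\<in>UNIV. g_low L k i x y * g_up L i r x y) = (if k = r then 1 else 0)"
    and "(\<Sum>i\<in>UNIV. g_up L k i x y * g_low L i r x y) = (if k = r then 1 else 0)"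
    by (simp_all add: matrix_matrix_mult_def g_mat_def g_up_def mat_def)
qed

lemma nondegenerate:
  assumes p: "p \<in> D" and "\<And>u. (\<Sum>i\<in>UNIV. vd u (vd (ax i) En) p * w i) = 0"
  shows "w i = 0"
proof -
  obtain x y where xy: "p = (x, y)" by (cases p)
  have "(\<Sum>i\<in>UNIV. g_low L k i x y * w i) = 0" for k
    using assms(2)[of "ax k"] p xy by (simp add: g_low_eq)
  hence "0 = (\<Sum>k\<in>UNIV. g_up L i k x y * (\<Sum>j\<in>UNIV. g_low L k j x y * w j))" by simp
  also have "\<dots> = (\<Sum>k\<in>UNIV. \<Sum>j\<in>UNIV. g_up L i k x y * g_low L k j x y * w j)"
    by (simp add: sum_distrib_left mult.assoc)
  also have "\<dots> = (\<Sum>j\<in>UNIV. (\<Sum>k\<in>UNIV. g_up L i k x y * g_low L k j x y) * w j)"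
    by (subst sum.swap) (simp add: sum_distrib_right)
  also have "\<dots> = w i" using p xy by (simp add: g_inverse if_distrib[of "\<lambda>c. c * _"] sum.delta cong: if_cong)
  finally show ?thesis by simp
qed

lemma g_contract_up:
  assumes "(x, y) \<in> D"
  shows "(\<Sum>i\<in>UNIV. vd u (vd (ax i) En) (x, y) * (\<Sum>r\<in>UNIV. g_up L i r x y * R r)) = (\<Sum>r\<in>UNIV. u $ r * R r)"
proof -
  have "(\<Sum>i\<in>UNIV. vd (ax k) (vd (ax i) En) (x, y) * (\<Sum>r\<in>UNIV. g_up L i r x y * R r)) = R k" for k
  proof -
    have "(\<Sum>i\<in>UNIV. vd (ax k) (vd (ax i) En) (x, y) * (\<Sum>r\<in>UNIV. g_up L i r x y * R r))
        = (\<Sum>i\<in>UNIV. \<Sum>r\<in>UNIV. g_low L k i x y * g_up L i r x y * R r)"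
      using assms by (simp add: g_low_eq sum_distrib_left mult.assoc)
    also have "\<dots> = (\<Sum>r\<in>UNIV. (\<Sum>i\<in>UNIV. g_low L k i x y * g_up L i r x y) * R r)"
      by (subst sum.swap) (simp add: sum_distrib_right)
    also have "\<dots> = R k" using assms by (simp add: g_inverse if_distrib[of "\<lambda>c. c * _"] sum.delta cong: if_cong)
    finally show ?thesis .
  qed
  hence "(\<Sum>k\<in>UNIV. u $ k * R k) = (\<Sum>k\<in>UNIV. u $ k *
      (\<Sum>i\<in>UNIV. vd (ax k) (vd (ax i) En) (x, y) * (\<Sum>r\<in>UNIV. g_up L i r x y * R r)))" by simp
  also have "\<dots> = (\<Sum>i\<in>UNIV. \<Sum>k\<in>UNIV. u $ k *
      (vd (ax k) (vd (ax i) En) (x, y) * (\<Sum>r\<in>UNIV. g_up L i r x y * R r)))"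
    unfolding sum_distrib_left by (rule sum.swap)
  also have "\<dots> = (\<Sum>i\<in>UNIV. vd u (vd (ax i) En) (x, y) * (\<Sum>r\<in>UNIV. g_up L i r x y * R r))"
    using assms by (simp add: vd_exp[of "(x, y)" _ u] smooths sum_distrib_right mult.assoc)
  finally show ?thesis by simp
qed

lemma smooth_g_low: "smooth_on D (\<lambda>p. g_low L i j (fst p) (snd p))"
  by (rule smooth_on_cong[OF open_D, of "vd (ax i) (vd (ax j) En)"]) (auto simp: g_low_eq smooths)

lemma smooth_g_up: "smooth_on D (\<lambda>p. g_up L i j (fst p) (snd p))"
proof (rule smooth_on_cong[OF open_D])
  let ?g = "\<lambda>p. g_mat L (fst p) (snd p)"
  have g: "smooth_on D (\<lambda>p. ?g p $ a $ b)" for a b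
    using smooth_g_low by (simp add: g_mat_def)
  have "smooth_on D (\<lambda>p. (\<chi> a b. if b = i then ax j $ a else ?g p $ a $ b) $ a $ b)" for a b
    using g by (cases "b = i") (auto intro: smooth_rules)
  moreover have "det (?g p) \<noteq> 0" if "p \<in> D" for p
    using invertible_g[of "fst p" "snd p"] that invertible_det_nz by auto
  ultimately show "smooth_on D (\<lambda>p. det (\<chi> a b. if b = i then ax j $ a else ?g p $ a $ b) / det (?g p))"
    by (intro smooth_rules smooth_on_det[OF open_D] g)
  show "det (\<chi> a b. if b = i then ax j $ a else ?g p $ a $ b) / det (?g p) = g_up L i j (fst p) (snd p)"
    if "p \<in> D" for p
    using invertible_g[of "fst p" "snd p"] that by (simp add: g_up_def matrix_inv_nth)
qed

lemma G_eq:
  assumes "(x, y) \<in> D"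
  shows "G i (x, y) = 1/2 * (\<Sum>r\<in>UNIV. g_up L i r x y *
    ((\<Sum>j\<in>UNIV. y $ j * vd (ax r) (xd (ax j) En) (x, y)) - xd (ax r) En (x, y)))"
proof -
  have "(\<Sum>j\<in>UNIV. y $ j * dy r (dx j (sq L)) x y) - dx r (sq L) x y
      = 2 * ((\<Sum>j\<in>UNIV. y $ j * vd (ax r) (xd (ax j) En) (x, y)) - xd (ax r) En (x, y))" for r
    using assms by (simp add: dy_dx_sq dx_sq sum_distrib_left mult.left_commute right_diff_distrib)
  thus ?thesis unfolding G_def spray_def fst_conv snd_conv
    by (simp only: mult.left_commute[of _ 2] sum_distrib_left[symmetric, of 2])
qed

lemma smooth_G: "smooth_on D (G i)"
proof (rule smooth_on_cong[OF open_D])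
  show "smooth_on D (\<lambda>p. 1/2 * (\<Sum>r\<in>UNIV. g_up L i r (fst p) (snd p) *
    ((\<Sum>j\<in>UNIV. snd p $ j * vd (ax r) (xd (ax j) En) p) - xd (ax r) En p)))"
    by (intro smooth_rules smooth_g_up smooth_En)
qed (use G_eq in auto)

lemmas all_smooth = smooths smooth_G
lemmas all_rules = deriv_rules smooth_Lf smooth_En smooth_G

text \<open>The spray with its index lowered. No inverse metric occurs any more, so the identity can
  be differentiated in terms of the energy and the spray alone.\<close>

lemma spray_eq:
  assumes "p \<in> D"
  shows "xd (snd p) (vd u En) p - xd u En p = 2 * (\<Sum>i\<in>UNIV. vd u (vd (ax i) En) p * G i p)"
proof -
  obtain x y where xy: "p = (x, y)" by (cases p)
  let ?R = "\<lambda>r. (\<Sum>j\<in>UNIV. y $ j * vd (ax r) (xd (ax j) En) (x, y)) - xd (ax r) En (x, y)"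
  have "2 * (\<Sum>i\<in>UNIV. vd u (vd (ax i) En) p * G i p)
      = (\<Sum>i\<in>UNIV. vd u (vd (ax i) En) p * (\<Sum>r\<in>UNIV. g_up L i r x y * ?R r))"
    using assms xy by (simp add: G_eq sum_distrib_left[of 2])
  also have "\<dots> = (\<Sum>r\<in>UNIV. u $ r * ?R r)"
    using g_contract_up assms xy by simp
  also have "\<dots> = (\<Sum>r\<in>UNIV. u $ r * vd (ax r) (xd y En) p) - xd u En p"
  proof -
    have "vd (ax r) (xd y En) p = (\<Sum>j\<in>UNIV. y $ j * vd (ax r) (xd (ax j) En) (x, y))" for r
      using assms xd_exp[of p "vd (ax r) En" y]
      by (simp add: dd_commute[where e = "(0, ax r)"] all_smooth xy)
    thus ?thesis using assms
      by (simp add: right_diff_distrib sum_subtractf xd_exp[of _ _ u] all_smooth xy)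
  qed
  also have "\<dots> = vd u (xd y En) p - xd u En p"
    using assms by (simp add: vd_exp[of p _ u] all_smooth)
  finally show ?thesis using assms by (simp add: dd_commute[where e' = "(0, u)"] smooth_En xy)
qed

text \<open>The energy is constant along horizontal directions. Contracting \<open>spray_eq\<close>
  with the supporting element equates the position derivative of the energy in that direction with
  twice the contraction of its fibre derivative with the spray. Differentiating this along
  \<open>u\<close> and subtracting \<open>spray_eq\<close> leaves twice the claim.\<close>

lemma horizontal_energy:
  assumes p: "p \<in> D"
  shows "xd u En p = (\<Sum>h\<in>UNIV. vd u (G h) p * vd (ax h) En p)"
proof -
  have *: "(\<Sum>j\<in>UNIV. snd q $ j * xd (ax j) En q) = 2 * (\<Sum>i\<in>UNIV. vd (ax i) En q * G i q)" if q: "q \<in> D" for q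
  proof -
    have 1: "vd (snd q) (vd (ax i) En) q = vd (ax i) En q" for i
      using homogD[OF homog_En1 q] by simp
    have "xd v (vd (snd q) En) q = 2 * xd v En q" for v
      using homogD[OF homog_xd[OF smooth_En homog_En] q, of v]
      by (simp add: dd_commute[OF q smooth_En, of "(v, 0)"])
    hence "xd (snd q) En q = 2 * (\<Sum>i\<in>UNIV. vd (ax i) En q * G i q)"
      using spray_eq[OF q, of "snd q"] by (simp add: 1)
    thus ?thesis using xd_exp[OF q smooth_En, of "snd q"] by simp
  qed
  have "vd u (\<lambda>q. \<Sum>j\<in>UNIV. snd q $ j * xd (ax j) En q) p =
      vd u (\<lambda>q. 2 * (\<Sum>i\<in>UNIV. vd (ax i) En q * G i q)) p"
    by (rule dd_cong[OF p *])
  hence "(\<Sum>j\<in>UNIV. snd p $ j * vd u (xd (ax j) En) p) + (\<Sum>j\<in>UNIV. u $ j * xd (ax j) En p)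
     = 2 * ((\<Sum>i\<in>UNIV. vd (ax i) En p * vd u (G i) p) + (\<Sum>i\<in>UNIV. vd u (vd (ax i) En) p * G i p))"
    using p by (simp add: all_rules sum.distrib)
  moreover have "(\<Sum>j\<in>UNIV. snd p $ j * vd u (xd (ax j) En) p) = xd (snd p) (vd u En) p"
    using p by (simp add: xd_exp[of p _ "snd p"] all_smooth dd_commute[where e = "(0, u)"])
  moreover have "(\<Sum>j\<in>UNIV. u $ j * xd (ax j) En p) = xd u En p"
    using p by (simp add: xd_exp[of p _ u] all_smooth)
  ultimately have "2 * xd u En p = 2 * (\<Sum>i\<in>UNIV. vd (ax i) En p * vd u (G i) p)"
    using spray_eq[OF p, of u] by simp
  thus ?thesis by (simp add: mult.commute)
qed

lemma dir_deriv_En: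
  assumes "p \<in> D"
  shows "dir_deriv e En p = Lf p * dir_deriv e Lf p"
  using assms dir_deriv_cmult[of "\<lambda>p. Lf p * Lf p" p e "1/2"]
  unfolding En_def[abs_def] by (simp add: all_rules)

lemma dir_deriv2_En:
  assumes "p \<in> D"
  shows "dir_deriv e (dir_deriv e' En) p = dir_deriv e Lf p * dir_deriv e' Lf p + Lf p * dir_deriv e (dir_deriv e' Lf) p"
proof -
  have "dir_deriv e (dir_deriv e' En) p = dir_deriv e (\<lambda>q. Lf q * dir_deriv e' Lf q) p"
    by (rule dd_cong[OF assms dir_deriv_En])
  thus ?thesis using assms by (simp add: all_rules)
qed

lemma horizontal_Lf:
  assumes p: "p \<in> D"
  shows "xd u Lf p = (\<Sum>h\<in>UNIV. vd u (G h) p * vd (ax h) Lf p)"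
proof -
  have "Lf p * xd u Lf p = Lf p * (\<Sum>h\<in>UNIV. vd u (G h) p * vd (ax h) Lf p)"
    using horizontal_energy[OF p, of u] p by (simp add: dir_deriv_En sum_distrib_left mult.left_commute)
  thus ?thesis using Lf_nonzero[OF p] by simp
qed

text \<open>The lowered spray has degree 2 and the metric degree 0; nondegeneracy transfers the
  degree to the components of the spray.\<close>

lemma homog_G: "homog 2 (G i)"
  unfolding homog_def
proof
  fix p assume p: "p \<in> D"
  have "vd (snd p) (G i) p - 2 * G i p = 0"
  proof (rule nondegenerate[OF p, of "\<lambda>i. vd (snd p) (G i) p - 2 * G i p"])
    fix u
    let ?R = "\<lambda>q. (\<Sum>j\<in>UNIV. snd q $ j * xd (ax j) (vd u En) q) - xd u En q"
    let ?S = "\<lambda>q. \<Sum>i\<in>UNIV. vd u (vd (ax i) En) q * G i q"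
    have "homog (1 + 1) ?R"
      by (intro homog_diff homog_sum homog_mult homog_snd_nth homog_xd homog_En1 smooth_rules smooth_En)
        (use homog_En in simp)
    moreover have R: "?R q = 2 * ?S q" if "q \<in> D" for q
      using spray_eq[OF that, of u] that by (simp add: xd_exp[of _ _ "snd q"] all_smooth)
    moreover have "vd (snd p) ?R p = vd (snd p) (\<lambda>q. 2 * ?S q) p" by (rule dd_cong[OF p R])
    ultimately have "vd (snd p) (\<lambda>q. 2 * ?S q) p = 2 * (2 * ?S p)"
      using homogD[OF _ p, of "1 + 1" ?R] R[OF p] by simp
    hence "(\<Sum>i\<in>UNIV. vd u (vd (ax i) En) p * vd (snd p) (G i) p) = 2 * ?S p"
      using p homogD[OF homog_En2 p] by (simp add: all_rules sum.distrib)
    thus "(\<Sum>i\<in>UNIV. vd u (vd (ax i) En) p * (vd (snd p) (G i) p - 2 * G i p)) = 0"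
      by (simp add: right_diff_distrib sum_subtractf sum_distrib_left mult.left_commute)
  qed
  thus "vd (snd p) (G i) p = 2 * G i p" by simp
qed

lemma homog_G1: "homog 1 (vd u (G i))"
  using homog_vd[OF smooth_G homog_G] by simp

lemma homog_G2: "homog 0 (vd u (vd v (G i)))"
  using homog_vd[OF _ homog_G1] by (simp add: all_smooth)

end

section \<open>Horizontal derivatives and the Cartan connection\<close>

context finsler_chart
begin

text \<open>The operator $w^k \delta_k$.\<close>

definition hderiv :: "real^'n \<Rightarrow> ((real^'n) \<times> (real^'n) \<Rightarrow> real) \<Rightarrow> (real^'n) \<times> (real^'n) \<Rightarrow> real" where
  "hderiv w F p = xd w F p - (\<Sum>h\<in>UNIV. vd w (G h) p * vd (ax h) F p)"

lemma hderiv_sum: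
  assumes "p \<in> D" "\<And>a. a \<in> I \<Longrightarrow> smooth_on D (F a)"
  shows "hderiv w (\<lambda>p. \<Sum>a\<in>I. c a * F a p) p = (\<Sum>a\<in>I. c a * hderiv w (F a) p)"
proof -
  have "(\<Sum>h\<in>UNIV. vd w (G h) p * (\<Sum>a\<in>I. c a * vd (ax h) (F a) p))
      = (\<Sum>a\<in>I. c a * (\<Sum>h\<in>UNIV. vd w (G h) p * vd (ax h) (F a) p))"
    unfolding sum_distrib_left by (subst sum.swap) (simp add: mult.left_commute)
  thus ?thesis using assms
    by (simp add: hderiv_def deriv_rules right_diff_distrib sum_subtractf)
qed

lemma hderiv_cong: "p \<in> D \<Longrightarrow> (\<And>q. q \<in> D \<Longrightarrow> F q = F' q) \<Longrightarrow> hderiv w F p = hderiv w F' p"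
  unfolding hderiv_def by (intro arg_cong2[where f = "(-)"] sum.cong arg_cong2[where f = "(*)"] dd_cong refl)

lemma hderiv_exp:
  assumes "p \<in> D" "smooth_on D F"
  shows "hderiv w F p = (\<Sum>k\<in>UNIV. w $ k * hderiv (ax k) F p)"
proof -
  have "(\<Sum>h\<in>UNIV. vd w (G h) p * vd (ax h) F p)
      = (\<Sum>h\<in>UNIV. \<Sum>k\<in>UNIV. w $ k * (vd (ax k) (G h) p * vd (ax h) F p))"
    using assms by (simp add: vd_exp[of p _ w] all_smooth sum_distrib_right mult.assoc)
  also have "\<dots> = (\<Sum>k\<in>UNIV. w $ k * (\<Sum>h\<in>UNIV. vd (ax k) (G h) p * vd (ax h) F p))"
    by (subst sum.swap) (simp add: sum_distrib_left)
  finally show ?thesis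
    using assms by (simp add: hderiv_def xd_exp[of p F w] right_diff_distrib sum_subtractf)
qed

lemma hderiv_dir_derivs:
  assumes p: "p \<in> D" and F: "smooth_on D F"
  shows "hderiv w (vd u (vd v F)) p = (\<Sum>a\<in>UNIV. u $ a * hderiv w (vd (ax a) (vd v F)) p)"
    and "hderiv w (vd u (vd v F)) p = (\<Sum>a\<in>UNIV. v $ a * hderiv w (vd u (vd (ax a) F)) p)"
proof -
  have "hderiv w (vd u (vd v F)) p = hderiv w (\<lambda>q. \<Sum>a\<in>UNIV. u $ a * vd (ax a) (vd v F) q) p"
    by (rule hderiv_cong[OF p]) (rule vd_exp, auto intro: smooth_rules F)
  also have "\<dots> = (\<Sum>a\<in>UNIV. u $ a * hderiv w (vd (ax a) (vd v F)) p)"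
    by (intro hderiv_sum p smooth_rules F)
  finally show "hderiv w (vd u (vd v F)) p = (\<Sum>a\<in>UNIV. u $ a * hderiv w (vd (ax a) (vd v F)) p)" .
  have "hderiv w (vd u (vd v F)) p = hderiv w (\<lambda>q. \<Sum>a\<in>UNIV. v $ a * vd u (vd (ax a) F) q) p"
    by (rule hderiv_cong[OF p]) (rule vd_vd_exp, auto intro: F)
  also have "\<dots> = (\<Sum>a\<in>UNIV. v $ a * hderiv w (vd u (vd (ax a) F)) p)"
    by (intro hderiv_sum p smooth_rules F)
  finally show "hderiv w (vd u (vd v F)) p = (\<Sum>a\<in>UNIV. v $ a * hderiv w (vd u (vd (ax a) F)) p)" .
qed

lemma nonlin_conn_eq: "(x, y) \<in> D \<Longrightarrow> nonlin_conn L i j x y = vd (ax j) (G i) (x, y)"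
  unfolding nonlin_conn_def by (rule dy_eq) (auto simp: smooth_G G_def)

lemma delta_g_low_eq:
  assumes "(x, y) \<in> D"
  shows "delta L k (g_low L i j) x y = hderiv (ax k) (vd (ax i) (vd (ax j) En)) (x, y)"
proof -
  have "dx k (g_low L i j) x y = xd (ax k) (vd (ax i) (vd (ax j) En)) (x, y)"
    by (rule dx_eq[OF assms]) (auto simp: g_low_eq all_smooth)
  moreover have "dy h (g_low L i j) x y = vd (ax h) (vd (ax i) (vd (ax j) En)) (x, y)" for h
    by (rule dy_eq[OF assms]) (auto simp: g_low_eq all_smooth)
  ultimately show ?thesis using assms by (simp add: delta_def hderiv_def nonlin_conn_eq)
qed

text \<open>The vector $F^i_{jk} v^j w^k$.\<close>

definition Fv :: "real^'n \<Rightarrow> real^'n \<Rightarrow> (real^'n) \<times> (real^'n) \<Rightarrow> 'n \<Rightarrow> real" where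
  "Fv v w p i = (\<Sum>j\<in>UNIV. \<Sum>k\<in>UNIV. F_conn L i j k (fst p) (snd p) * v $ j * w $ k)"

text \<open>The Christoffel formula with lowered index. The vectors are constant, so their
  components pass through all derivatives.\<close>

lemma F_conn_lower:
  assumes p: "p \<in> D"
  shows "2 * (\<Sum>i\<in>UNIV. vd u (vd (ax i) En) p * Fv v w p i) =
    hderiv w (vd u (vd v En)) p + hderiv v (vd u (vd w En)) p - hderiv u (vd v (vd w En)) p"
proof -
  obtain x y where xy: "p = (x, y)" by (cases p)
  let ?d = "\<lambda>k i j. hderiv (ax k) (vd (ax i) (vd (ax j) En)) p"
  let ?T = "\<lambda>r j k. ?d k r j + ?d j r k - ?d r j k"
  have F: "2 * (\<Sum>i\<in>UNIV. vd u (vd (ax i) En) p * F_conn L i j k x y) = (\<Sum>r\<in>UNIV. u $ r * ?T r j k)" for j k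
    using g_contract_up[of x y u "\<lambda>r. ?T r j k"] p xy
    by (simp add: F_conn_def delta_g_low_eq sum_distrib_left[of 2])
  have "2 * (\<Sum>i\<in>UNIV. vd u (vd (ax i) En) p * Fv v w p i)
      = (\<Sum>i\<in>UNIV. \<Sum>j\<in>UNIV. \<Sum>k\<in>UNIV. 2 * (vd u (vd (ax i) En) p * F_conn L i j k x y) * v $ j * w $ k)"
    by (simp add: Fv_def xy sum_distrib_left mult.assoc)
  also have "\<dots> = (\<Sum>j\<in>UNIV. \<Sum>k\<in>UNIV. \<Sum>i\<in>UNIV. 2 * (vd u (vd (ax i) En) p * F_conn L i j k x y) * v $ j * w $ k)"
    by (subst sum.swap, rule sum.cong[OF refl], rule sum.swap)
  also have "\<dots> = (\<Sum>j\<in>UNIV. \<Sum>k\<in>UNIV. (\<Sum>r\<in>UNIV. u $ r * ?T r j k) * v $ j * w $ k)"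
    by (simp only: F[symmetric] sum_distrib_left sum_distrib_right)
  also have "\<dots> = (\<Sum>j\<in>UNIV. v $ j * (\<Sum>k\<in>UNIV. w $ k * (\<Sum>r\<in>UNIV. u $ r * ?d k r j)))
     + (\<Sum>j\<in>UNIV. v $ j * (\<Sum>k\<in>UNIV. w $ k * (\<Sum>r\<in>UNIV. u $ r * ?d j r k)))
     - (\<Sum>j\<in>UNIV. v $ j * (\<Sum>k\<in>UNIV. w $ k * (\<Sum>r\<in>UNIV. u $ r * ?d r j k)))"
    by (simp add: sum_distrib_left sum_distrib_right sum.distrib[symmetric] sum_subtractf[symmetric] algebra_simps)
  also have "(\<Sum>j\<in>UNIV. v $ j * (\<Sum>k\<in>UNIV. w $ k * (\<Sum>r\<in>UNIV. u $ r * ?d k r j))) = hderiv w (vd u (vd v En)) p"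
    using p by (simp add: hderiv_dir_derivs(1)[OF p smooth_En, symmetric] hderiv_exp[OF p, symmetric] all_smooth
        hderiv_dir_derivs(2)[OF p smooth_En, symmetric])
  also have "(\<Sum>j\<in>UNIV. v $ j * (\<Sum>k\<in>UNIV. w $ k * (\<Sum>r\<in>UNIV. u $ r * ?d j r k))) = hderiv v (vd u (vd w En)) p"
    using p by (simp add: hderiv_dir_derivs(1)[OF p smooth_En, symmetric] hderiv_exp[OF p, symmetric] all_smooth
        hderiv_dir_derivs(2)[OF p smooth_En, symmetric])
  also have "(\<Sum>j\<in>UNIV. v $ j * (\<Sum>k\<in>UNIV. w $ k * (\<Sum>r\<in>UNIV. u $ r * ?d r j k))) = hderiv u (vd v (vd w En)) p"
    using p by (simp add: hderiv_exp[OF p, symmetric] all_smooth)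
     (simp add: hderiv_dir_derivs(1)[OF p smooth_En, symmetric] hderiv_dir_derivs(2)[OF p smooth_En, symmetric])
  finally show ?thesis .
qed

text \<open>Differentiate the hypothesis twice in \<open>y\<close>; the third derivatives of \<open>\<phi>\<close> cancel.\<close>

lemma hderiv_second_derivative:
  assumes p: "p \<in> D" and smooth: "smooth_on D \<phi>" "smooth_on D \<psi>"
    and eq: "\<And>q. q \<in> D \<Longrightarrow> xd u \<phi> q = (\<Sum>h\<in>UNIV. vd u (G h) q * vd (ax h) \<phi> q) + \<psi> q"
  shows "hderiv u (vd v (vd w \<phi>)) p =
    (\<Sum>h\<in>UNIV. vd v (vd w (vd u (G h))) p * vd (ax h) \<phi> p
       + vd v (vd u (G h)) p * vd w (vd (ax h) \<phi>) p
       + vd w (vd u (G h)) p * vd v (vd (ax h) \<phi>) p) + vd v (vd w \<psi>) p"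
proof -
  have 1: "xd u (vd w \<phi>) q = (\<Sum>h\<in>UNIV. vd u (G h) q * vd w (vd (ax h) \<phi>) q
      + vd w (vd u (G h)) q * vd (ax h) \<phi> q) + vd w \<psi> q" if q: "q \<in> D" for q
  proof -
    have "vd w (xd u \<phi>) q = vd w (\<lambda>q. (\<Sum>h\<in>UNIV. vd u (G h) q * vd (ax h) \<phi> q) + \<psi> q) q"
      by (rule dd_cong[OF q eq])
    thus ?thesis using q smooth by (simp add: all_rules dd_commute[where e = "(u, 0)"])
  qed
  have "xd u (vd v (vd w \<phi>)) p = vd v (xd u (vd w \<phi>)) p"
    using p smooth by (simp add: all_smooth dd_commute[where e = "(u, 0)"])
  also have "\<dots> = (\<Sum>h\<in>UNIV. vd u (G h) p * vd v (vd w (vd (ax h) \<phi>)) p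
      + vd v (vd u (G h)) p * vd w (vd (ax h) \<phi>) p
      + vd w (vd u (G h)) p * vd v (vd (ax h) \<phi>) p
      + vd v (vd w (vd u (G h))) p * vd (ax h) \<phi> p) + vd v (vd w \<psi>) p"
  proof -
    have "vd v (xd u (vd w \<phi>)) p = vd v (\<lambda>q. (\<Sum>h\<in>UNIV. vd u (G h) q * vd w (vd (ax h) \<phi>) q
      + vd w (vd u (G h)) q * vd (ax h) \<phi> q) + vd w \<psi> q) p"
      by (rule dd_cong[OF p 1])
    thus ?thesis using p smooth by (simp add: all_rules add_ac)
  qed
  moreover have "vd (ax h) (vd v (vd w \<phi>)) p = vd v (vd w (vd (ax h) \<phi>)) p" for h
    using p smooth by (simp add: all_smooth dd_commute[where e = "(0, ax h)"] dd_commute3)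
  ultimately show ?thesis
    by (simp add: hderiv_def sum_subtractf[symmetric] sum.distrib)
qed

text \<open>Three instances of \<open>hderiv_second_derivative\<close>. Of the products of second
  derivatives of the spray with the Hessian of \<phi>, two kinds cancel and one doubles; the third
  derivatives of the spray are symmetric, so one copy survives. The function \<psi> measures how far
  \<phi> is from being horizontally constant, which lets the formula serve the energies of both
  metrics.\<close>

lemma hderiv_Christoffel_sum:
  assumes p: "p \<in> D" and smooth: "smooth_on D \<phi>" "\<And>u. smooth_on D (\<psi> u)"
    and eq: "\<And>u q. q \<in> D \<Longrightarrow> xd u \<phi> q = (\<Sum>h\<in>UNIV. vd u (G h) q * vd (ax h) \<phi> q) + \<psi> u q"
  shows "hderiv w (vd u (vd v \<phi>)) p + hderiv v (vd u (vd w \<phi>)) p - hderiv u (vd v (vd w \<phi>)) p =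
    (\<Sum>h\<in>UNIV. vd u (vd v (vd w (G h))) p * vd (ax h) \<phi> p
       + 2 * (vd v (vd w (G h)) p * vd u (vd (ax h) \<phi>) p))
    + (vd u (vd v (\<psi> w)) p + vd u (vd w (\<psi> v)) p - vd v (vd w (\<psi> u)) p)"
proof -
  have hderiv: "hderiv a (vd b (vd c \<phi>)) p = (\<Sum>h\<in>UNIV. vd b (vd c (vd a (G h))) p * vd (ax h) \<phi> p
       + vd b (vd a (G h)) p * vd c (vd (ax h) \<phi>) p
       + vd c (vd a (G h)) p * vd b (vd (ax h) \<phi>) p) + vd b (vd c (\<psi> a)) p" for a b c
    by (rule hderiv_second_derivative[OF p smooth eq])
  have G2: "vd b (vd a (G h)) p = vd a (vd b (G h)) p" for b a h
    by (rule dd_commute[OF p smooth_G])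
  have G3: "vd v (vd w (vd u (G h))) p = vd u (vd v (vd w (G h))) p"
    "vd u (vd w (vd v (G h))) p = vd u (vd v (vd w (G h))) p" for h
    using dd_commute3[OF p smooth_G, of "(0, v)" "(0, w)" "(0, u)" h]
      dd_commute[OF p smooth_rules(6)[OF smooth_G], of "(0, v)" "(0, u)" "(0, w)" h]
      dd_commute3[OF p smooth_G, of "(0, u)" "(0, w)" "(0, v)" h] by simp_all
  show ?thesis
    unfolding hderiv G3 G2[of w v] G2[of v u] G2[of w u]
    by (simp add: sum.distrib sum_subtractf sum_distrib_left algebra_simps)
qed

text \<open>The Cartan coefficients are split into the Berwald coefficients, which are second
  derivatives of the spray, and a Landsberg term made of its third derivatives.\<close>

lemma F_conn_lower_Berwald:
  assumes p: "p \<in> D"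
  shows "2 * (\<Sum>i\<in>UNIV. vd u (vd (ax i) En) p * Fv v w p i) =
    (\<Sum>h\<in>UNIV. vd u (vd v (vd w (G h))) p * vd (ax h) En p
       + 2 * (vd v (vd w (G h)) p * vd u (vd (ax h) En) p))"
  unfolding F_conn_lower[OF p]
  by (subst hderiv_Christoffel_sum[OF p smooth_En, of "\<lambda>u q. 0"])
    (simp_all add: smooth_on_const horizontal_energy)

lemma metric_contraction_cancel:
  assumes p: "p \<in> D"
    and "\<And>u. (\<Sum>i\<in>UNIV. vd u (vd (ax i) En) p * w i) = (\<Sum>i\<in>UNIV. vd u (vd (ax i) En) p * w' i)"
  shows "w i = w' i"
  using nondegenerate[OF p, of "\<lambda>i. w i - w' i" i] assms(2)
  by (simp add: right_diff_distrib sum_subtractf)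

text \<open>With \<open>v\<close> the supporting element, homogeneity kills the third-derivative
  term of \<open>F_conn_lower_Berwald\<close> and reduces the second derivative of the spray to a
  first one.\<close>

lemma Fv_supporting:
  assumes p: "p \<in> D"
  shows "Fv (snd p) w p i = vd w (G i) p"
proof (rule metric_contraction_cancel[OF p])
  fix u
  have "vd (snd p) (vd w (G h)) p = vd w (G h) p" for h
    using homogD[OF homog_G1 p] by simp
  moreover have "vd u (vd (snd p) (vd w (G h))) p = 0" for h
    using homogD[OF homog_G2 p, of u w h]
      dd_commute[OF p smooth_rules(6)[OF smooth_G], of "(0, u)" "(0, snd p)" "(0, w)" h] by simp
  ultimately have "2 * (\<Sum>i\<in>UNIV. vd u (vd (ax i) En) p * Fv (snd p) w p i)
      = 2 * (\<Sum>i\<in>UNIV. vd u (vd (ax i) En) p * vd w (G i) p)"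
    unfolding F_conn_lower_Berwald[OF p] by (simp add: sum_distrib_left mult.commute)
  thus "(\<Sum>i\<in>UNIV. vd u (vd (ax i) En) p * Fv (snd p) w p i)
      = (\<Sum>i\<in>UNIV. vd u (vd (ax i) En) p * vd w (G i) p)" by simp
qed

lemma F_conn_sym:
  assumes "(x, y) \<in> D"
  shows "F_conn L i j k x y = F_conn L i k j x y"
proof -
  have "delta L r (g_low L j k) x y = delta L r (g_low L k j) x y" for r
    unfolding delta_g_low_eq[OF assms] by (rule hderiv_cong[OF assms]) (rule dd_commute, auto intro: smooth_En)
  thus ?thesis unfolding F_conn_def by (simp add: add.commute)
qed

lemma F_conn_supporting:
  assumes "(x, y) \<in> D"
  shows "(\<Sum>j\<in>UNIV. F_conn L i j k x y * y $ j) = nonlin_conn L i k x y"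
  using Fv_supporting[OF assms, of "ax k" i] assms
  by (simp add: Fv_def nonlin_conn_eq axis_def if_distrib[of "\<lambda>c. _ * c"] cong: if_cong)

end

section \<open>Gradient h-vectors\<close>

locale h_vector_chart = finsler_chart D L for D :: "((real^'n::finite) \<times> (real^'n)) set" and L +
  fixes b :: "'n \<Rightarrow> 'n tmfun" and \<rho> :: "'n tmfun"
  assumes smooth_b: "smooth_on D (\<lambda>(x, y). b i x y)"
    and v_cov_b: "(x, y) \<in> D \<Longrightarrow> v_cov L b i k x y = 0"
    and rho_nonzero: "(x, y) \<in> D \<Longrightarrow> \<rho> x y \<noteq> 0"
    and C_up_b: "(x, y) \<in> D \<Longrightarrow> L x y * (\<Sum>h\<in>UNIV. C_up L h i j x y * b h x y) = \<rho> x y * h_low L i j x y"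
    and gradient_b: "(x, y) \<in> D \<Longrightarrow> h_cov L b i j x y = h_cov L b j i x y"
    and h_cov_C: "(x, y) \<in> D \<Longrightarrow>
      (\<Sum>r\<in>UNIV. (\<Sum>k\<in>UNIV. h_cov L b r k x y * y $ k) * C_up L r i j x y) = 0"
begin

definition bf :: "'n \<Rightarrow> (real^'n) \<times> (real^'n) \<Rightarrow> real" where
  "bf i p = b i (fst p) (snd p)"

definition Be :: "(real^'n) \<times> (real^'n) \<Rightarrow> real" where
  "Be p = beta b (fst p) (snd p)"

definition rho :: "(real^'n) \<times> (real^'n) \<Rightarrow> real" where
  "rho p = \<rho> (fst p) (snd p)"

lemma smooth_bf: "smooth_on D (bf i)"
  using smooth_b by (simp add: bf_def[abs_def] case_prod_unfold)

lemma Be_eq: "Be = (\<lambda>p. \<Sum>i\<in>UNIV. bf i p * snd p $ i)"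
  by (simp add: Be_def[abs_def] beta_def bf_def)

lemma smooth_Be: "smooth_on D Be"
  unfolding Be_eq by (intro smooth_rules smooth_bf)

lemmas b_rules = all_rules smooth_bf smooth_Be

lemma C_up_b_eq:
  assumes "(x, y) \<in> D"
  shows "(\<Sum>h\<in>UNIV. C_up L h i j x y * b h x y) = rho (x, y) * vd (ax i) (vd (ax j) Lf) (x, y)"
proof -
  have "dy i (dy j L) x y = vd (ax i) (vd (ax j) Lf) (x, y)"
    by (rule dy_eq[OF assms]) (auto intro!: smooths dy_eq simp: Lf_def)
  thus ?thesis using C_up_b[OF assms, of i j] L_nonzero[OF assms] by (simp add: h_low_def rho_def)
qed

text \<open>The vanishing v-covariant derivative expresses the fibre derivative of \<open>b\<close>
  by the Cartan tensor, and the second h-vector condition turns that into a multiple of the angular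
  metric. Dividing by \<open>L\<close> leaves the Hessian of \<open>L\<close>.\<close>

lemma vd_bf:
  assumes "p \<in> D"
  shows "vd v (bf i) p = rho p * vd v (vd (ax i) Lf) p"
proof -
  obtain x y where xy: "p = (x, y)" by (cases p)
  have "vd (ax k) (bf i) p = rho p * vd (ax k) (vd (ax i) Lf) p" for k
  proof -
    have "vd (ax k) (bf i) p = dy k (b i) x y"
      using assms xy dy_eq[of x y "bf i" "b i" k] by (simp add: smooth_bf bf_def)
    also have "\<dots> = rho p * vd (ax i) (vd (ax k) Lf) p"
      using v_cov_b[of x y i k] C_up_b_eq[of x y i k] assms xy by (simp add: v_cov_def)
    finally show ?thesis using dd_commute[OF assms smooth_Lf, of "(0, ax i)" "(0, ax k)"] by simp
  qed
  thus ?thesis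
    using assms by (simp add: vd_exp[of p _ v] b_rules sum_distrib_left mult.left_commute)
qed

text \<open>The supporting element lies in the kernel of the Hessian of \<open>Lf\<close>, which has
  degree 1. Thus the dependence of \<open>b\<close> on the supporting element does not contribute to
  fibre derivatives of \<beta>.\<close>

lemma vd_supporting_bf: "p \<in> D \<Longrightarrow> (\<Sum>i\<in>UNIV. snd p $ i * vd v (bf i) p) = 0"
proof -
  assume p: "p \<in> D"
  have "(\<Sum>i\<in>UNIV. snd p $ i * vd v (bf i) p) = rho p * (\<Sum>i\<in>UNIV. snd p $ i * vd v (vd (ax i) Lf) p)"
    using p by (simp add: vd_bf sum_distrib_left mult.left_commute)
  also have "(\<Sum>i\<in>UNIV. snd p $ i * vd v (vd (ax i) Lf) p) = vd (snd p) (vd v Lf) p"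
    using p vd_vd_exp[OF p smooth_Lf, of v "snd p"] dd_commute[OF p smooth_Lf, of "(0, v)" "(0, snd p)"] by simp
  also have "\<dots> = 0" using homogD[OF homog_vd[OF smooth_Lf homog_Lf] p] by simp
  finally show ?thesis by simp
qed

lemma vd_Be:
  assumes "p \<in> D"
  shows "vd v Be p = (\<Sum>i\<in>UNIV. v $ i * bf i p)"
  using assms vd_supporting_bf[OF assms, of v]
  by (simp add: Be_eq b_rules sum.distrib mult.commute)

lemma vd_vd_Be:
  assumes "p \<in> D"
  shows "vd u (vd v Be) p = rho p * vd u (vd v Lf) p"
proof -
  have "vd u (vd v Be) p = vd u (\<lambda>q. \<Sum>i\<in>UNIV. v $ i * bf i q) p"
    by (rule dd_cong[OF assms vd_Be])
  also have "\<dots> = (\<Sum>i\<in>UNIV. v $ i * (rho p * vd u (vd (ax i) Lf) p))"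
    using assms by (simp add: b_rules vd_bf)
  also have "\<dots> = rho p * vd u (vd v Lf) p"
    using assms by (simp add: vd_vd_exp[of p Lf u v] smooths sum_distrib_left mult.left_commute)
  finally show ?thesis .
qed

lemma homog_Be: "homog 1 Be"
  by (simp add: homog_def vd_Be) (simp add: Be_eq mult.commute)

lemma xd_Be:
  assumes "p \<in> D"
  shows "xd v Be p = (\<Sum>i\<in>UNIV. snd p $ i * xd v (bf i) p)"
  using assms by (simp add: Be_eq b_rules mult.commute)

lemma h_cov_b_eq:
  assumes "(x, y) \<in> D"
  shows "h_cov L b i j x y = hderiv (ax j) (bf i) (x, y) - (\<Sum>r\<in>UNIV. F_conn L r i j x y * b r x y)"
proof -
  have "dx j (b i) x y = xd (ax j) (bf i) (x, y)"
    by (rule dx_eq[OF assms smooth_bf]) (simp add: bf_def)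
  moreover have "dy h (b i) x y = vd (ax h) (bf i) (x, y)" for h
    by (rule dy_eq[OF assms smooth_bf]) (simp add: bf_def)
  ultimately show ?thesis using assms by (simp add: h_cov_def hderiv_def nonlin_conn_eq mult.commute)
qed

text \<open>The gradient condition moves the contraction to the index of \<open>b\<close>. The fibre
  derivatives of \<open>b\<close> then drop out by \<open>vd_supporting_bf\<close>, and the
  contracted connection coefficients become the nonlinear connection.\<close>

lemma h_cov_supporting:
  assumes "(x, y) \<in> D"
  shows "(\<Sum>k\<in>UNIV. h_cov L b r k x y * y $ k) = hderiv (ax r) Be (x, y)"
proof -
  let ?p = "(x, y)"
  have "(\<Sum>k\<in>UNIV. h_cov L b r k x y * y $ k) = (\<Sum>k\<in>UNIV. y $ k * h_cov L b k r x y)"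
    using gradient_b[OF assms, of r] by (simp add: mult.commute)
  also have "\<dots> = (\<Sum>k\<in>UNIV. y $ k * xd (ax r) (bf k) ?p)
      - (\<Sum>k\<in>UNIV. y $ k * (\<Sum>h\<in>UNIV. vd (ax r) (G h) ?p * vd (ax h) (bf k) ?p))
      - (\<Sum>k\<in>UNIV. y $ k * (\<Sum>s\<in>UNIV. F_conn L s k r x y * b s x y))"
    using assms by (simp add: h_cov_b_eq hderiv_def right_diff_distrib sum_subtractf)
  also have "(\<Sum>k\<in>UNIV. y $ k * xd (ax r) (bf k) ?p) = xd (ax r) Be ?p"
    using assms by (simp add: xd_Be)
  also have "(\<Sum>k\<in>UNIV. y $ k * (\<Sum>h\<in>UNIV. vd (ax r) (G h) ?p * vd (ax h) (bf k) ?p))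
      = (\<Sum>h\<in>UNIV. vd (ax r) (G h) ?p * (\<Sum>k\<in>UNIV. y $ k * vd (ax h) (bf k) ?p))"
    unfolding sum_distrib_left by (subst sum.swap) (simp add: mult.left_commute)
  also have "\<dots> = 0" using vd_supporting_bf[OF assms] by simp
  also have "(\<Sum>k\<in>UNIV. y $ k * (\<Sum>s\<in>UNIV. F_conn L s k r x y * b s x y))
      = (\<Sum>s\<in>UNIV. (\<Sum>k\<in>UNIV. F_conn L s k r x y * y $ k) * b s x y)"
    unfolding sum_distrib_left sum_distrib_right by (subst sum.swap) (simp add: ac_simps)
  also have "\<dots> = (\<Sum>s\<in>UNIV. vd (ax r) (G s) ?p * vd (ax s) Be ?p)"
    using assms by (simp add: F_conn_supporting nonlin_conn_eq vd_Be axis_def bf_def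
        if_distrib[of "\<lambda>c. c * _"] cong: if_cong)
  finally show ?thesis by (simp add: hderiv_def)
qed

text \<open>Contract the hypothesis $b_{r|0} C^r_{ij} = 0$ with $b^j$: the h-vector condition turns $C^r_{ij} b^j$
  into a nonzero multiple of the angular metric, whose kernel is spanned by the supporting element.\<close>

lemma hderiv_Be_proportional:
  assumes p: "p \<in> D"
  obtains c where "\<And>i. hderiv (ax i) Be p = c * vd (ax i) En p"
proof -
  obtain x y where xy: "p = (x, y)" by (cases p)
  have D: "(x, y) \<in> D" using p xy by simp
  let ?W = "\<lambda>r. hderiv (ax r) Be p" and ?g = "\<lambda>r k. g_up L r k x y" and ?C = "\<lambda>i j k. C_low L i j k x y"
  have C_sym: "?C i j k = ?C i k j" for i j k
    using dd_commute[OF D smooth_rules(6)[OF smooth_En], of "(0, ax i)" "(0, ax j)" "(0, ax k)"]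
      dd_commute3[OF D smooth_En, of "(0, ax k)" "(0, ax i)" "(0, ax j)"]
      dd_commute3[OF D smooth_En, of "(0, ax j)" "(0, ax i)" "(0, ax k)"]
      dd_commute[OF D smooth_rules(6)[OF smooth_En], of "(0, ax k)" "(0, ax j)" "(0, ax i)"]
    by (simp add: C_low_eq[OF D])
  have *: "(\<Sum>r\<in>UNIV. \<Sum>k\<in>UNIV. ?W r * ?g r k * vd (ax i) (vd (ax k) Lf) p) = 0" for i
  proof -
    have "0 = (\<Sum>j\<in>UNIV. (\<Sum>r\<in>UNIV. ?W r * C_up L r i j x y) * (\<Sum>s\<in>UNIV. ?g s j * b s x y))"
      using h_cov_C[OF D, of i] by (simp add: h_cov_supporting[OF D] xy)
    also have "\<dots> = (\<Sum>j\<in>UNIV. \<Sum>r\<in>UNIV. \<Sum>k\<in>UNIV. ?W r * ?g r k * (\<Sum>s\<in>UNIV. ?g s j * ?C i k j * b s x y))"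
      by (simp add: C_up_def sum_distrib_left sum_distrib_right C_sym[of i _ j for j] ac_simps)
    also have "\<dots> = (\<Sum>r\<in>UNIV. \<Sum>k\<in>UNIV. \<Sum>j\<in>UNIV. ?W r * ?g r k * (\<Sum>s\<in>UNIV. ?g s j * ?C i k j * b s x y))"
      by (subst sum.swap, rule sum.cong[OF refl], rule sum.swap)
    also have "\<dots> = (\<Sum>r\<in>UNIV. \<Sum>k\<in>UNIV. ?W r * ?g r k * (\<Sum>s\<in>UNIV. C_up L s i k x y * b s x y))"
      unfolding C_up_def sum_distrib_right
      by (subst sum.swap[of _ UNIV UNIV for f]) (simp add: sum_distrib_left ac_simps)
    also have "\<dots> = rho p * (\<Sum>r\<in>UNIV. \<Sum>k\<in>UNIV. ?W r * ?g r k * vd (ax i) (vd (ax k) Lf) p)"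
      using C_up_b_eq[OF D] by (simp add: xy sum_distrib_left[of "rho _"] ac_simps)
    finally show ?thesis using rho_nonzero[OF D] xy by (simp add: rho_def)
  qed
  have L_sym: "vd (ax i) (vd (ax k) Lf) p = vd (ax k) (vd (ax i) Lf) p" for i k
    by (rule dd_commute[OF p smooth_Lf])
  have "(\<Sum>r\<in>UNIV. \<Sum>k\<in>UNIV. ?W r * ?g r k * vd (ax k) (vd (ax i) Lf) p) = 0" for i
    by (rule trans[OF _ *[of i]]) (intro sum.cong refl arg_cong2[where f = "(*)"] L_sym)
  hence "(\<Sum>r\<in>UNIV. \<Sum>k\<in>UNIV. ?W r * ?g r k * (Lf p * vd (ax k) (vd (ax i) Lf) p)) = 0" for i
    by (simp only: mult.left_commute[of _ "Lf p"] sum_distrib_left[symmetric, of "Lf p"] mult_zero_right)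
  note L_zero = this
  define c where "c = (\<Sum>r\<in>UNIV. \<Sum>k\<in>UNIV. ?W r * ?g r k * vd (ax k) Lf p)"
  \<comment> \<open>The index is lowered again. The Hessian of the energy is the product of two
    derivatives of \<open>Lf\<close> plus \<open>Lf\<close> times its Hessian; the second part
    contributes nothing by \<open>L_zero\<close>.\<close>
  have "?W i = c / Lf p * vd (ax i) En p" for i
  proof -
    have "(\<Sum>k\<in>UNIV. ?g r k * vd (ax k) (vd (ax i) En) p) = (if r = i then 1 else 0)" for r
      using g_inverse(2)[OF D, of r i] D xy by (simp add: g_low_eq)
    hence "?W i = (\<Sum>r\<in>UNIV. ?W r * (\<Sum>k\<in>UNIV. ?g r k * vd (ax k) (vd (ax i) En) p))"
      by (simp add: if_distrib[of "\<lambda>c. _ * c"] cong: if_cong)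
    also have "\<dots> = (\<Sum>r\<in>UNIV. \<Sum>k\<in>UNIV. ?W r * ?g r k * vd (ax k) Lf p * vd (ax i) Lf p)
       + (\<Sum>r\<in>UNIV. \<Sum>k\<in>UNIV. ?W r * ?g r k * (Lf p * vd (ax k) (vd (ax i) Lf) p))"
      by (simp only: dir_deriv2_En[OF p] distrib_left sum.distrib sum_distrib_left mult.assoc)
    also have "\<dots> = c * vd (ax i) Lf p"
      by (simp only: L_zero c_def sum_distrib_right add_0_right)
    finally show ?thesis using Lf_nonzero[OF p] by (simp add: dir_deriv_En[OF p])
  qed
  thus thesis by (rule that)
qed

section \<open>The proportionality factor \<tau>\<close>

text \<open>The constant of \<open>hderiv_Be_proportional\<close>, recovered by contraction with the
  supporting element, along which the derivative of the energy is \<open>2 * En\<close>. The closed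
  formula shows that it is smooth in \<open>p\<close>.\<close>

definition \<tau> :: "(real^'n) \<times> (real^'n) \<Rightarrow> real" where
  "\<tau> p = (\<Sum>i\<in>UNIV. snd p $ i * hderiv (ax i) Be p) * inverse (2 * En p)"

lemma smooth_hderiv: "smooth_on D F \<Longrightarrow> smooth_on D (hderiv u F)"
  unfolding hderiv_def[abs_def] by (intro smooth_rules smooth_G)

lemma smooth_tau: "smooth_on D \<tau>"
  unfolding \<tau>_def[abs_def] by (intro smooth_rules smooth_hderiv smooth_Be smooth_En) (simp add: En_nonzero)

lemma hderiv_Be:
  assumes p: "p \<in> D"
  shows "hderiv u Be p = \<tau> p * vd u En p"
proof -
  obtain c where c: "\<And>i. hderiv (ax i) Be p = c * vd (ax i) En p"
    using hderiv_Be_proportional[OF p] by blast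
  hence *: "(\<Sum>i\<in>UNIV. u $ i * hderiv (ax i) Be p) = c * vd u En p" for u
    using p by (simp add: vd_exp[of p _ u] smooths sum_distrib_left mult.left_commute)
  have "\<tau> p = c"
    using *[of "snd p"] homogD[OF homog_En p] En_nonzero[OF p] by (simp add: \<tau>_def)
  thus ?thesis using hderiv_exp[OF p smooth_Be, of u] * by simp
qed

lemma xd_Be_tau:
  "p \<in> D \<Longrightarrow> xd u Be p = (\<Sum>h\<in>UNIV. vd u (G h) p * vd (ax h) Be p) + \<tau> p * vd u En p"
  using hderiv_Be[of p u] by (simp add: hderiv_def)

lemma homog_tau: "homog 0 \<tau>"
  unfolding homog_def
proof
  fix p assume p: "p \<in> D"
  let ?W = "\<lambda>q. \<Sum>i\<in>UNIV. snd q $ i * hderiv (ax i) Be q"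
  have "homog (1 + 0) (\<lambda>q. \<Sum>h\<in>UNIV. vd u (G h) q * vd (ax h) Be q)" for u
    using homog_vd[OF smooth_Be homog_Be]
    by (intro homog_sum homog_mult homog_G1 smooth_rules smooth_G smooth_Be) auto
  hence hderiv: "homog 1 (hderiv u Be)" for u
    unfolding hderiv_def[abs_def]
    by (intro homog_diff homog_xd homog_Be smooth_rules smooth_G smooth_Be) auto
  have W: "homog (1 + 1) ?W"
    by (intro homog_sum homog_mult homog_snd_nth hderiv smooth_rules smooth_hderiv smooth_Be)
  have "vd (snd p) (\<lambda>q. \<tau> q * (2 * En q)) p = vd (snd p) ?W p"
    by (rule dd_cong[OF p]) (simp add: \<tau>_def En_nonzero)
  hence "\<tau> p * (2 * (2 * En p)) + vd (snd p) \<tau> p * (2 * En p) = 2 * ?W p"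
    using p homogD[OF W p] homogD[OF homog_En p] by (simp add: deriv_rules smooth_En smooth_tau)
  also have "?W p = \<tau> p * (2 * En p)" by (simp add: \<tau>_def En_nonzero p)
  finally show "vd (snd p) \<tau> p = 0 * \<tau> p" using En_nonzero[OF p] by simp
qed

text \<open>The fibre derivatives of \<beta> are the components of \<open>b\<close>, so this is the
  gradient condition after the symmetric connection coefficients cancel.\<close>

lemma hderiv_vd_Be_sym:
  assumes p: "p \<in> D"
  shows "hderiv u (vd v Be) p = hderiv v (vd u Be) p"
proof -
  obtain x y where xy: "p = (x, y)" by (cases p)
  have sym: "hderiv (ax k) (bf i) p = hderiv (ax i) (bf k) p" for i k
    using gradient_b[of x y i k] p xy F_conn_sym[of x y _ i k] by (simp add: h_cov_b_eq)
  have exp: "hderiv u (vd v Be) p = (\<Sum>i\<in>UNIV. v $ i * (\<Sum>k\<in>UNIV. u $ k * hderiv (ax k) (bf i) p))" for u v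
  proof -
    have "hderiv u (vd v Be) p = hderiv u (\<lambda>q. \<Sum>i\<in>UNIV. v $ i * bf i q) p"
      by (rule hderiv_cong[OF p vd_Be])
    thus ?thesis using p by (simp add: hderiv_sum smooth_bf hderiv_exp[OF p smooth_bf, of u])
  qed
  show ?thesis unfolding exp[of u v] exp[of v u] sum_distrib_left
    by (subst sum.swap) (simp add: sym mult.left_commute)
qed

text \<open>Differentiate \<open>xd_Be_tau\<close> along \<open>v\<close> and exchange
  \<open>u\<close> and \<open>v\<close>. All terms are symmetric except the derivative of \<tau>
  along \<open>v\<close> times that of the energy along \<open>u\<close>. Take \<open>u\<close> to
  be the supporting element: there \<tau> has derivative zero and the energy a nonzero one.\<close>

lemma vd_tau:
  assumes p: "p \<in> D"
  shows "vd v \<tau> p = 0"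
proof -
  have "hderiv u (vd v Be) p = (\<Sum>h\<in>UNIV. vd v (vd u (G h)) p * vd (ax h) Be p)
      + vd v \<tau> p * vd u En p + \<tau> p * vd v (vd u En) p" for u v
  proof -
    have "vd v (xd u Be) p = vd v (\<lambda>q. (\<Sum>h\<in>UNIV. vd u (G h) q * vd (ax h) Be q) + \<tau> q * vd u En q) p"
      by (rule dd_cong[OF p xd_Be_tau])
    also have "\<dots> = (\<Sum>h\<in>UNIV. vd u (G h) p * vd v (vd (ax h) Be) p) + (\<Sum>h\<in>UNIV. vd v (vd u (G h)) p * vd (ax h) Be p)
      + \<tau> p * vd v (vd u En) p + vd v \<tau> p * vd u En p"
      using p by (simp add: b_rules smooth_tau sum.distrib)
    finally show ?thesis
      using dd_commute[OF p smooth_Be, of "(u, 0)" "(0, v)"] dd_commute[OF p smooth_Be, of "(0, v)" "(0, ax h)" for h]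
      by (simp add: hderiv_def)
  qed
  from this[of "snd p" v] this[of v "snd p"]
  have "vd v \<tau> p * vd (snd p) En p = vd (snd p) \<tau> p * vd v En p"
    using hderiv_vd_Be_sym[OF p, of "snd p" v] dd_commute[OF p smooth_En, of "(0, v)" "(0, snd p)"]
      dd_commute[OF p smooth_G, of "(0, v)" "(0, snd p)"] by simp
  thus ?thesis using homogD[OF homog_tau p] homogD[OF homog_En p] En_nonzero[OF p] by simp
qed

end

section \<open>Leibniz rules of second and third order\<close>

context open_domain
begin

lemma dd2_mult:
  assumes "p \<in> D" "smooth_on D F" "smooth_on D H"
  shows "dir_deriv e (dir_deriv e' (\<lambda>p. F p * H p)) p =
    F p * dir_deriv e (dir_deriv e' H) p + dir_deriv e F p * dir_deriv e' H p
      + dir_deriv e' F p * dir_deriv e H p + dir_deriv e (dir_deriv e' F) p * H p"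
proof -
  have "dir_deriv e (dir_deriv e' (\<lambda>p. F p * H p)) p
      = dir_deriv e (\<lambda>q. F q * dir_deriv e' H q + dir_deriv e' F q * H q) p"
    by (rule dd_cong[OF assms(1)]) (use assms in \<open>simp add: deriv_rules\<close>)
  thus ?thesis using assms by (simp add: deriv_rules)
qed

lemma dd3_mult:
  assumes "p \<in> D" "smooth_on D F" "smooth_on D H"
  shows "dir_deriv e (dir_deriv e' (dir_deriv e'' (\<lambda>p. F p * H p))) p =
    F p * dir_deriv e (dir_deriv e' (dir_deriv e'' H)) p + dir_deriv e F p * dir_deriv e' (dir_deriv e'' H) p
      + dir_deriv e' F p * dir_deriv e (dir_deriv e'' H) p + dir_deriv e (dir_deriv e' F) p * dir_deriv e'' H p
      + dir_deriv e'' F p * dir_deriv e (dir_deriv e' H) p + dir_deriv e (dir_deriv e'' F) p * dir_deriv e' H p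
      + dir_deriv e' (dir_deriv e'' F) p * dir_deriv e H p + dir_deriv e (dir_deriv e' (dir_deriv e'' F)) p * H p"
proof -
  have "dir_deriv e (dir_deriv e' (dir_deriv e'' (\<lambda>p. F p * H p))) p
      = dir_deriv e (\<lambda>q. F q * dir_deriv e' (dir_deriv e'' H) q + dir_deriv e' F q * dir_deriv e'' H q
      + dir_deriv e'' F q * dir_deriv e' H q + dir_deriv e' (dir_deriv e'' F) q * H q) p"
    by (rule dd_cong[OF assms(1)]) (use assms in \<open>simp add: dd2_mult\<close>)
  thus ?thesis using assms by (simp add: deriv_rules)
qed

lemma vd_vd_vd_exp:
  assumes "p \<in> D" "smooth_on D F"
  shows "vd w (vd u (vd v F)) p = (\<Sum>i\<in>UNIV. v $ i * vd w (vd u (vd (ax i) F)) p)"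
proof -
  have "vd w (vd u (vd v F)) p = vd w (\<lambda>q. \<Sum>i\<in>UNIV. v $ i * vd u (vd (ax i) F) q) p"
    by (rule dd_cong[OF assms(1)]) (rule vd_vd_exp[OF _ assms(2)])
  thus ?thesis using assms by (simp add: deriv_rules)
qed

lemma vd_decompose:
  assumes "p \<in> D" "smooth_on D F"
  shows "vd (u + c *\<^sub>R v) F p = vd u F p + c * vd v F p"
    and "vd (u - c *\<^sub>R v) F p = vd u F p - c * vd v F p"
proof -
  show *: "vd (u + c *\<^sub>R v) F p = vd u F p + c * vd v F p" for c
    using dir_deriv_lin(1)[OF diff[OF assms], of "(0, u)" "c *\<^sub>R (0, v)"]
      dir_deriv_lin(2)[OF diff[OF assms], of c "(0, v)"] by simp
  show "vd (u - c *\<^sub>R v) F p = vd u F p - c * vd v F p"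
    using *[of "- c"] by simp
qed

end

section \<open>The Kropina change\<close>

locale kropina_chart = h_vector_chart D L b \<rho> + K: finsler_chart D Ls
  for D :: "((real^'n::finite) \<times> (real^'n)) set" and L b \<rho> Ls +
  assumes beta_nonzero: "(x, y) \<in> D \<Longrightarrow> beta b x y \<noteq> 0"
    and Ls_eq: "(x, y) \<in> D \<Longrightarrow> Ls x y = (L x y)\<^sup>2 / beta b x y"
begin

lemma Be_nonzero: "p \<in> D \<Longrightarrow> Be p \<noteq> 0"
  using beta_nonzero[of "fst p" "snd p"] by (simp add: Be_def)

lemma KLf: "p \<in> D \<Longrightarrow> K.Lf p * Be p = Lf p * Lf p"
  using Ls_eq[of "fst p" "snd p"] Be_nonzero[of p] by (simp add: K.Lf_def Lf_def Be_def power2_eq_square)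

text \<open>\<open>cL\<close> and \<open>- cB\<close> are the partial derivatives of \<open>1/2 (L\<^sup>2/\<beta>)\<^sup>2\<close> with respect to \<open>L\<close> and \<open>\<beta>\<close>.\<close>

definition cL :: "(real^'n) \<times> (real^'n) \<Rightarrow> real" where
  "cL p = 2 * (Lf p * Lf p * Lf p * (inverse (Be p) * inverse (Be p)))"

definition cB :: "(real^'n) \<times> (real^'n) \<Rightarrow> real" where
  "cB p = Lf p * Lf p * Lf p * Lf p * (inverse (Be p) * inverse (Be p) * inverse (Be p))"

text \<open>The factor in \<open>horizontal_KEn\<close>. Like \<open>cL\<close> and
  \<open>cB\<close> it is built from products and inverses only, so the closure rules for smoothness
  and for \<open>flat\<close> apply directly.\<close>

definition \<eta> :: "(real^'n) \<times> (real^'n) \<Rightarrow> real" where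
  "\<eta> p = - 1 * (cB p * \<tau> p)"

lemma smooth_Be_inverse: "smooth_on D (\<lambda>p. inverse (Be p))"
  by (intro smooth_rules smooth_Be) (rule Be_nonzero)

lemma smooth_cL: "smooth_on D cL" and smooth_cB: "smooth_on D cB" and smooth_eta: "smooth_on D \<eta>"
  unfolding cL_def[abs_def] cB_def[abs_def] \<eta>_def[abs_def]
  by (intro smooth_rules smooth_Be_inverse smooth_Lf smooth_tau)+

lemmas k_smooth = smooth_rules smooth_Lf smooth_En smooth_Be smooth_cL smooth_cB smooth_eta smooth_tau
  smooth_G K.smooth_En K.smooth_Lf K.smooth_G
lemmas k_rules = deriv_rules smooth_Lf smooth_En smooth_Be smooth_cL smooth_cB smooth_eta smooth_tau
  smooth_G K.smooth_En K.smooth_Lf K.smooth_G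

lemma dir_deriv_KEn:
  assumes p: "p \<in> D"
  shows "dir_deriv e K.En p = cL p * dir_deriv e Lf p - cB p * dir_deriv e Be p"
proof -
  have "dir_deriv e (\<lambda>q. K.Lf q * Be q) p = dir_deriv e (\<lambda>q. Lf q * Lf q) p"
    by (rule dd_cong[OF p KLf])
  hence "dir_deriv e K.Lf p * Be p = 2 * Lf p * dir_deriv e Lf p - K.Lf p * dir_deriv e Be p"
    using p by (simp add: k_rules)
  hence *: "dir_deriv e K.Lf p = (2 * Lf p * dir_deriv e Lf p - K.Lf p * dir_deriv e Be p) / Be p"
    using Be_nonzero[OF p] by (simp add: field_simps)
  have K: "K.Lf p = Lf p * Lf p / Be p"
    using KLf[OF p] Be_nonzero[OF p] by (simp add: field_simps)
  show ?thesis
    using Be_nonzero[OF p] by (simp only: K.dir_deriv_En[OF p] * K cL_def cB_def) (simp add: field_simps)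
qed

text \<open>By the chain rule only the \<beta> part remains: \<open>Lf\<close> is horizontally
  constant, and the horizontal derivative of \<open>Be\<close> is \<tau> times the fibre derivative
  of the energy.\<close>

lemma horizontal_KEn:
  assumes p: "p \<in> D"
  shows "xd u K.En p = (\<Sum>h\<in>UNIV. vd u (G h) p * vd (ax h) K.En p) + \<eta> p * vd u En p"
proof -
  have "xd u K.En p = cL p * (\<Sum>h\<in>UNIV. vd u (G h) p * vd (ax h) Lf p)
      - cB p * ((\<Sum>h\<in>UNIV. vd u (G h) p * vd (ax h) Be p) + \<tau> p * vd u En p)"
    using p by (simp add: dir_deriv_KEn horizontal_Lf xd_Be_tau)
  thus ?thesis using p
    by (simp add: dir_deriv_KEn \<eta>_def right_diff_distrib sum_subtractf sum_distrib_left algebra_simps)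
qed

section \<open>The difference of the two sprays\<close>

definition Df :: "'n \<Rightarrow> (real^'n) \<times> (real^'n) \<Rightarrow> real" where
  "Df i p = K.G i p - G i p"

lemma smooth_Df: "smooth_on D (Df i)"
  unfolding Df_def[abs_def] by (intro k_smooth)

text \<open>Take \<open>horizontal_KEn\<close> along the supporting element, differentiate it along
  \<open>u\<close>, and subtract \<open>horizontal_KEn\<close> along \<open>u\<close>. The
  undifferentiated \<eta> terms cancel, and comparison with the starred \<open>spray_eq\<close>
  isolates the difference of the sprays.\<close>

lemma spray_difference:
  assumes p: "p \<in> D"
  shows "(\<Sum>i\<in>UNIV. vd u (vd (ax i) K.En) p * Df i p) = En p * vd u \<eta> p"
proof -
  let ?y = "snd p" and ?S = "\<lambda>c H. \<Sum>h\<in>UNIV. c h * H h"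
  have G1: "vd u (vd ?y (G h)) p = vd u (G h) p" for h
    using homogD[OF homog_G1 p, of u h] dd_commute[OF p smooth_G, of "(0, u)" "(0, ?y)" h] by simp
  have E1: "vd u (vd ?y En) p = vd u En p"
    using homogD[OF homog_En1 p, of u] dd_commute[OF p smooth_En, of "(0, u)" "(0, ?y)"] by simp
  have "vd u (xd ?y K.En) p = vd u (\<lambda>q. (\<Sum>h\<in>UNIV. vd ?y (G h) q * vd (ax h) K.En q) + \<eta> q * vd ?y En q) p"
    by (rule dd_cong[OF p horizontal_KEn])
  also have "\<dots> = (\<Sum>h\<in>UNIV. vd ?y (G h) p * vd u (vd (ax h) K.En) p)
      + (\<Sum>h\<in>UNIV. vd u (vd ?y (G h)) p * vd (ax h) K.En p)
      + \<eta> p * vd u (vd ?y En) p + vd u \<eta> p * vd ?y En p"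
    using p by (simp add: k_rules sum.distrib)
  also have "\<dots> = 2 * (\<Sum>h\<in>UNIV. vd u (vd (ax h) K.En) p * G h p)
      + (\<Sum>h\<in>UNIV. vd u (G h) p * vd (ax h) K.En p) + \<eta> p * vd u En p + 2 * (En p * vd u \<eta> p)"
    using homogD[OF homog_G p] homogD[OF homog_En p]
    by (simp add: G1 E1 sum_distrib_left ac_simps)
  finally have "xd ?y (vd u K.En) p - xd u K.En p =
      2 * (\<Sum>h\<in>UNIV. vd u (vd (ax h) K.En) p * G h p) + 2 * (En p * vd u \<eta> p)"
    using horizontal_KEn[OF p, of u] dd_commute[OF p K.smooth_En, of "(?y, 0)" "(0, u)"] by simp
  hence "(\<Sum>h\<in>UNIV. vd u (vd (ax h) K.En) p * K.G h p) =
      (\<Sum>h\<in>UNIV. vd u (vd (ax h) K.En) p * G h p) + En p * vd u \<eta> p"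
    using K.spray_eq[OF p, of u] by simp
  thus ?thesis by (simp add: Df_def right_diff_distrib sum_subtractf)
qed

text \<open>The product rule applied to \<open>spray_difference\<close>. The components of the spray
  difference and of its derivative are frozen at \<open>p\<close>, so that contractions become
  directional derivatives of the starred energy.\<close>

lemma spray_difference_derivative:
  assumes p: "p \<in> D"
  shows "vd w (vd u (vd (\<chi> i. Df i p) K.En)) p + vd u (vd (\<chi> i. vd w (Df i) p) K.En) p
     = vd w En p * vd u \<eta> p + En p * vd w (vd u \<eta>) p"
proof -
  have "vd w (\<lambda>q. \<Sum>i\<in>UNIV. vd u (vd (ax i) K.En) q * Df i q) p = vd w (\<lambda>q. En q * vd u \<eta> q) p"
    by (rule dd_cong[OF p spray_difference])
  hence "(\<Sum>i\<in>UNIV. vd u (vd (ax i) K.En) p * vd w (Df i) p) + (\<Sum>i\<in>UNIV. vd w (vd u (vd (ax i) K.En)) p * Df i p)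
      = En p * vd w (vd u \<eta>) p + vd w En p * vd u \<eta> p"
    using p by (simp add: k_rules smooth_Df sum.distrib)
  thus ?thesis using p by (simp add: vd_vd_vd_exp[of p K.En w u] vd_vd_exp[of p K.En u] k_smooth mult.commute)
qed

lemma K_hderiv_eq:
  assumes p: "p \<in> D" and F: "smooth_on D F"
  shows "K.hderiv w F p = hderiv w F p - vd (\<chi> i. vd w (Df i) p) F p"
proof -
  have "vd w (K.G h) p = vd w (G h) p + vd w (Df h) p" for h
    unfolding Df_def[abs_def] using p by (simp add: k_rules)
  thus ?thesis using p F
    by (simp add: K.hderiv_def hderiv_def vd_exp[of p F "\<chi> i. vd w (Df i) p"] distrib_right sum.distrib)
qed

end

section \<open>Mixed normal and tangential derivatives at a supporting element of the
  hypersurface\<close>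

text \<open>The geometry at one supporting element. \<open>C_normal\<close> is the vanishing of the
  second fundamental v-tensor, stated for all vectors orthogonal to \<open>N\<close>.\<close>

locale kropina_tangent = kropina_chart D L b \<rho> Ls
  for D :: "((real^'n::finite) \<times> (real^'n)) set" and L b \<rho> Ls +
  fixes p :: "(real^'n) \<times> (real^'n)" and N :: "real^'n"
  assumes p: "p \<in> D"
    and N_unit: "vd N (vd N En) p = 1"
    and supporting_tangent: "vd N (vd (snd p) En) p = 0"
    and b_tangential: "vd N Be p = 0"
    and C_normal: "vd N (vd B En) p = 0 \<Longrightarrow> vd N (vd B' En) p = 0 \<Longrightarrow> vd N (vd B (vd B' En)) p = 0"
begin

definition T :: "(real^'n) set" where
  "T = {B. vd N (vd B En) p = 0}"

text \<open>Only derivatives with exactly one normal direction are recorded. In every Leibniz term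
  that direction falls on one factor, hence products inherit the property. The second-order version
  is kept for products containing a derivative of the energy.\<close>

definition flat1 :: "((real^'n) \<times> (real^'n) \<Rightarrow> real) \<Rightarrow> bool" where
  "flat1 F \<longleftrightarrow> vd N F p = 0 \<and> (\<forall>B\<in>T. vd N (vd B F) p = 0)"

definition flat :: "((real^'n) \<times> (real^'n) \<Rightarrow> real) \<Rightarrow> bool" where
  "flat F \<longleftrightarrow> flat1 F \<and> (\<forall>B\<in>T. \<forall>B'\<in>T. vd N (vd B (vd B' F)) p = 0)"

lemma flat_const: "flat (\<lambda>q. c)"
  by (simp add: flat_def flat1_def)

lemma flat1_mult: "smooth_on D F \<Longrightarrow> smooth_on D H \<Longrightarrow> flat1 F \<Longrightarrow> flat1 H \<Longrightarrow> flat1 (\<lambda>q. F q * H q)"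
  using p by (simp add: flat1_def dd2_mult deriv_rules)

lemma flat_mult: "smooth_on D F \<Longrightarrow> smooth_on D H \<Longrightarrow> flat F \<Longrightarrow> flat H \<Longrightarrow> flat (\<lambda>q. F q * H q)"
  using p unfolding flat_def by (auto simp: flat1_mult) (simp add: flat1_def dd3_mult)

lemma dd_cong_const:
  assumes "\<And>q. q \<in> D \<Longrightarrow> F q = c"
  shows "dir_deriv e F p = 0" "dir_deriv e (dir_deriv e' F) p = 0"
    "dir_deriv e (dir_deriv e' (dir_deriv e'' F)) p = 0"
proof -
  have 1: "dir_deriv e F q = 0" if "q \<in> D" for q e
    using dd_cong[OF that assms, where e = e] by simp
  have 2: "dir_deriv e (dir_deriv e' F) q = 0" if "q \<in> D" for q e e'
    using dd_cong[OF that 1, where e = e] by simp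
  have 3: "dir_deriv e (dir_deriv e' (dir_deriv e'' F)) q = 0" if "q \<in> D" for q e e' e''
    using dd_cong[OF that 2, where e = e] by simp
  show "dir_deriv e F p = 0" "dir_deriv e (dir_deriv e' F) p = 0"
    "dir_deriv e (dir_deriv e' (dir_deriv e'' F)) p = 0" using 1 2 3 p by auto
qed

text \<open>Differentiate the constant product of \<open>F\<close> with its inverse. At each order
  only \<open>F\<close> times the derivative of the inverse is left, and \<open>F p\<close> is
  nonzero.\<close>

lemma flat_inverse:
  assumes F: "smooth_on D F" "flat F" "\<And>q. q \<in> D \<Longrightarrow> F q \<noteq> 0"
  shows "flat (\<lambda>q. inverse (F q))"
proof -
  let ?I = "\<lambda>q. inverse (F q)"
  have I: "smooth_on D ?I" using F by (intro smooth_rules)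
  have one: "F q * ?I q = 1" if "q \<in> D" for q using F(3)[OF that] by simp
  have nz: "F p \<noteq> 0" using F(3) p .
  have f: "vd N F p = 0" "\<And>B. B \<in> T \<Longrightarrow> vd N (vd B F) p = 0"
    "\<And>B B'. B \<in> T \<Longrightarrow> B' \<in> T \<Longrightarrow> vd N (vd B (vd B' F)) p = 0"
    using F(2) by (auto simp: flat_def flat1_def)
  have 1: "vd N ?I p = 0"
    using dd_cong_const(1)[of "\<lambda>q. F q * ?I q", OF one, of "(0, N)"] nz f dir_deriv_mult[OF diff[OF p F(1)] diff[OF p I], of "(0, N)"] by simp
  have 2: "vd N (vd B ?I) p = 0" if "B \<in> T" for B
    using dd_cong_const(2)[of "\<lambda>q. F q * ?I q", OF one, of "(0, N)" "(0, B)"] nz f that 1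
      dd2_mult[OF p F(1) I, of "(0, N)" "(0, B)"] by simp
  have 3: "vd N (vd B (vd B' ?I)) p = 0" if "B \<in> T" "B' \<in> T" for B B'
    using dd_cong_const(3)[of "\<lambda>q. F q * ?I q", OF one, of "(0, N)" "(0, B)" "(0, B')"] nz f that 1 2
      dd3_mult[OF p F(1) I, of "(0, N)" "(0, B)" "(0, B')"] by simp
  show ?thesis using 1 2 3 by (simp add: flat_def flat1_def)
qed

lemma flat_cong: "flat F \<Longrightarrow> (\<And>q. q \<in> D \<Longrightarrow> F q = H q) \<Longrightarrow> flat H"
proof -
  assume F: "flat F" and eq: "\<And>q. q \<in> D \<Longrightarrow> F q = H q"
  have 1: "dir_deriv e H q = dir_deriv e F q" if "q \<in> D" for q e
    by (rule dd_cong[OF that]) (simp add: eq)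
  have 2: "dir_deriv e (dir_deriv e' H) q = dir_deriv e (dir_deriv e' F) q" if "q \<in> D" for q e e'
    by (rule dd_cong[OF that]) (simp add: 1)
  have 3: "dir_deriv e (dir_deriv e' (dir_deriv e'' H)) q = dir_deriv e (dir_deriv e' (dir_deriv e'' F)) q" if "q \<in> D" for q e e' e''
    by (rule dd_cong[OF that]) (simp add: 2)
  show ?thesis using F 1 2 3 p by (simp add: flat_def flat1_def)
qed

text \<open>The first order is tangency of the supporting element combined with Euler's relation,
  the second is the definition of \<open>T\<close>, and the third is
  \<open>C_normal\<close>.\<close>

lemma flat_En: "flat En"
proof -
  have "vd N En p = 0"
    using homogD[OF homog_En1 p, of N] dd_commute[OF p smooth_En, of "(0, N)" "(0, snd p)"] supporting_tangent by simp
  thus ?thesis using C_normal by (auto simp: flat_def flat1_def T_def)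
qed

lemma flat_Lf: "flat Lf"
proof -
  note nz = Lf_nonzero[OF p]
  have En: "En q * 2 = Lf q * Lf q" for q by (simp add: En_def)
  have f: "vd N (\<lambda>q. Lf q * Lf q) p = 0" "\<And>B. B \<in> T \<Longrightarrow> vd N (vd B (\<lambda>q. Lf q * Lf q)) p = 0"
    "\<And>B B'. B \<in> T \<Longrightarrow> B' \<in> T \<Longrightarrow> vd N (vd B (vd B' (\<lambda>q. Lf q * Lf q))) p = 0"
    using flat_mult[OF smooth_En smooth_on_const flat_En flat_const, of 2] by (auto simp: flat_def flat1_def En)
  have 1: "vd N Lf p = 0"
    using f(1) nz dir_deriv_mult[OF diff[OF p smooth_Lf] diff[OF p smooth_Lf], of "(0, N)"] by simp
  have 2: "vd N (vd B Lf) p = 0" if "B \<in> T" for B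
    using f(2)[OF that] nz 1 dd2_mult[OF p smooth_Lf smooth_Lf, of "(0, N)" "(0, B)"] by simp
  have 3: "vd N (vd B (vd B' Lf)) p = 0" if "B \<in> T" "B' \<in> T" for B B'
    using f(3)[OF that] nz 1 2 that dd3_mult[OF p smooth_Lf smooth_Lf, of "(0, N)" "(0, B)" "(0, B')"] by simp
  show ?thesis using 1 2 3 by (simp add: flat_def flat1_def)
qed

lemma Lf_N:
  shows "vd N Lf p = 0" "B \<in> T \<Longrightarrow> vd N (vd B Lf) p = 0"
  using flat_Lf by (auto simp: flat_def flat1_def)

lemma En_N: "vd N (vd U En) p = Lf p * vd N (vd U Lf) p"
  by (simp add: dir_deriv2_En p Lf_N)

text \<open>\<open>\<rho>\<close> is not assumed differentiable, so it is eliminated from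
  \<open>\<beta>\<^sub>u\<^sub>v = \<rho> L\<^sub>u\<^sub>v\<close> by cross-multiplication before differentiating.\<close>

lemma dd_Be_NB:
  assumes B: "B \<in> T"
  shows "dir_deriv e (vd N (vd B Be)) p = rho p * dir_deriv e (vd N (vd B Lf)) p"
proof -
  have "dir_deriv e (\<lambda>q. vd N (vd B Be) q * vd N (vd N Lf) q) p
      = dir_deriv e (\<lambda>q. vd N (vd N Be) q * vd N (vd B Lf) q) p"
    by (rule dd_cong[OF p]) (simp add: vd_vd_Be)
  hence "dir_deriv e (vd N (vd B Be)) p * vd N (vd N Lf) p = rho p * vd N (vd N Lf) p * dir_deriv e (vd N (vd B Lf)) p"
    using p B by (simp add: k_rules vd_vd_Be Lf_N)
  moreover have "vd N (vd N Lf) p \<noteq> 0" using En_N[of N] N_unit by auto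
  ultimately show ?thesis by simp
qed

text \<open>The third-order condition reduces to that of \<open>Lf\<close> by
  \<open>dd_Be_NB\<close>, once the normal derivative has been moved inside.\<close>

lemma flat_Be: "flat Be"
proof -
  have 2: "vd N (vd B Be) p = 0" if "B \<in> T" for B
    using that by (simp add: vd_vd_Be p Lf_N)
  have 3: "vd N (vd B (vd B' Be)) p = 0" if "B \<in> T" "B' \<in> T" for B B'
  proof -
    have "vd N (vd B (vd B' Be)) p = rho p * vd B (vd N (vd B' Lf)) p"
      using dd_commute[OF p smooth_rules(6)[OF smooth_Be], of "(0, N)" "(0, B)" "(0, B')"] dd_Be_NB[OF that(2)] by simp
    also have "vd B (vd N (vd B' Lf)) p = vd N (vd B (vd B' Lf)) p"
      by (rule dd_commute[OF p smooth_rules(6)[OF smooth_Lf]])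
    finally show ?thesis using flat_Lf that by (simp add: flat_def)
  qed
  show ?thesis using b_tangential 2 3 by (simp add: flat_def flat1_def)
qed

lemma flat_Be_inverse: "flat (\<lambda>q. inverse (Be q))"
  by (rule flat_inverse[OF smooth_Be flat_Be Be_nonzero])

lemma flat_tau: "flat \<tau>"
proof -
  have "vd u (vd v \<tau>) q = 0" if "q \<in> D" for q u v
    using dd_cong[OF that vd_tau, where e = "(0, u)"] by simp
  moreover from this have "vd w (vd u (vd v \<tau>)) p = 0" for u v w
    using dd_cong[OF p, of "vd u (vd v \<tau>)" "\<lambda>q. 0" "(0, w)"] by simp
  ultimately show ?thesis using p by (simp add: flat_def flat1_def vd_tau)
qed

lemma flat_cL: "flat cL" and flat_cB: "flat cB" and flat_eta: "flat \<eta>"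
proof -
  show "flat cL" unfolding cL_def[abs_def]
    by (intro flat_mult flat_const flat_Lf flat_Be_inverse smooth_rules smooth_Be_inverse smooth_Lf)
  show cB: "flat cB" unfolding cB_def[abs_def]
    by (intro flat_mult flat_const flat_Lf flat_Be_inverse smooth_rules smooth_Be_inverse smooth_Lf)
  show "flat \<eta>" unfolding \<eta>_def[abs_def]
    by (intro flat_mult flat_const cB flat_tau k_smooth)
qed

lemma flat_KEn: "flat K.En"
proof (rule flat_cong)
  show "flat (\<lambda>q. 1/2 * (Lf q * Lf q * (Lf q * Lf q) * (inverse (Be q) * inverse (Be q))))"
    by (intro flat_mult flat_const flat_Lf flat_Be_inverse smooth_rules smooth_Be_inverse smooth_Lf)
  fix q assume "q \<in> D"
  hence "K.Lf q = Lf q * Lf q * inverse (Be q)"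
    using KLf[of q] Be_nonzero[of q] by (simp add: field_simps)
  thus "1/2 * (Lf q * Lf q * (Lf q * Lf q) * (inverse (Be q) * inverse (Be q))) = K.En q"
    by (simp add: K.En_def)
qed

section \<open>The normal direction of the starred metric\<close>

text \<open>The factor by which the Kropina change scales metric products with \<open>N\<close>;
  dividing by \<open>Lf p\<close> passes from the Hessian of \<open>Lf\<close> to that of the
  energy.\<close>

definition \<kappa> :: real where
  "\<kappa> = (cL p - cB p * rho p) / Lf p"

lemma kappa_En: "\<kappa> * (Lf p * c) = (cL p - cB p * rho p) * c"
  using Lf_nonzero[OF p] by (simp add: \<kappa>_def)

text \<open>The coefficients \<open>cL\<close> and \<open>cB\<close> have no normal derivative, so
  only second derivatives of \<open>Lf\<close> and \<open>Be\<close> occur, and those of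
  \<open>Be\<close> are \<open>rho p\<close> times those of \<open>Lf\<close>.\<close>

lemma KEn_N: "vd N (vd U K.En) p = \<kappa> * vd N (vd U En) p"
proof -
  have "vd N (vd U K.En) p = vd N (\<lambda>q. cL q * vd U Lf q - cB q * vd U Be q) p"
    by (rule dd_cong[OF p dir_deriv_KEn])
  also have "\<dots> = cL p * vd N (vd U Lf) p - cB p * (rho p * vd N (vd U Lf) p)"
    using p flat_cL flat_cB by (simp add: k_rules vd_vd_Be flat_def flat1_def)
  finally have "vd N (vd U K.En) p = (cL p - cB p * rho p) * vd N (vd U Lf) p"
    by (simp add: algebra_simps)
  thus ?thesis by (simp add: En_N kappa_En)
qed

lemma K_nondegenerate:
  assumes "\<And>u. vd u (vd z K.En) p = 0"
  shows "z = 0"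
  unfolding vec_eq_iff
proof
  fix i show "z $ i = 0 $ i"
    using K.nondegenerate[OF p, of "\<lambda>i. z $ i" i] assms vd_vd_exp[OF p K.smooth_En, of _ z]
    by (simp add: mult.commute)
qed

text \<open>Otherwise \<open>N\<close> would lie in the kernel of the nondegenerate starred metric,
  contradicting \<open>N_unit\<close>.\<close>

lemma kappa_nonzero: "\<kappa> \<noteq> 0"
proof
  assume "\<kappa> = 0"
  hence "vd u (vd N K.En) p = 0" for u
    using KEn_N[of u] dd_commute[OF p K.smooth_En, of "(0, u)" "(0, N)"] by simp
  hence "N = 0" by (rule K_nondegenerate)
  thus False using N_unit vd_zero[OF p, of "vd 0 En"] by (simp add: smooths)
qed

lemma K_normal:
  assumes z: "\<And>B. B \<in> T \<Longrightarrow> vd B (vd z K.En) p = 0"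
  obtains c where "z = c *\<^sub>R N"
proof -
  define c where "c = vd N (vd z K.En) p / \<kappa>"
  have NN: "vd N (vd N K.En) p = \<kappa>" using KEn_N[of N] N_unit by simp
  have "vd u (vd (z - c *\<^sub>R N) K.En) p = 0" for u
  proof -
    have lin: "vd u (vd (z - c *\<^sub>R N) K.En) p = vd u (vd z K.En) p - c * vd u (vd N K.En) p" for u
    proof -
      have "vd u (vd (z - c *\<^sub>R N) K.En) p = vd u (\<lambda>q. vd z K.En q - c * vd N K.En q) p"
        by (rule dd_cong[OF p]) (rule vd_decompose(2)[OF _ K.smooth_En])
      thus ?thesis using p by (simp add: k_rules)
    qed
    let ?a = "vd N (vd u En) p" and ?z = "vd (z - c *\<^sub>R N) K.En"
    \<comment> \<open>The part of \<open>u\<close> orthogonal to \<open>N\<close>, so that testing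
      against \<open>T\<close> and against \<open>N\<close> suffices.\<close>
    define B where "B = u - ?a *\<^sub>R N"
    have "vd N (vd B En) p = vd N (\<lambda>q. vd u En q - ?a * vd N En q) p"
      unfolding B_def by (rule dd_cong[OF p]) (rule vd_decompose(2)[OF _ smooth_En])
    hence B: "B \<in> T" using p N_unit by (simp add: k_rules T_def)
    have "vd N (vd B K.En) p = 0" using B by (simp add: KEn_N T_def)
    hence "vd B (vd N K.En) p = 0" using dd_commute[OF p K.smooth_En, of "(0, B)" "(0, N)"] by simp
    hence "vd B ?z p = 0" using z[OF B] lin[of B] by simp
    moreover have "vd N ?z p = 0" using lin[of N] NN kappa_nonzero by (simp add: c_def)
    moreover have "vd u ?z p = vd (B + ?a *\<^sub>R N) ?z p" by (simp add: B_def)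
    ultimately show ?thesis using vd_decompose(1)[OF p, of ?z B ?a N] by (simp add: k_smooth)
  qed
  hence "z - c *\<^sub>R N = 0" by (rule K_nondegenerate)
  thus thesis using that[of c] by simp
qed

lemma T_iff: "B \<in> T \<longleftrightarrow> vd N (vd B K.En) p = 0"
  by (simp add: T_def KEn_N kappa_nonzero)

lemma flatD:
  assumes "flat F"
  shows "vd N F p = 0" "B \<in> T \<Longrightarrow> vd N (vd B F) p = 0" "B \<in> T \<Longrightarrow> B' \<in> T \<Longrightarrow> vd N (vd B (vd B' F)) p = 0"
  using assms by (auto simp: flat_def flat1_def)

lemma flatD_sym:
  assumes "flat F" "smooth_on D F"
  shows "B \<in> T \<Longrightarrow> vd B (vd N F) p = 0"
    and "B \<in> T \<Longrightarrow> B' \<in> T \<Longrightarrow> vd B (vd N (vd B' F)) p = 0"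
    and "B \<in> T \<Longrightarrow> B' \<in> T \<Longrightarrow> vd B (vd B' (vd N F)) p = 0"
proof -
  show "vd B (vd N F) p = 0" if "B \<in> T" for B
    using flatD(2)[OF assms(1) that] dd_commute[OF p assms(2), of "(0, B)" "(0, N)"] by simp
  show 2: "vd B (vd N (vd B' F)) p = 0" if "B \<in> T" "B' \<in> T" for B B'
    using flatD(3)[OF assms(1) that] dd_commute[OF p smooth_rules(6)[OF assms(2)], of "(0, B)" "(0, N)" "(0, B')"] by simp
  show "vd B (vd B' (vd N F)) p = 0" if "B \<in> T" "B' \<in> T" for B B'
    using 2[OF that] dd_commute3[OF p assms(2), of "(0, B)" "(0, B')" "(0, N)"] by simp
qed

section \<open>Tangency of the spray difference and its derivatives\<close>

definition Dw :: "real^'n \<Rightarrow> real^'n" where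
  "Dw w = (\<chi> i. vd w (Df i) p)"

text \<open>\<open>spray_difference\<close> along \<open>N\<close>: its right-hand side contains the
  normal derivative of \<eta>, which vanishes.\<close>

lemma D_tangent: "(\<chi> i. Df i p) \<in> T"
  using spray_difference[OF p, of N] vd_vd_exp[OF p K.smooth_En, of N "\<chi> i. Df i p"] flatD(1)[OF flat_eta]
  by (simp add: T_iff mult.commute)

text \<open>In \<open>spray_difference_derivative\<close> with \<open>w\<close> tangent and
  \<open>u\<close> normal, flatness of \<eta> kills the right-hand side, and flatness of the starred
  energy kills the third-derivative term because the spray difference is tangent.\<close>

lemma Dw_tangent:
  assumes "B \<in> T"
  shows "Dw B \<in> T"
  unfolding T_iff[of "Dw B"] unfolding Dw_def
  using spray_difference_derivative[OF p, of B N] flatD(1)[OF flat_eta] assms D_tangent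
    flatD_sym[OF flat_eta smooth_eta] flatD_sym[OF flat_KEn K.smooth_En]
  by simp

text \<open>The same identity with \<open>w\<close> normal and \<open>u\<close> tangent shows
  orthogonality to \<open>T\<close> under the starred metric; \<open>K_normal\<close> then
  applies.\<close>

lemma Dw_normal:
  obtains c where "Dw N = c *\<^sub>R N"
proof (rule K_normal)
  fix B assume "B \<in> T"
  thus "vd B (vd (Dw N) K.En) p = 0"
    using spray_difference_derivative[OF p, of N B] flatD[OF flat_eta] flatD[OF flat_En] D_tangent
      flatD[OF flat_KEn] by (simp add: Dw_def)
qed

lemma K_hderiv: "smooth_on D F \<Longrightarrow> K.hderiv w F p = hderiv w F p - vd (Dw w) F p"
  by (simp add: K_hderiv_eq[OF p] Dw_def)

section \<open>Normal components of the starred connection\<close>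

text \<open>Compare \<open>hderiv_second_derivative\<close> for \<open>Be\<close> and for
  \<open>Lf\<close>. The left-hand sides are related by \<open>dd_Be_NB\<close>, because
  \<open>hderiv\<close> is a first-order operator; the Hessian terms by \<open>vd_vd_Be\<close>; and
  the \<tau> term vanishes by flatness. What is left is the relation between the third-derivative
  terms.\<close>

lemma Berwald_curvature_Be:
  assumes B: "B \<in> T" "B' \<in> T"
  shows "(\<Sum>h\<in>UNIV. vd N (vd B' (vd B (G h))) p * vd (ax h) Be p)
    = rho p * (\<Sum>h\<in>UNIV. vd N (vd B' (vd B (G h))) p * vd (ax h) Lf p)"
proof -
  have "flat1 (\<lambda>q. \<tau> q * vd B En q)"
    using flat_tau flatD[OF flat_En] B
    by (intro flat1_mult k_smooth) (auto simp: flat_def flat1_def intro: dd_commute3[OF p smooth_En, THEN trans])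
  hence tau: "vd N (vd B' (\<lambda>q. \<tau> q * vd B En q)) p = 0" using B by (simp add: flat1_def)
  have "hderiv B (vd N (vd B' Be)) p = rho p * hderiv B (vd N (vd B' Lf)) p"
    by (simp add: hderiv_def dd_Be_NB[OF B(2)] right_diff_distrib sum_distrib_left mult.left_commute)
  moreover have "hderiv B (vd N (vd B' Be)) p = (\<Sum>h\<in>UNIV. vd N (vd B' (vd B (G h))) p * vd (ax h) Be p
       + vd N (vd B (G h)) p * vd B' (vd (ax h) Be) p
       + vd B' (vd B (G h)) p * vd N (vd (ax h) Be) p) + vd N (vd B' (\<lambda>q. \<tau> q * vd B En q)) p"
    by (rule hderiv_second_derivative[OF p smooth_Be _ xd_Be_tau]) (intro k_smooth)
  moreover have "hderiv B (vd N (vd B' Lf)) p = (\<Sum>h\<in>UNIV. vd N (vd B' (vd B (G h))) p * vd (ax h) Lf p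
       + vd N (vd B (G h)) p * vd B' (vd (ax h) Lf) p
       + vd B' (vd B (G h)) p * vd N (vd (ax h) Lf) p) + vd N (vd B' (\<lambda>q. 0)) p"
    by (rule hderiv_second_derivative[OF p smooth_Lf]) (auto simp: horizontal_Lf smooth_on_const)
  ultimately show ?thesis
    by (simp add: tau vd_vd_Be p sum.distrib sum_distrib_left algebra_simps)
qed

lemma eta_terms_vanish:
  assumes B: "B \<in> T" "B' \<in> T"
  shows "vd N (vd B (\<lambda>q. \<eta> q * vd B' En q)) p = 0"
    and "vd B (vd B' (\<lambda>q. \<eta> q * vd N En q)) p = 0"
proof -
  show "vd N (vd B (\<lambda>q. \<eta> q * vd B' En q)) p = 0"
    using B flatD[OF flat_eta] flatD[OF flat_En] p by (simp add: dd2_mult k_smooth)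
  show "vd B (vd B' (\<lambda>q. \<eta> q * vd N En q)) p = 0"
    using B flatD[OF flat_En] flatD_sym[OF flat_En smooth_En] p by (simp add: dd2_mult k_smooth)
qed

lemma K_F_conn_normal:
  assumes B: "B \<in> T" "B' \<in> T"
  shows "(\<Sum>i\<in>UNIV. vd N (vd (ax i) K.En) p * K.Fv B B' p i)
    = \<kappa> * (\<Sum>i\<in>UNIV. vd N (vd (ax i) En) p * Fv B B' p i)"
proof -
  obtain c where c: "Dw N = c *\<^sub>R N" by (rule Dw_normal)
  have "vd (Dw N) (vd B (vd B' K.En)) p = c * vd N (vd B (vd B' K.En)) p"
    using dir_deriv_lin(2)[OF diff[OF p], of "vd B (vd B' K.En)" c "(0, N)"] by (simp add: c k_smooth)
  hence "vd (Dw N) (vd B (vd B' K.En)) p = 0" using flatD[OF flat_KEn] B by simp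
  moreover have "vd (Dw B') (vd N (vd B K.En)) p = 0" "vd (Dw B) (vd N (vd B' K.En)) p = 0"
    using flatD_sym(2)[OF flat_KEn K.smooth_En] Dw_tangent B by auto
  \<comment> \<open>Replacing \<open>K.hderiv\<close> by \<open>hderiv\<close> costs derivatives
    along \<open>Dw\<close>. All three vanish: \<open>Dw\<close> preserves \<open>T\<close> and maps
    \<open>N\<close> to a multiple of itself, and the starred energy is flat.\<close>
  ultimately have "2 * (\<Sum>i\<in>UNIV. vd N (vd (ax i) K.En) p * K.Fv B B' p i)
     = hderiv B' (vd N (vd B K.En)) p + hderiv B (vd N (vd B' K.En)) p - hderiv N (vd B (vd B' K.En)) p"
    by (simp add: K.F_conn_lower[OF p] K_hderiv k_smooth)
  \<comment> \<open>The starred energy is expanded with the unstarred spray; the \<eta> terms vanish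
    on these directions.\<close>
  also have "\<dots> = (\<Sum>h\<in>UNIV. vd N (vd B (vd B' (G h))) p * vd (ax h) K.En p
       + 2 * (vd B (vd B' (G h)) p * vd N (vd (ax h) K.En) p))"
    by (subst hderiv_Christoffel_sum[OF p K.smooth_En _ horizontal_KEn])
      (simp_all add: k_smooth eta_terms_vanish B)
  also have "\<dots> = \<kappa> * (\<Sum>h\<in>UNIV. vd N (vd B (vd B' (G h))) p * vd (ax h) En p
       + 2 * (vd B (vd B' (G h)) p * vd N (vd (ax h) En) p))"
  proof -
    \<comment> \<open>Split the derivative of the starred energy into its \<open>Lf\<close> and
      \<open>Be\<close> parts; \<open>Berwald_curvature_Be\<close> merges them into the factor
      \<kappa>.\<close>
    have "(\<Sum>h\<in>UNIV. vd N (vd B (vd B' (G h))) p * vd (ax h) K.En p)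
        = cL p * (\<Sum>h\<in>UNIV. vd N (vd B (vd B' (G h))) p * vd (ax h) Lf p)
        - cB p * (\<Sum>h\<in>UNIV. vd N (vd B (vd B' (G h))) p * vd (ax h) Be p)"
      by (simp add: dir_deriv_KEn p right_diff_distrib sum_subtractf sum_distrib_left mult.left_commute)
    also have "\<dots> = \<kappa> * (Lf p * (\<Sum>h\<in>UNIV. vd N (vd B (vd B' (G h))) p * vd (ax h) Lf p))"
      unfolding kappa_En Berwald_curvature_Be[OF B(2,1)] by (simp add: algebra_simps)
    finally show ?thesis
      by (simp add: sum.distrib KEn_N dir_deriv_En p sum_distrib_left algebra_simps)
  qed
  also have "\<dots> = 2 * (\<kappa> * (\<Sum>i\<in>UNIV. vd N (vd (ax i) En) p * Fv B B' p i))"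
    using F_conn_lower_Berwald[OF p, of N B B'] by simp
  finally show ?thesis by simp
qed

text \<open>The fibre derivative of the spray difference along a tangent vector is tangent, hence
  invisible to the normal covector.\<close>

lemma K_G_normal:
  assumes "B \<in> T"
  shows "(\<Sum>i\<in>UNIV. vd N (vd (ax i) K.En) p * vd B (K.G i) p)
    = \<kappa> * (\<Sum>i\<in>UNIV. vd N (vd (ax i) En) p * vd B (G i) p)"
proof -
  have "vd B (K.G h) p = vd B (G h) p + vd B (Df h) p" for h
    unfolding Df_def[abs_def] using p by (simp add: k_rules)
  moreover have "(\<Sum>i\<in>UNIV. vd N (vd (ax i) K.En) p * vd B (Df i) p) = 0"
    using Dw_tangent[OF assms] vd_vd_exp[OF p K.smooth_En, of N "Dw B"] by (simp add: T_iff Dw_def mult.commute)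
  ultimately show ?thesis
    by (simp add: distrib_left sum.distrib KEn_N sum_distrib_left mult.assoc)
qed

end

section \<open>Hypersurfaces\<close>

text \<open>The column space lies in the hyperplane and has the same dimension. This makes every
  vector orthogonal to the normal a combination of the coordinate tangent vectors.\<close>

lemma hyperplane_eq_range:
  fixes A :: "real^'m^'n" and \<nu> :: "real^'n"
  assumes "CARD('n) = CARD('m) + 1" "rank A = CARD('m)" "\<nu> \<noteq> 0" "\<And>c. \<nu> \<bullet> (A *v c) = 0"
    and w: "\<nu> \<bullet> w = 0"
  obtains c where "w = A *v c"
proof -
  let ?R = "range (\<lambda>c. A *v c)" and ?H = "{x. \<nu> \<bullet> x = 0}"
  have "?R = ?H"
  proof (rule subspace_dim_equal)
    show "subspace ?R" by (simp add: linear_subspace_image matrix_vector_mul_linear)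
    show "subspace ?H" by (rule subspace_hyperplane)
    show "?R \<subseteq> ?H" using assms(4) by auto
    have "dim ?H = CARD('m)" using dim_hyperplane[OF assms(3)] assms(1) by simp
    thus "dim ?H \<le> dim ?R" using assms(2) by (simp add: rank_dim_range)
  qed
  thus thesis using w that by blast
qed

definition tangent_basis :: "(real^'m::finite \<Rightarrow> real^'n::finite) \<Rightarrow> real^'m \<Rightarrow> 'm \<Rightarrow> real^'n" where
  "tangent_basis X u \<alpha> = (\<chi> i. B1 X i \<alpha> u)"

lemma tangent_basis_nth [simp]: "tangent_basis X u \<alpha> $ i = B1 X i \<alpha> u"
  by (simp add: tangent_basis_def)

lemma tangent_lift_eq: "tangent_lift X u v = (\<Sum>\<alpha>\<in>UNIV. v $ \<alpha> *\<^sub>R tangent_basis X u \<alpha>)"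
  by (simp add: vec_eq_iff tangent_lift_def tangent_basis_def B1_def mult.commute)

context open_domain
begin

lemma vd_sum_direction:
  assumes "p \<in> D" "smooth_on D F"
  shows "vd (\<Sum>\<alpha>\<in>I. c \<alpha> *\<^sub>R w \<alpha>) F p = (\<Sum>\<alpha>\<in>I. c \<alpha> * vd (w \<alpha>) F p)"
proof -
  have "vd (c \<alpha> *\<^sub>R w \<alpha>) F p = c \<alpha> * vd (w \<alpha>) F p" for \<alpha>
    using dir_deriv_lin(2)[OF diff[OF assms], of "c \<alpha>" "(0, w \<alpha>)"] by simp
  moreover have "(0 :: real^'n, \<Sum>\<alpha>\<in>I. c \<alpha> *\<^sub>R w \<alpha>) = (\<Sum>\<alpha>\<in>I. (0, c \<alpha> *\<^sub>R w \<alpha>))" by (simp add: sum_prod)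
  ultimately show ?thesis using dir_deriv_lin(3)[OF diff[OF assms], of "\<lambda>\<alpha>. (0, c \<alpha> *\<^sub>R w \<alpha>)" I] by simp
qed

lemma vd_vd_sum_direction:
  assumes "p \<in> D" "smooth_on D F"
  shows "dir_deriv e (vd (\<Sum>\<alpha>\<in>I. c \<alpha> *\<^sub>R w \<alpha>) F) p = (\<Sum>\<alpha>\<in>I. c \<alpha> * dir_deriv e (vd (w \<alpha>) F) p)"
proof -
  have "dir_deriv e (vd (\<Sum>\<alpha>\<in>I. c \<alpha> *\<^sub>R w \<alpha>) F) p = dir_deriv e (\<lambda>q. \<Sum>\<alpha>\<in>I. c \<alpha> * vd (w \<alpha>) F q) p"
    by (rule dd_cong[OF assms(1)]) (rule vd_sum_direction[OF _ assms(2)])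
  thus ?thesis using assms by (simp add: deriv_rules)
qed

lemma vd_vd_vd_sum_direction:
  assumes "p \<in> D" "smooth_on D F"
  shows "dir_deriv e (vd v (vd (\<Sum>\<alpha>\<in>I. c \<alpha> *\<^sub>R w \<alpha>) F)) p = (\<Sum>\<alpha>\<in>I. c \<alpha> * dir_deriv e (vd v (vd (w \<alpha>) F)) p)"
proof -
  have "dir_deriv e (vd v (vd (\<Sum>\<alpha>\<in>I. c \<alpha> *\<^sub>R w \<alpha>) F)) p = dir_deriv e (\<lambda>q. \<Sum>\<alpha>\<in>I. c \<alpha> * vd v (vd (w \<alpha>) F) q) p"
    by (rule dd_cong[OF assms(1)]) (rule vd_vd_sum_direction[OF _ assms(2)])
  thus ?thesis using assms by (simp add: deriv_rules)
qed

lemma vd_vd_vd_exp_all: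
  assumes "p \<in> D" "smooth_on D F"
  shows "vd w (vd u (vd v F)) p =
    (\<Sum>i\<in>UNIV. \<Sum>j\<in>UNIV. \<Sum>k\<in>UNIV. vd (ax k) (vd (ax i) (vd (ax j) F)) p * u $ i * v $ j * w $ k)"
proof -
  have "vd w (vd u (vd v F)) p = (\<Sum>k\<in>UNIV. \<Sum>i\<in>UNIV. \<Sum>j\<in>UNIV.
      w $ k * (u $ i * (v $ j * vd (ax k) (vd (ax i) (vd (ax j) F)) p)))"
    using assms
    by (subst vd_exp, simp_all add: smooth_rules vd_vd_exp[of p "vd v F" "ax k" u for k]
        vd_vd_vd_exp[of p F "ax k" "ax i" v for k i] sum_distrib_left)
  also have "\<dots> = (\<Sum>i\<in>UNIV. \<Sum>j\<in>UNIV. \<Sum>k\<in>UNIV.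
      w $ k * (u $ i * (v $ j * vd (ax k) (vd (ax i) (vd (ax j) F)) p)))"
    by (subst sum.swap, rule sum.cong[OF refl], rule sum.swap)
  finally show ?thesis by (simp add: ac_simps)
qed

end

section \<open>The fundamental tensors in terms of the energy and the spray\<close>

context finsler_chart
begin

lemma N_low_eq:
  assumes "(X u, tangent_lift X u v) \<in> D"
  shows "N_low L X N i u v = vd (N u v) (vd (ax i) En) (X u, tangent_lift X u v)"
  using assms vd_vd_exp[OF assms smooth_En, of "ax i" "N u v"]
    dd_commute[OF assms smooth_En, of "(0, ax i)" "(0, N u v)"]
  by (simp add: N_low_def along_def g_low_eq mult.commute)

lemma is_unit_normal_iff:
  assumes "(X u, tangent_lift X u v) \<in> D"
  shows "is_unit_normal L X N u v \<longleftrightarrow>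
    (\<forall>\<alpha>. vd (N u v) (vd (tangent_basis X u \<alpha>) En) (X u, tangent_lift X u v) = 0) \<and>
    vd (N u v) (vd (N u v) En) (X u, tangent_lift X u v) = 1"
proof -
  have "(\<Sum>i\<in>UNIV. \<Sum>j\<in>UNIV. along X (g_low L i j) u v * w $ i * N u v $ j)
      = vd (N u v) (vd w En) (X u, tangent_lift X u v)" for w
  proof -
    have "(\<Sum>i\<in>UNIV. \<Sum>j\<in>UNIV. along X (g_low L i j) u v * w $ i * N u v $ j)
        = (\<Sum>i\<in>UNIV. w $ i * N_low L X N i u v)"
      by (simp add: N_low_def sum_distrib_left ac_simps)
    thus ?thesis using assms vd_vd_exp[OF assms smooth_En, of "N u v" w] by (simp add: N_low_eq)
  qed
  from this[of "tangent_basis X u _"] this[of "N u v"] show ?thesis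
    by (simp add: is_unit_normal_def)
qed

lemma M_tensor_eq:
  assumes "(X u, tangent_lift X u v) \<in> D"
  shows "M_tensor L X N \<alpha> \<beta> u v = 1/2 * vd (N u v) (vd (tangent_basis X u \<alpha>)
    (vd (tangent_basis X u \<beta>) En)) (X u, tangent_lift X u v)"
  using assms
  by (simp add: M_tensor_def along_def C_low_eq vd_vd_vd_exp_all[of _ _ "N u v" "tangent_basis X u \<alpha>" "tangent_basis X u \<beta>"] smooth_En sum_divide_distrib)

lemma M_vec_eq:
  assumes "(X u, tangent_lift X u v) \<in> D"
  shows "M_vec L X N \<alpha> u v = 1/2 * vd (N u v) (vd (tangent_basis X u \<alpha>)
    (vd (N u v) En)) (X u, tangent_lift X u v)"
  using assms
  by (simp add: M_vec_def along_def C_low_eq vd_vd_vd_exp_all[of _ _ "N u v" "tangent_basis X u \<alpha>" "N u v"] smooth_En sum_divide_distrib)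

lemma H_vec_eq:
  assumes "(X u, tangent_lift X u v) \<in> D"
  shows "H_vec L X N \<alpha> u v = (\<Sum>i\<in>UNIV. vd (N u v) (vd (ax i) En) (X u, tangent_lift X u v) *
    (B0 X i \<alpha> u v + vd (tangent_basis X u \<alpha>) (G i) (X u, tangent_lift X u v)))"
  using assms
  by (simp add: H_vec_def N_low_eq along_def nonlin_conn_eq vd_exp[of _ _ "tangent_basis X u \<alpha>"] smooth_G
      mult.commute)

lemma H_tensor_eq:
  assumes "(X u, tangent_lift X u v) \<in> D"
  shows "H_tensor L X N \<alpha> \<beta> u v = (\<Sum>i\<in>UNIV. vd (N u v) (vd (ax i) En) (X u, tangent_lift X u v) *
    (B2 X i \<alpha> \<beta> u + Fv (tangent_basis X u \<alpha>) (tangent_basis X u \<beta>) (X u, tangent_lift X u v) i))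
    + M_vec L X N \<alpha> u v * H_vec L X N \<beta> u v"
  using assms by (simp add: H_tensor_def N_low_eq along_def Fv_def)

text \<open>Contraction with \<open>v\<close> inserts the supporting element: the
  \<open>M_vec\<close> term disappears because the metric has degree 0, and
  \<open>Fv_supporting\<close> turns the connection coefficients into the nonlinear
  connection.\<close>

lemma H_vec_contraction:
  assumes "(X u, tangent_lift X u v) \<in> D"
  shows "(\<Sum>\<alpha>\<in>UNIV. v $ \<alpha> * H_tensor L X N \<alpha> \<beta> u v) = H_vec L X N \<beta> u v"
proof -
  let ?p = "(X u, tangent_lift X u v)" and ?n = "N u v" and ?B = "tangent_basis X u"
  let ?g = "\<lambda>i. vd ?n (vd (ax i) En) ?p"
  have y: "snd ?p = (\<Sum>\<alpha>\<in>UNIV. v $ \<alpha> *\<^sub>R ?B \<alpha>)" by (simp add: tangent_lift_eq)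
  have "(\<Sum>\<alpha>\<in>UNIV. v $ \<alpha> * M_vec L X N \<alpha> u v) = 1/2 * (\<Sum>\<alpha>\<in>UNIV. v $ \<alpha> * vd ?n (vd (?B \<alpha>) (vd ?n En)) ?p)"
    using assms by (simp add: M_vec_eq sum_divide_distrib)
  also have "(\<Sum>\<alpha>\<in>UNIV. v $ \<alpha> * vd ?n (vd (?B \<alpha>) (vd ?n En)) ?p) = vd ?n (vd (snd ?p) (vd ?n En)) ?p"
    unfolding y using assms by (simp add: vd_vd_sum_direction smooths)
  also have "\<dots> = vd (snd ?p) (vd ?n (vd ?n En)) ?p"
    by (rule dd_commute[OF assms]) (intro smooths)
  also have "\<dots> = 0" using homogD[OF homog_En2 assms] by simp
  finally have M: "(\<Sum>\<alpha>\<in>UNIV. v $ \<alpha> * M_vec L X N \<alpha> u v) = 0" by simp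
  have F: "(\<Sum>\<alpha>\<in>UNIV. v $ \<alpha> * Fv (?B \<alpha>) w ?p i) = vd w (G i) ?p" for w i
  proof -
    have "(\<Sum>\<alpha>\<in>UNIV. v $ \<alpha> * Fv (?B \<alpha>) w ?p i) = (\<Sum>\<alpha>\<in>UNIV. \<Sum>j\<in>UNIV. v $ \<alpha> * ?B \<alpha> $ j * (\<Sum>k\<in>UNIV. F_conn L i j k (fst ?p) (snd ?p) * w $ k))"
      by (simp add: Fv_def sum_distrib_left ac_simps)
    also have "\<dots> = (\<Sum>j\<in>UNIV. (\<Sum>\<alpha>\<in>UNIV. v $ \<alpha> * ?B \<alpha> $ j) * (\<Sum>k\<in>UNIV. F_conn L i j k (fst ?p) (snd ?p) * w $ k))"
      by (subst sum.swap) (simp only: sum_distrib_right)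
    also have "\<dots> = Fv (\<Sum>\<alpha>\<in>UNIV. v $ \<alpha> *\<^sub>R ?B \<alpha>) w ?p i"
      by (simp add: Fv_def sum_distrib_left[of "sum _ _"] ac_simps)
    finally show ?thesis using Fv_supporting[OF assms, of w i] y by simp
  qed
  have "(\<Sum>\<alpha>\<in>UNIV. v $ \<alpha> * H_tensor L X N \<alpha> \<beta> u v)
     = (\<Sum>\<alpha>\<in>UNIV. \<Sum>i\<in>UNIV. ?g i * (B2 X i \<alpha> \<beta> u * v $ \<alpha>))
     + (\<Sum>\<alpha>\<in>UNIV. \<Sum>i\<in>UNIV. ?g i * (v $ \<alpha> * Fv (?B \<alpha>) (?B \<beta>) ?p i))
     + (\<Sum>\<alpha>\<in>UNIV. v $ \<alpha> * M_vec L X N \<alpha> u v) * H_vec L X N \<beta> u v"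
    using assms
    by (simp add: H_tensor_eq distrib_left sum.distrib sum_distrib_left sum_distrib_right ac_simps)
  also have "\<dots> = (\<Sum>i\<in>UNIV. ?g i * (\<Sum>\<alpha>\<in>UNIV. B2 X i \<alpha> \<beta> u * v $ \<alpha>))
     + (\<Sum>i\<in>UNIV. ?g i * (\<Sum>\<alpha>\<in>UNIV. v $ \<alpha> * Fv (?B \<alpha>) (?B \<beta>) ?p i))"
    unfolding M sum_distrib_left by (subst (1 2) sum.swap) simp
  also have "\<dots> = H_vec L X N \<beta> u v"
    using assms unfolding F by (simp add: H_vec_eq B0_def distrib_left sum.distrib)
  finally show ?thesis .
qed

end

section \<open>Both claims at a single supporting element\<close>

lemma (in kropina_chart) kropina_hypersurface:
  fixes X :: "real^'m::finite \<Rightarrow> real^'n" and N Ns :: "real^'m \<Rightarrow> real^'m \<Rightarrow> real^'n"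
  assumes p: "(X u, tangent_lift X u v) \<in> D"
    and dim: "CARD('n) = CARD('m) + 1" "rank (\<chi> i \<alpha>. B1 X i \<alpha> u) = CARD('m)"
    and N: "is_unit_normal L X N u v" and Ns: "is_unit_normal Ls X Ns u v"
    and b: "(\<Sum>i\<in>UNIV. along X (b i) u v * N u v $ i) = 0"
    and H: "\<And>\<alpha> \<beta>. H_tensor L X N \<alpha> \<beta> u v = 0"
    and M: "\<And>\<alpha> \<beta>. M_tensor L X N \<alpha> \<beta> u v = 0"
  shows "H_tensor Ls X Ns \<alpha> \<beta> u v = 0" "M_tensor Ls X Ns \<alpha> \<beta> u v = 0"
proof -
  let ?p = "(X u, tangent_lift X u v)" and ?n = "N u v" and ?B = "tangent_basis X u"
  define A :: "real^'m^'n" where "A = (\<chi> i \<alpha>. B1 X i \<alpha> u)"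
  have A: "A *v c = (\<Sum>\<alpha>\<in>UNIV. c $ \<alpha> *\<^sub>R ?B \<alpha>)" for c
    by (simp add: vec_eq_iff A_def matrix_vector_mult_def tangent_basis_def mult.commute)
  have N0: "vd ?n (vd (?B \<alpha>) En) ?p = 0" and N1: "vd ?n (vd ?n En) ?p = 1" for \<alpha>
    using N is_unit_normal_iff[OF p] by auto
  define \<nu> where "\<nu> = (\<chi> i. vd ?n (vd (ax i) En) ?p)"
  have \<nu>: "\<nu> \<bullet> w = vd ?n (vd w En) ?p" for w
    by (simp add: \<nu>_def inner_vec_def vd_vd_exp[OF p smooth_En, of ?n w] mult.commute)
  \<comment> \<open>Conditions known for the coordinate tangent vectors thereby extend to every
    vector orthogonal to the normal.\<close>
  have tangent: "\<exists>c. B = (\<Sum>\<alpha>\<in>UNIV. c $ \<alpha> *\<^sub>R ?B \<alpha>)" if tB: "vd ?n (vd B En) ?p = 0" for B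
  proof -
    have "\<nu> \<noteq> 0" using N1 \<nu>[of ?n] by auto
    moreover have "\<nu> \<bullet> (A *v c) = 0" for c
      using p by (simp add: \<nu> A vd_vd_sum_direction smooth_En N0)
    ultimately obtain c where "B = A *v c"
      by (rule hyperplane_eq_range[OF dim[folded A_def], of \<nu> B]) (use tB \<nu>[of B] in auto)
    thus ?thesis using A by auto
  qed
  have C: "vd ?n (vd (?B \<alpha>) (vd (?B \<beta>) En)) ?p = 0" for \<alpha> \<beta>
    using M[of \<alpha> \<beta>] M_tensor_eq[OF p, of N \<alpha> \<beta>] by simp
  interpret kropina_tangent D L b \<rho> Ls ?p ?n
  proof
    show "vd ?n (vd (snd ?p) En) ?p = 0"
      using vd_vd_sum_direction[OF p smooth_En, of "(0, ?n)" "\<lambda>\<alpha>. v $ \<alpha>" ?B UNIV]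
      by (simp only: N0 tangent_lift_eq[symmetric] snd_conv mult_zero_right sum.neutral_const)
    show "vd ?n Be ?p = 0"
      using b by (simp add: vd_Be[OF p] along_def bf_def mult.commute)
    fix B B' assume "vd ?n (vd B En) ?p = 0" "vd ?n (vd B' En) ?p = 0"
    then obtain c c' where c: "B = (\<Sum>\<alpha>\<in>UNIV. c $ \<alpha> *\<^sub>R ?B \<alpha>)" "B' = (\<Sum>\<alpha>\<in>UNIV. c' $ \<alpha> *\<^sub>R ?B \<alpha>)"
      using tangent by metis
    show "vd ?n (vd B (vd B' En)) ?p = 0"
      unfolding c using p by (simp add: vd_vd_vd_sum_direction vd_vd_sum_direction smooths C)
  qed (use p N1 in auto)
  have B: "?B \<alpha> \<in> T" for \<alpha> by (simp add: T_def N0)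
  \<comment> \<open>The starred normal is orthogonal, under the starred metric, to all of
    \<open>T\<close>.\<close>
  obtain c where c: "Ns u v = c *\<^sub>R ?n"
  proof (rule K_normal)
    fix B assume "B \<in> T"
    then obtain a where a: "B = (\<Sum>\<alpha>\<in>UNIV. a $ \<alpha> *\<^sub>R ?B \<alpha>)" using tangent by (auto simp: T_def)
    have "vd (?B \<alpha>) (vd (Ns u v) K.En) ?p = 0" for \<alpha>
      using Ns K.is_unit_normal_iff[OF p, of Ns] dd_commute[OF p K.smooth_En, of "(0, ?B \<alpha>)" "(0, Ns u v)"] by auto
    thus "vd B (vd (Ns u v) K.En) ?p = 0"
      unfolding a using p by (simp add: vd_sum_direction k_smooth)
  qed
  have scale: "vd (Ns u v) F ?p = c * vd ?n F ?p" if "smooth_on D F" for F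
    using dir_deriv_lin(2)[OF diff[OF p that], of c "(0, ?n)"] by (simp add: c)
  have H0: "H_vec L X N \<beta> u v = 0" for \<beta>
    using H_vec_contraction[OF p, of N \<beta>] H by simp
  \<comment> \<open>The covector of the starred normal is \<open>c * \<kappa>\<close> times the
    unstarred one, so the coordinate term \<open>B0\<close> scales exactly like the connection
    term.\<close>
  have "H_vec Ls X Ns \<beta> u v = c * \<kappa> * H_vec L X N \<beta> u v" for \<beta>
    using K_G_normal[OF B[of \<beta>]]
    by (simp add: K.H_vec_eq[OF p] H_vec_eq[OF p] scale k_smooth distrib_left sum.distrib
        sum_distrib_left[symmetric] mult.assoc KEn_N)
  \<comment> \<open>The starred product of \<open>M_vec\<close> and \<open>H_vec\<close> drops out,
    since its second factor is a multiple of the vanishing \<open>H_vec\<close> of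
    \<open>L\<close>.\<close>
  hence "H_tensor Ls X Ns \<alpha> \<beta> u v = c * \<kappa> * (\<Sum>i\<in>UNIV. vd ?n (vd (ax i) En) ?p *
    (B2 X i \<alpha> \<beta> u + Fv (?B \<alpha>) (?B \<beta>) ?p i))"
    using K_F_conn_normal[OF B[of \<alpha>] B[of \<beta>]]
    by (simp add: K.H_tensor_eq[OF p] H0 scale k_smooth distrib_left sum.distrib
        sum_distrib_left[symmetric] mult.assoc KEn_N)
  thus "H_tensor Ls X Ns \<alpha> \<beta> u v = 0"
    using H[of \<alpha> \<beta>] by (simp add: H_tensor_eq[OF p] H0)
  show "M_tensor Ls X Ns \<alpha> \<beta> u v = 0"
    using flatD(3)[OF flat_KEn B[of \<alpha>] B[of \<beta>]] by (simp add: K.M_tensor_eq[OF p] scale k_smooth)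
qed

section \<open>From the manifold to its charts\<close>

lemma finsler_space_chart:
  fixes A :: "('p, 'n::finite) chart set"
  assumes "finsler_space M A D L" "c \<in> A"
  shows "finsler_chart (D c) (L c)"
proof
  show "open (D c)" using assms by (simp add: finsler_space_def conic_domain_def)
  show "smooth_on (D c) (\<lambda>(x, y). L c x y)" using assms by (simp add: finsler_space_def)
  fix x y t
  assume xy: "(x, y) \<in> D c"
  show "L c x y \<noteq> 0" "invertible (g_mat (L c) x y)"
    using assms xy unfolding finsler_space_def by fast+
  assume "t > (0::real)"
  thus "(x, t *\<^sub>R y) \<in> D c" "L c x (t *\<^sub>R y) = t * L c x y"
    using assms xy unfolding finsler_space_def conic_domain_def by fast+
qed

text \<open>The conditions on \<open>L\<close> and \<open>b\<close> are pointwise or local, so they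
  restrict from \<open>D c\<close> to the open subset \<open>Ds c\<close>, which serves as the
  common domain of both metrics.\<close>

lemma kropina_chartI:
  fixes A :: "('p, 'n::finite) chart set" and L :: "('p, 'n) chart \<Rightarrow> 'n tmfun"
  assumes FL: "finsler_space M A D L" and h: "h_vector A D L b"
    and sub: "\<And>c x y. c \<in> A \<Longrightarrow> (x, y) \<in> Ds c \<Longrightarrow> (x, y) \<in> D c \<and> beta (b c) x y \<noteq> 0"
    and FK: "finsler_space M A Ds (kropina L b)"
    and grad: "gradient A D L b"
    and C: "\<And>c x y i j. c \<in> A \<Longrightarrow> (x, y) \<in> D c \<Longrightarrow>
           (\<Sum>r\<in>UNIV. (\<Sum>k\<in>UNIV. h_cov (L c) (b c) r k x y * y $ k) * C_up (L c) r i j x y) = 0"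
    and c: "c \<in> A"
  obtains \<rho> where "kropina_chart (Ds c) (L c) (b c) \<rho> (kropina L b c)"
proof -
  obtain \<rho> where \<rho>: "\<forall>(x, y)\<in>D c. \<rho> c x y \<noteq> 0 \<and> (\<forall>i j. L c x y * (\<Sum>h\<in>UNIV. C_up (L c) h i j x y * b c h x y) =
              \<rho> c x y * h_low (L c) i j x y)"
    using h c by (auto simp: h_vector_def)
  interpret F: finsler_chart "D c" "L c" by (rule finsler_space_chart[OF FL c])
  interpret K: finsler_chart "Ds c" "kropina L b c" by (rule finsler_space_chart[OF FK c])
  have in_D: "(x, y) \<in> D c" if "(x, y) \<in> Ds c" for x y using sub[OF c that] by blast
  have restrict: "smooth_on (Ds c) F" if "smooth_on (D c) F" for F :: "_ \<Rightarrow> real"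
    by (rule smooth_on_subset_open[OF F.open_D K.open_D _ that]) (use in_D in auto)
  have "kropina_chart (Ds c) (L c) (b c) (\<rho> c) (kropina L b c)"
  proof
    fix x y
    assume xy: "(x, y) \<in> Ds c"
    note D = in_D[OF xy]
    show "L c x y \<noteq> 0" by (rule F.L_nonzero[OF D])
    show "invertible (g_mat (L c) x y)" by (rule F.invertible_g[OF D])
    show "beta (b c) x y \<noteq> 0" using sub[OF c xy] by blast
    show "kropina L b c x y = (L c x y)\<^sup>2 / beta (b c) x y" by (simp add: kropina_def)
    show "\<rho> c x y \<noteq> 0" using \<rho> D by auto
    show "L c x (t *\<^sub>R y) = t * L c x y" if "t > 0" for t by (rule F.L_homog[OF D that])
    fix i j
    show "v_cov (L c) (b c) i j x y = 0" using h c D unfolding h_vector_def by fast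
    show "L c x y * (\<Sum>h\<in>UNIV. C_up (L c) h i j x y * b c h x y) = \<rho> c x y * h_low (L c) i j x y"
      using \<rho> D by auto
    show "h_cov (L c) (b c) i j x y = h_cov (L c) (b c) j i x y"
      using grad c D unfolding gradient_def by fast
    show "(\<Sum>r\<in>UNIV. (\<Sum>k\<in>UNIV. h_cov (L c) (b c) r k x y * y $ k) * C_up (L c) r i j x y) = 0"
      by (rule C[OF c D])
  next
    show "smooth_on (Ds c) (\<lambda>(x, y). L c x y)" by (rule restrict[OF F.smooth_L])
    show "smooth_on (Ds c) (\<lambda>(x, y). b c i x y)" for i
      using h c unfolding h_vector_def by (intro restrict) fast
  qed (use K.open_D K.conic in auto)
  thus thesis by (rule that)
qed

theorem theorem4p3:
  fixes M :: "'p topology" and A :: "('p, 'n::finite) chart set"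
    and D Ds :: "('p, 'n) chart \<Rightarrow> ((real^'n) \<times> (real^'n)) set"
    and L :: "('p, 'n) chart \<Rightarrow> 'n tmfun"
    and b :: "('p, 'n) chart \<Rightarrow> 'n \<Rightarrow> 'n tmfun"
    and S :: "'q topology" and A' :: "('q, 'm::finite) chart set"
    and f :: "'q \<Rightarrow> 'p"
    and N Ns :: "('q, 'm, 'p, 'n) normal"
  assumes "finsler_space M A D L"
    and "h_vector A D L b"
    and "\<And>c x y. c \<in> A \<Longrightarrow> (x, y) \<in> Ds c \<Longrightarrow> (x, y) \<in> D c \<and> beta (b c) x y \<noteq> 0"
    and "finsler_space M A Ds (kropina L b)"
    and "hypersurface M A S A' f"
    and "unit_normal_field A D L A' f N"
    and "unit_normal_field A Ds (kropina L b) A' f Ns"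
    and "gradient A D L b"
    and "tangential A D b A' f N"
    and "\<And>c x y i j. c \<in> A \<Longrightarrow> (x, y) \<in> D c \<Longrightarrow>
           (\<Sum>r\<in>UNIV. (\<Sum>k\<in>UNIV. h_cov (L c) (b c) r k x y * y $ k) * C_up (L c) r i j x y) = 0"
  shows "(hyperplane_2nd A D L A' f N \<and> M_tensor_vanishes A D L A' f N \<longrightarrow>
            hyperplane_2nd A Ds (kropina L b) A' f Ns) \<and>
         (hyperplane_3rd A D L A' f N \<longrightarrow> hyperplane_3rd A Ds (kropina L b) A' f Ns)"
proof -
  \<comment> \<open>In both claims the hypotheses amount to the vanishing of the two unstarred
    tensors, so a single pointwise statement yields both conclusions.\<close>
  have "H_tensor (kropina L b d) (rep f c d) (Ns c d) \<alpha> \<beta> u v = 0 \<and>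
      M_tensor (kropina L b d) (rep f c d) (Ns c d) \<alpha> \<beta> u v = 0"
    if HM: "H_tensor_vanishes A D L A' f N" "M_tensor_vanishes A D L A' f N"
      and cd: "c \<in> A'" "d \<in> A" and uv: "(u, v) \<in> supp_elems Ds f c d" for c d u v \<alpha> \<beta>
  proof -
    obtain \<rho> where "kropina_chart (Ds d) (L d) (b d) \<rho> (kropina L b d)"
      by (rule kropina_chartI[OF assms(1-4,8,10) cd(2)])
    then interpret kropina_chart "Ds d" "L d" "b d" \<rho> "kropina L b d" .
    have p: "(rep f c d u, tangent_lift (rep f c d) u v) \<in> Ds d" and u: "u \<in> rep_dom f c d"
      using uv by (auto simp: supp_elems_def)
    have uv': "(u, v) \<in> supp_elems D f c d"
      using p u assms(3)[OF cd(2)] by (auto simp: supp_elems_def)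
    have dim: "CARD('n) = CARD('m) + 1" "rank (\<chi> i \<alpha>. B1 (rep f c d) i \<alpha> u) = CARD('m)"
      using assms(5) cd u by (auto simp: hypersurface_def)
    have N: "is_unit_normal (L d) (rep f c d) (N c d) u v"
      using assms(6) cd uv' unfolding unit_normal_field_def by fast
    have Ns: "is_unit_normal (kropina L b d) (rep f c d) (Ns c d) u v"
      using assms(7) cd uv unfolding unit_normal_field_def by fast
    have b: "(\<Sum>i\<in>UNIV. along (rep f c d) (b d i) u v * N c d u v $ i) = 0"
      using assms(9) cd uv' unfolding tangential_def by fast
    have H: "H_tensor (L d) (rep f c d) (N c d) \<alpha> \<beta> u v = 0" for \<alpha> \<beta>
      using HM(1) cd uv' unfolding H_tensor_vanishes_def by fast
    have M: "M_tensor (L d) (rep f c d) (N c d) \<alpha> \<beta> u v = 0" for \<alpha> \<beta>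
      using HM(2) cd uv' unfolding M_tensor_vanishes_def by fast
    show ?thesis using kropina_hypersurface[OF p dim N Ns b H M] by blast
  qed
  thus ?thesis
    unfolding hyperplane_2nd_def hyperplane_3rd_def H_tensor_vanishes_def[of A Ds] M_tensor_vanishes_def[of A Ds]
    by blast
qed

end
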